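(* Let $K$ be a finite extension of $\mathbb{Q}_p$, $E$ a field of characteristic $0$, and $V$ a mixed $E$-linear Weil--Deligne representation of $K$. Then $V$ is Frobenius-semisimple if and only if $\mathrm{gr}^W_\bullet V$ is Frobenius-semisimple.
   Context: $K$ has residue field of size $q$. $W_K\le G_K=\mathrm{Gal}(\overline K/K)$ is the Weil group: elements $w$ acting on the residue field of $\overline K$ as $\sigma^{v(w)}$, $\sigma\colon x\mapsto x^p$, $v(w)\in\mathbb{Z}$. $I_K$ is inertia, and $\varphi_K\in W_K$ is a fixed geometric Frobenius, $v(\varphi_K)=-f(K/\mathbb{Q}_p)$. A Weil--Deligne representation over $E$ is a finite-dimensional $E$-vector space $V$ with a representation $\rho$ of $W_K$ on which $I_K$ acts through a finite quotient, and $N\in\mathrm{End}(V)$ with $\rho(w)N\rho(w)^{-1}=p^{v(w)}N$ for all $w\in W_K$. It is Frobenius-semisimple if $\varphi_K$ acts semisimply (equivalently, every element of $W_K$ acts semisimply). A $q$-Weil number of weight $i$ is an algebraic element $\alpha\in\overline E$ with $|\iota(\alpha)|=q^{i/2}$ for every complex embedding $\iota$ of $\overline{\mathbb Q}$. $V^i\subseteq V$ is the subspace (defined over $E$) which over $\overline E$ is the sum of generalized $\varphi_K$-eigenspaces whose eigenvalues are $q$-Weil numbers of weight $i$. $V$ is pure of weight $i$ if $V=\bigoplus_jV^j$ and $N^j\colon V^{i+j}\to V^{i-j}$ is an isomorphism for all $j\ge0$. A mixed Weil--Deligne representation is a Weil--Deligne representation $V$ with an exhaustive separated increasing filtration $W_\bullet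 V$ by Weil--Deligne subrepresentations such that $\mathrm{gr}^W_iV$ is pure of weight $i$ for all $i$. *)

theory Defs
  imports
    "HOL-Algebra.Algebraic_Closure_Type"
    "HOL-Algebra.Generated_Fields"
    "HOL-Algebra.Bij"
    "HOL-Analysis.Abstract_Metric_Spaces"
    "Jordan_Normal_Form.Missing_VectorSpace"
begin

section \<open>Finite extensions of the p-adic numbers\<close>

definition nonarchimedean_absolute_value :: "'k ring \<Rightarrow> ('k \<Rightarrow> real) \<Rightarrow> bool" where
  "nonarchimedean_absolute_value L a \<longleftrightarrow>
     (\<forall>x\<in>carrier L. 0 \<le> a x \<and> (a x = 0 \<longleftrightarrow> x = \<zero>\<^bsub>L\<^esub>)) \<and>
     (\<forall>x\<in>carrier L. \<forall>y\<in>carrier L. a (x \<otimes>\<^bsub>L\<^esub> y) = a x * a y) \<and>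
     (\<forall>x\<in>carrier L. \<forall>y\<in>carrier L. a (x \<oplus>\<^bsub>L\<^esub> y) \<le> max (a x) (a y))"

text \<open>The value outside the carrier is irrelevant; it is set to 0 because the library's
  metric spaces ask for a distance function that is nonnegative and symmetric everywhere.\<close>

definition absolute_value_dist :: "'k ring \<Rightarrow> ('k \<Rightarrow> real) \<Rightarrow> 'k \<Rightarrow> 'k \<Rightarrow> real" where
  "absolute_value_dist L a x y =
     (if x \<in> carrier L \<and> y \<in> carrier L then a (x \<ominus>\<^bsub>L\<^esub> y) else 0)"

text \<open>The subfield \<open>Qp\<close> of \<open>L\<close>, with the absolute value \<open>a\<close>, is the completion of the
  prime field (a copy of the rationals) for the p-adic absolute value. By multiplicativity the
  values on integers determine \<open>a\<close> on the prime field.\<close>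

definition p_adic_numbers :: "nat \<Rightarrow> 'k ring \<Rightarrow> ('k \<Rightarrow> real) \<Rightarrow> 'k set \<Rightarrow> bool" where
  "p_adic_numbers p L a Qp \<longleftrightarrow>
     subfield Qp L \<and>
     (\<forall>n::int. n \<noteq> 0 \<longrightarrow>
        a ([n] \<cdot>\<^bsub>L\<^esub> \<one>\<^bsub>L\<^esub>) = (1 / real p) ^ multiplicity (int p) n) \<and>
     Metric_space.mcomplete Qp (absolute_value_dist L a) \<and>
     Metric_space.mtopology Qp (absolute_value_dist L a) closure_of (generate_field L {}) = Qp"

text \<open>\<open>K\<close> is a finite extension of the p-adic numbers \<open>Qp\<close>, both realised inside a fixed
  algebraic closure \<open>L\<close> of \<open>K\<close>; \<open>a\<close> is the (unique) extension to \<open>L\<close> of the p-adic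
  absolute value.\<close>

definition p_adic_field :: "nat \<Rightarrow> 'k ring \<Rightarrow> ('k \<Rightarrow> real) \<Rightarrow> 'k set \<Rightarrow> 'k set \<Rightarrow> bool" where
  "p_adic_field p L a Qp K \<longleftrightarrow>
     Factorial_Ring.prime p \<and>
     algebraic_closure L K \<and>
     nonarchimedean_absolute_value L a \<and>
     p_adic_numbers p L a Qp \<and>
     Qp \<subseteq> K \<and> ring.finite_dimension L Qp K"

text \<open>In the following, \<open>M\<close> is a subfield of \<open>L\<close>.\<close>

definition valuation_ring :: "'k ring \<Rightarrow> ('k \<Rightarrow> real) \<Rightarrow> 'k set \<Rightarrow> 'k ring" where
  "valuation_ring L a M = L\<lparr>carrier := {x \<in> M. a x \<le> 1}\<rparr>"

definition valuation_ideal :: "('k \<Rightarrow> real) \<Rightarrow> 'k set \<Rightarrow> 'k set" where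
  "valuation_ideal a M = {x \<in> M. a x < 1}"

definition residue_field :: "'k ring \<Rightarrow> ('k \<Rightarrow> real) \<Rightarrow> 'k set \<Rightarrow> 'k set ring" where
  "residue_field L a M = valuation_ring L a M Quot valuation_ideal a M"

definition residue_class :: "'k ring \<Rightarrow> ('k \<Rightarrow> real) \<Rightarrow> 'k set \<Rightarrow> 'k \<Rightarrow> 'k set" where
  "residue_class L a M x = valuation_ideal a M +>\<^bsub>valuation_ring L a M\<^esub> x"

definition residue_card :: "'k ring \<Rightarrow> ('k \<Rightarrow> real) \<Rightarrow> 'k set \<Rightarrow> nat" where
  "residue_card L a K = card (carrier (residue_field L a K))"

text \<open>The residue degree of \<open>K\<close> over \<open>Qp\<close> is \<open>f\<close>: the residue field of \<open>K\<close> has dimension \<open>f\<close>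
  over the image in it of the ring of integers of \<open>Qp\<close>.\<close>

definition has_residue_degree ::
    "'k ring \<Rightarrow> ('k \<Rightarrow> real) \<Rightarrow> 'k set \<Rightarrow> 'k set \<Rightarrow> nat \<Rightarrow> bool" where
  "has_residue_degree L a Qp K f \<longleftrightarrow>
     ring.dimension (residue_field L a K) f
       (residue_class L a K ` carrier (valuation_ring L a Qp)) (carrier (residue_field L a K))"


section \<open>The Weil group\<close>

definition galois_group :: "'k ring \<Rightarrow> 'k set \<Rightarrow> ('k \<Rightarrow> 'k) monoid" where
  "galois_group L K =
     (BijGroup (carrier L))
       \<lparr>carrier := {g \<in> Bij (carrier L). g \<in> ring_hom L L \<and> (\<forall>x\<in>K. g x = x)}\<rparr>"

definition residue_frobenius :: "nat \<Rightarrow> 'k ring \<Rightarrow> ('k \<Rightarrow> real) \<Rightarrow> 'k set \<Rightarrow> 'k set" where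
  "residue_frobenius p L a =
     (\<lambda>x\<in>carrier (residue_field L a (carrier L)). x [^]\<^bsub>residue_field L a (carrier L)\<^esub> p)"

text \<open>\<open>w\<close> acts on the residue field of \<open>L\<close> as the \<open>n\<close>-th power (in the group of
  permutations of the residue field) of \<open>x \<mapsto> x ^ p\<close>, i.e. \<open>v(w) = n\<close>.\<close>

definition has_weil_degree ::
    "nat \<Rightarrow> 'k ring \<Rightarrow> ('k \<Rightarrow> real) \<Rightarrow> ('k \<Rightarrow> 'k) \<Rightarrow> int \<Rightarrow> bool" where
  "has_weil_degree p L a w n \<longleftrightarrow>
     (\<forall>x\<in>carrier (valuation_ring L a (carrier L)).
        residue_class L a (carrier L) (w x) =
        (residue_frobenius p L a [^]\<^bsub>BijGroup (carrier (residue_field L a (carrier L)))\<^esub> n)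
          (residue_class L a (carrier L) x))"

definition weil_group ::
    "nat \<Rightarrow> 'k ring \<Rightarrow> ('k \<Rightarrow> real) \<Rightarrow> 'k set \<Rightarrow> ('k \<Rightarrow> 'k) monoid" where
  "weil_group p L a K =
     (galois_group L K)
       \<lparr>carrier := {w \<in> carrier (galois_group L K). \<exists>n. has_weil_degree p L a w n}\<rparr>"

definition inertia_group ::
    "'k ring \<Rightarrow> ('k \<Rightarrow> real) \<Rightarrow> 'k set \<Rightarrow> ('k \<Rightarrow> 'k) monoid" where
  "inertia_group L a K =
     (galois_group L K)
       \<lparr>carrier := {w \<in> carrier (galois_group L K).
          \<forall>x\<in>carrier (valuation_ring L a (carrier L)).
            residue_class L a (carrier L) (w x) = residue_class L a (carrier L) x}\<rparr>"

definition geometric_frobenius ::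
    "nat \<Rightarrow> 'k ring \<Rightarrow> ('k \<Rightarrow> real) \<Rightarrow> 'k set \<Rightarrow> 'k set \<Rightarrow> ('k \<Rightarrow> 'k) \<Rightarrow> bool" where
  "geometric_frobenius p L a Qp K frob \<longleftrightarrow>
     frob \<in> carrier (weil_group p L a K) \<and>
     (\<exists>f. has_residue_degree L a Qp K f \<and> has_weil_degree p L a frob (- int f))"


section \<open>Constructions on vector spaces\<close>

text \<open>The multiplicative fields \<open>mult\<close> and \<open>one\<close> that a module record inherits from the
  record of rings carry no meaning and are left \<open>undefined\<close>.\<close>

definition coset_map ::
    "('e, 'v, 'm) module_scheme \<Rightarrow> 'v set \<Rightarrow> ('v \<Rightarrow> 'v) \<Rightarrow> 'v set \<Rightarrow> 'v set" where
  "coset_map M U f Y = (\<Union>x\<in>Y. U +>\<^bsub>M\<^esub> f x)"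

definition quotient_module ::
    "('e, 'v, 'm) module_scheme \<Rightarrow> 'v set \<Rightarrow> ('e, 'v set) module" where
  "quotient_module M U =
     \<lparr>carrier = a_rcosets\<^bsub>M\<^esub> U, monoid.mult = undefined, one = undefined,
      zero = U, add = set_add M,
      module.smult = (\<lambda>c. coset_map M U (\<lambda>x. c \<odot>\<^bsub>M\<^esub> x))\<rparr>"

definition semisimple_endomorphism ::
    "'e ring \<Rightarrow> ('e, 'v, 'm) module_scheme \<Rightarrow> ('v \<Rightarrow> 'v) \<Rightarrow> bool" where
  "semisimple_endomorphism E V T \<longleftrightarrow>
     (\<forall>U. subspace E U V \<and> T ` U \<subseteq> U \<longrightarrow>
        (\<exists>U'. subspace E U' V \<and> T ` U' \<subseteq> U' \<and>
              U \<inter> U' = {\<zero>\<^bsub>V\<^esub>} \<and> U <+>\<^bsub>V\<^esub> U' = carrier V))"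

text \<open>\<open>V\<close> is the internal direct sum of the subspaces \<open>Y j\<close>, indexed by the integers.\<close>

definition internal_direct_sum ::
    "('e, 'v, 'm) module_scheme \<Rightarrow> (int \<Rightarrow> 'v set) \<Rightarrow> bool" where
  "internal_direct_sum V Y \<longleftrightarrow>
     (\<forall>v\<in>carrier V. \<exists>!f. (\<forall>j. f j \<in> Y j) \<and> finite {j. f j \<noteq> \<zero>\<^bsub>V\<^esub>} \<and>
        v = finsum V f {j. f j \<noteq> \<zero>\<^bsub>V\<^esub>})"

definition generalized_eigenspace ::
    "('e, 'v, 'm) module_scheme \<Rightarrow> ('v \<Rightarrow> 'v) \<Rightarrow> 'e \<Rightarrow> 'v set" where
  "generalized_eigenspace V T \<alpha> =
     {x \<in> carrier V. \<exists>n. ((\<lambda>y. T y \<ominus>\<^bsub>V\<^esub> \<alpha> \<odot>\<^bsub>V\<^esub> y) ^^ n) x = \<zero>\<^bsub>V\<^esub>}"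


subsection \<open>Extension of scalars\<close>

text \<open>For a subfield \<open>E\<close> of \<open>F\<close> and a vector space \<open>V\<close> over \<open>E\<close>, the \<open>F\<close>-vector space
  \<open>F \<otimes>\<^sub>E V\<close> is constructed as the free \<open>F\<close>-vector space on the set \<open>V\<close>, whose basis
  vectors stand for the tensors \<open>1 \<otimes> x\<close>, modulo the relations of additivity and
  \<open>E\<close>-linearity in \<open>x\<close>.\<close>

definition free_module :: "'e ring \<Rightarrow> 'v set \<Rightarrow> ('e, 'v \<Rightarrow> 'e) module" where
  "free_module F S =
     (ring.func_space F S)
       \<lparr>carrier := {s \<in> S \<rightarrow>\<^sub>E carrier F. finite {x \<in> S. s x \<noteq> \<zero>\<^bsub>F\<^esub>}}\<rparr>"

definition free_basis :: "'e ring \<Rightarrow> 'v set \<Rightarrow> 'v \<Rightarrow> 'v \<Rightarrow> 'e" where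
  "free_basis F S x = (\<lambda>y\<in>S. if y = x then \<one>\<^bsub>F\<^esub> else \<zero>\<^bsub>F\<^esub>)"

definition free_map :: "'e ring \<Rightarrow> 'v set \<Rightarrow> ('v \<Rightarrow> 'v) \<Rightarrow> ('v \<Rightarrow> 'e) \<Rightarrow> 'v \<Rightarrow> 'e" where
  "free_map F S T s = (\<lambda>y\<in>S. finsum F s {x \<in> S. s x \<noteq> \<zero>\<^bsub>F\<^esub> \<and> T x = y})"

definition tensor_relations ::
    "'e ring \<Rightarrow> 'e set \<Rightarrow> ('e, 'v, 'm) module_scheme \<Rightarrow> ('v \<Rightarrow> 'e) set" where
  "tensor_relations F E V =
     (let P = free_module F (carrier V); b = free_basis F (carrier V) in
      module.span F P
        ({b (x \<oplus>\<^bsub>V\<^esub> y) \<ominus>\<^bsub>P\<^esub> (b x \<oplus>\<^bsub>P\<^esub> b y) | x y. x \<in> carrier V \<and> y \<in> carrier V} \<union>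
         {b (c \<odot>\<^bsub>V\<^esub> x) \<ominus>\<^bsub>P\<^esub> (c \<odot>\<^bsub>P\<^esub> b x) | c x. c \<in> E \<and> x \<in> carrier V}))"

definition extend_scalars ::
    "'e ring \<Rightarrow> 'e set \<Rightarrow> ('e, 'v, 'm) module_scheme \<Rightarrow> ('e, ('v \<Rightarrow> 'e) set) module" where
  "extend_scalars F E V =
     quotient_module (free_module F (carrier V)) (tensor_relations F E V)"

definition one_tensor ::
    "'e ring \<Rightarrow> 'e set \<Rightarrow> ('e, 'v, 'm) module_scheme \<Rightarrow> 'v \<Rightarrow> ('v \<Rightarrow> 'e) set" where
  "one_tensor F E V x =
     tensor_relations F E V +>\<^bsub>free_module F (carrier V)\<^esub> free_basis F (carrier V) x"

definition extend_scalars_map ::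
    "'e ring \<Rightarrow> 'e set \<Rightarrow> ('e, 'v, 'm) module_scheme \<Rightarrow> ('v \<Rightarrow> 'v) \<Rightarrow>
     ('v \<Rightarrow> 'e) set \<Rightarrow> ('v \<Rightarrow> 'e) set" where
  "extend_scalars_map F E V T =
     coset_map (free_module F (carrier V)) (tensor_relations F E V) (free_map F (carrier V) T)"


section \<open>Weil--Deligne representations\<close>

record ('e, 'v, 'w) wd_rep = "('e, 'v) module" +
  weil_action :: "'w \<Rightarrow> 'v \<Rightarrow> 'v"
  monodromy :: "'v \<Rightarrow> 'v"

text \<open>\<open>E\<close> is the coefficient field. The relation between action and monodromy is
  \<open>\<rho>(w) N \<rho>(w)\<^sup>-\<^sup>1 = p\<^sup>v\<^sup>(\<^sup>w\<^sup>) N\<close> composed with \<open>\<rho>(w)\<close> on the right.\<close>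

definition weil_deligne_rep ::
    "nat \<Rightarrow> 'k ring \<Rightarrow> ('k \<Rightarrow> real) \<Rightarrow> 'k set \<Rightarrow> 'e ring \<Rightarrow> ('e, 'v, 'k \<Rightarrow> 'k) wd_rep \<Rightarrow> bool" where
  "weil_deligne_rep p L a K E V \<longleftrightarrow>
     vectorspace E V \<and> vectorspace.fin_dim E V \<and>
     (\<forall>w\<in>carrier (weil_group p L a K). weil_action V w \<in> module_hom E V V) \<and>
     (\<forall>x\<in>carrier V. weil_action V \<one>\<^bsub>weil_group p L a K\<^esub> x = x) \<and>
     (\<forall>w\<in>carrier (weil_group p L a K). \<forall>w'\<in>carrier (weil_group p L a K). \<forall>x\<in>carrier V.
        weil_action V (w \<otimes>\<^bsub>weil_group p L a K\<^esub> w') x = weil_action V w (weil_action V w' x)) \<and>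
     (\<exists>H. H \<lhd> inertia_group L a K \<and> finite (carrier (inertia_group L a K Mod H)) \<and>
        (\<forall>h\<in>H. \<forall>x\<in>carrier V. weil_action V h x = x)) \<and>
     monodromy V \<in> module_hom E V V \<and>
     (\<forall>w\<in>carrier (weil_group p L a K). \<forall>n. has_weil_degree p L a w n \<longrightarrow>
        (\<forall>x\<in>carrier V. weil_action V w (monodromy V x) =
           (([p] \<cdot>\<^bsub>E\<^esub> \<one>\<^bsub>E\<^esub>) [^]\<^bsub>E\<^esub> n) \<odot>\<^bsub>V\<^esub> monodromy V (weil_action V w x)))"

text \<open>\<open>frob\<close> is the chosen geometric Frobenius.\<close>

definition frobenius_semisimple ::
    "'e ring \<Rightarrow> ('k \<Rightarrow> 'k) \<Rightarrow> ('e, 'v, 'k \<Rightarrow> 'k) wd_rep \<Rightarrow> bool" where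
  "frobenius_semisimple E frob V \<longleftrightarrow> semisimple_endomorphism E V (weil_action V frob)"

definition weil_deligne_subrep ::
    "nat \<Rightarrow> 'k ring \<Rightarrow> ('k \<Rightarrow> real) \<Rightarrow> 'k set \<Rightarrow> 'e ring \<Rightarrow> ('e, 'v, 'k \<Rightarrow> 'k) wd_rep \<Rightarrow>
     'v set \<Rightarrow> bool" where
  "weil_deligne_subrep p L a K E V U \<longleftrightarrow>
     subspace E U V \<and>
     (\<forall>w\<in>carrier (weil_group p L a K). weil_action V w ` U \<subseteq> U) \<and>
     monodromy V ` U \<subseteq> U"

definition wd_quotient ::
    "('e, 'v, 'w) wd_rep \<Rightarrow> 'v set \<Rightarrow> ('e, 'v set, 'w) wd_rep" where
  "wd_quotient V U =
     module.extend (quotient_module V U)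
       (wd_rep.fields (\<lambda>w. coset_map V U (weil_action V w)) (coset_map V U (monodromy V)))"

definition wd_direct_sum ::
    "(int \<Rightarrow> ('e, 'v, 'w) wd_rep) \<Rightarrow> ('e, int \<Rightarrow> 'v, 'w) wd_rep" where
  "wd_direct_sum Y =
     \<lparr>carrier = {f. (\<forall>i. f i \<in> carrier (Y i)) \<and> finite {i. f i \<noteq> \<zero>\<^bsub>Y i\<^esub>}},
      monoid.mult = undefined, one = undefined,
      zero = (\<lambda>i. \<zero>\<^bsub>Y i\<^esub>), add = (\<lambda>f g i. f i \<oplus>\<^bsub>Y i\<^esub> g i),
      module.smult = (\<lambda>c f i. c \<odot>\<^bsub>Y i\<^esub> f i),
      weil_action = (\<lambda>w f i. weil_action (Y i) w (f i)),
      monodromy = (\<lambda>f i. monodromy (Y i) (f i))\<rparr>"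


section \<open>Purity\<close>

text \<open>\<open>F\<close> is a field of characteristic 0. The algebraic closure of the rationals is taken
  inside \<open>F\<close>.\<close>

definition algebraic_numbers :: "'e ring \<Rightarrow> 'e set" where
  "algebraic_numbers F =
     {x \<in> carrier F. \<not> ring.transcendental F (generate_field F {}) x}"

definition weil_number :: "nat \<Rightarrow> 'e ring \<Rightarrow> int \<Rightarrow> 'e \<Rightarrow> bool" where
  "weil_number q F i \<alpha> \<longleftrightarrow>
     \<alpha> \<in> algebraic_numbers F \<and>
     (\<forall>\<iota> \<in> ring_hom (F\<lparr>carrier := algebraic_numbers F\<rparr>)
              (ring_of_type_algebra :: complex ring).
        cmod (\<iota> \<alpha>) = real q powr (real_of_int i / 2))"

text \<open>\<open>F\<close> is an algebraic closure of \<open>E\<close>. Since the sum of generalized eigenspaces is defined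
  over \<open>E\<close>, the corresponding \<open>E\<close>-subspace of \<open>V\<close> consists of the \<open>x\<close> for which
  \<open>1 \<otimes> x\<close> lies in that sum. All Weil numbers \<open>\<alpha>\<close> may be allowed, as the generalized
  eigenspace vanishes unless \<open>\<alpha>\<close> is an eigenvalue.\<close>

definition weight_space ::
    "nat \<Rightarrow> 'e ring \<Rightarrow> 'e set \<Rightarrow> ('k \<Rightarrow> 'k) \<Rightarrow> ('e, 'v, 'k \<Rightarrow> 'k) wd_rep \<Rightarrow> int \<Rightarrow> 'v set" where
  "weight_space q F E frob V i =
     {x \<in> carrier V. one_tensor F E V x \<in>
        module.span F (extend_scalars F E V)
          (\<Union>\<alpha>\<in>{\<alpha>. weil_number q F i \<alpha>}.
             generalized_eigenspace (extend_scalars F E V)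
               (extend_scalars_map F E V (weil_action V frob)) \<alpha>)}"

definition pure_of_weight ::
    "nat \<Rightarrow> 'e ring \<Rightarrow> 'e set \<Rightarrow> ('k \<Rightarrow> 'k) \<Rightarrow> int \<Rightarrow> ('e, 'v, 'k \<Rightarrow> 'k) wd_rep \<Rightarrow> bool" where
  "pure_of_weight q F E frob i V \<longleftrightarrow>
     internal_direct_sum V (weight_space q F E frob V) \<and>
     (\<forall>j::nat. bij_betw (monodromy V ^^ j)
        (weight_space q F E frob V (i + int j)) (weight_space q F E frob V (i - int j)))"

definition graded_piece ::
    "('e, 'v, 'w) wd_rep \<Rightarrow> (int \<Rightarrow> 'v set) \<Rightarrow> int \<Rightarrow> ('e, 'v set, 'w) wd_rep" where
  "graded_piece V W i = wd_quotient (V\<lparr>carrier := W i\<rparr>) (W (i - 1))"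

definition associated_graded ::
    "('e, 'v, 'w) wd_rep \<Rightarrow> (int \<Rightarrow> 'v set) \<Rightarrow> ('e, int \<Rightarrow> 'v set, 'w) wd_rep" where
  "associated_graded V W = wd_direct_sum (graded_piece V W)"

text \<open>\<open>V\<close> with the filtration \<open>W\<close> is a mixed Weil--Deligne representation of \<open>K\<close> over the
  subfield \<open>E\<close> of its algebraic closure \<open>F\<close>.\<close>

definition mixed_weil_deligne_rep ::
    "nat \<Rightarrow> 'k ring \<Rightarrow> ('k \<Rightarrow> real) \<Rightarrow> 'k set \<Rightarrow> ('k \<Rightarrow> 'k) \<Rightarrow> 'e ring \<Rightarrow> 'e set \<Rightarrow>
     ('e, 'v, 'k \<Rightarrow> 'k) wd_rep \<Rightarrow> (int \<Rightarrow> 'v set) \<Rightarrow> bool" where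
  "mixed_weil_deligne_rep p L a K frob F E V W \<longleftrightarrow>
     weil_deligne_rep p L a K (F\<lparr>carrier := E\<rparr>) V \<and>
     (\<forall>i. weil_deligne_subrep p L a K (F\<lparr>carrier := E\<rparr>) V (W i)) \<and>
     mono W \<and> (\<Union>i. W i) = carrier V \<and> (\<Inter>i. W i) = {\<zero>\<^bsub>V\<^esub>} \<and>
     (\<forall>i. pure_of_weight (residue_card L a K) F E frob i (graded_piece V W i))"

end

theory Submission
  imports Defs "HOL-Number_Theory.Cong"
begin

text \<open>Write \<open>T\<close> for the action of the geometric Frobenius on \<open>V\<close>, \<open>N\<close> for the monodromy and \<open>c\<close> for the
  scalar with \<open>T N = c N T\<close>. Semisimplicity passes to subquotients and finite direct sums. The
  mixed structure serves for the converse: if \<open>T\<close> is semisimple on the graded pieces, it is so on \<open>V\<close>.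

  The idea over an algebraically closed field is the following. The logarithm \<open>n\<close> of the unipotent part
  of \<open>T\<close> commutes with \<open>T\<close> and \<open>N\<close> and maps \<open>W i\<close> to \<open>W (i - 1)\<close>. If it maps every \<open>W i\<close> to \<open>W (i - k)\<close>
  with \<open>k > 0\<close>, it induces maps of graded pieces \<open>gr i \<rightarrow> gr (i - k)\<close> that preserve weights and commute
  with \<open>N\<close>. Such a map is zero: \<open>gr i\<close> is generated under \<open>N\<close> by vectors \<open>x\<close> of weight \<open>i + m\<close>, with
  \<open>m \<ge> 0\<close>, that \<open>N\<^sup>m\<^sup>+\<^sup>1\<close> kills, whereas \<open>i + m = (i - k) + (m + k)\<close>, so that by purity \<open>N\<^sup>m\<^sup>+\<^sup>k\<close>, hence
  \<open>N\<^sup>m\<^sup>+\<^sup>1\<close>, is injective on the vectors of this weight in \<open>gr (i - k)\<close>. So \<open>n\<close> maps every \<open>W i\<close> to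
  \<open>W (i - k - 1)\<close>, and by induction \<open>n = 0\<close>.

  To stay over the coefficient field, \<open>n\<close> is replaced by polynomials in \<open>T\<close>. In finite dimension, \<open>T\<close>
  is semisimple if and only if the algebra of polynomials in \<open>T\<close> is von Neumann regular: for
  every polynomial \<open>k\<close> there is a polynomial \<open>l\<close> with \<open>k(T) = k(T)\<^sup>2 l(T)\<close> (\<open>semisimple_iff_regular\<close>).
  Given \<open>k\<close>, one \<open>l\<close> serves finitely many multiples \<open>c\<^sup>b T\<close> on all graded pieces
  (\<open>regular_scaled_simultaneously\<close>). For \<open>h = k - k\<^sup>2 l\<close> and these \<open>b\<close>, the operators \<open>h(c\<^sup>b T)\<close>
  map every \<open>W i\<close> to \<open>W (i - 1)\<close>. They do not commute with \<open>N\<close>, but satisfy \<open>h(c\<^sup>b T) N = N h(c\<^sup>b\<^sup>+\<^sup>1 T)\<close>. The argument above therefore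
  applies to this family, at the expense of shrinking the range of \<open>b\<close> at each of its finitely many
  steps (\<open>lowering_step\<close>), and gives \<open>h(T) = 0\<close>.

  The argument needs that \<open>N\<close> lowers weights by 2 and that polynomials in \<open>T\<close> preserve them. Both
  follow from the functoriality of \<open>F \<otimes> V\<close> and its generalized eigenspaces (\<open>weight_space_hom\<close>),
  the former because \<open>c\<close> is the inverse of the cardinality \<open>p\<^sup>f\<close> of the residue field of \<open>K\<close>
  (\<open>residue_card_eq\<close>, \<open>weil_number_shift\<close>).\<close>

section \<open>Subspaces of a finite-dimensional space\<close>

context vectorspace
begin

lemma subspaceD:
  assumes "subspace K U V"
  shows "U \<subseteq> carrier V" "\<zero>\<^bsub>V\<^esub> \<in> U"
    "\<And>x y. x \<in> U \<Longrightarrow> y \<in> U \<Longrightarrow> x \<oplus>\<^bsub>V\<^esub> y \<in> U"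
    "\<And>c x. c \<in> carrier K \<Longrightarrow> x \<in> U \<Longrightarrow> c \<odot>\<^bsub>V\<^esub> x \<in> U"
    "\<And>x. x \<in> U \<Longrightarrow> \<ominus>\<^bsub>V\<^esub> x \<in> U"
    "\<And>x y. x \<in> U \<Longrightarrow> y \<in> U \<Longrightarrow> x \<ominus>\<^bsub>V\<^esub> y \<in> U"
proof -
  have s: "submodule K U V" using assms by simp
  show sub: "U \<subseteq> carrier V" and "\<zero>\<^bsub>V\<^esub> \<in> U"
    and add: "\<And>x y. x \<in> U \<Longrightarrow> y \<in> U \<Longrightarrow> x \<oplus>\<^bsub>V\<^esub> y \<in> U"
    and smult: "\<And>c x. c \<in> carrier K \<Longrightarrow> x \<in> U \<Longrightarrow> c \<odot>\<^bsub>V\<^esub> x \<in> U"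
    using s by (auto simp: submodule_def)
  show neg: "\<ominus>\<^bsub>V\<^esub> x \<in> U" if "x \<in> U" for x
    using smult[of "\<ominus>\<^bsub>K\<^esub> \<one>\<^bsub>K\<^esub>" x] that sub by (auto simp: smult_l_minus)
  show "x \<ominus>\<^bsub>V\<^esub> y \<in> U" if "x \<in> U" "y \<in> U" for x y
    using add neg that by (simp add: a_minus_def)
qed

lemma subspaceI:
  assumes "U \<subseteq> carrier V" "\<zero>\<^bsub>V\<^esub> \<in> U"
    "\<And>x y. x \<in> U \<Longrightarrow> y \<in> U \<Longrightarrow> x \<oplus>\<^bsub>V\<^esub> y \<in> U"
    "\<And>c x. c \<in> carrier K \<Longrightarrow> x \<in> U \<Longrightarrow> c \<odot>\<^bsub>V\<^esub> x \<in> U"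
  shows "subspace K U V"
proof -
  have "submodule K U V"
    by (rule submodule.intro) (use assms in \<open>auto intro: module_axioms\<close>)
  then show ?thesis
    by (auto simp: subspace_def intro: vectorspace_axioms)
qed

lemma add_minus_cancel:
  "x \<in> carrier V \<Longrightarrow> y \<in> carrier V \<Longrightarrow> y \<oplus>\<^bsub>V\<^esub> (x \<ominus>\<^bsub>V\<^esub> y) = x"
  by (simp add: a_minus_def M.a_lcomm M.r_neg)

text \<open>The dimension of a subspace, computed inside the ambient space, so that subspaces can be compared
  without passing to the vector space with a restricted carrier.\<close>

definition subspace_dim :: "'c set \<Rightarrow> nat" where
  "subspace_dim U = Max (card ` {A. A \<subseteq> U \<and> lin_indpt A})"

context
  assumes fd: fin_dim
begin

lemma finite_card_independent_subsets:
  assumes "U \<subseteq> carrier V"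
  shows "finite (card ` {A. A \<subseteq> U \<and> lin_indpt A})"
  by (rule finite_subset[of _ "{..dim}"]) (use assms li_le_dim[OF fd] in auto)

lemma subspace_dim_witness:
  assumes "subspace K U V"
  obtains A where "finite A" "A \<subseteq> U" "lin_indpt A" "card A = subspace_dim U" "span A = U"
proof -
  have U: "U \<subseteq> carrier V" using subspaceD[OF assms] by auto
  have "{} \<in> {A. A \<subseteq> U \<and> lin_indpt A}" by (auto simp: lin_dep_def)
  then have "subspace_dim U \<in> card ` {A. A \<subseteq> U \<and> lin_indpt A}"
    unfolding subspace_dim_def using finite_card_independent_subsets[OF U]
    by (intro Max_in) auto
  then obtain A where A: "A \<subseteq> U" "lin_indpt A" "card A = subspace_dim U" by auto
  have finA: "finite A" using A U fin_dim_li_fin[OF fd] by blast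
  have "span A \<subseteq> U" using A assms by (intro span_is_subset) auto
  moreover have "u \<in> span A" if u: "u \<in> U" for u
  proof (rule ccontr)
    assume n: "u \<notin> span A"
    have "u \<notin> A" using n in_own_span[of A] A U by auto
    moreover have li: "lin_indpt (A \<union> {u})"
      using n lin_dep_iff_in_span[of A u] A U u \<open>u \<notin> A\<close> by auto
    ultimately have "card (A \<union> {u}) = Suc (subspace_dim U)" using A finA by simp
    moreover have "card (A \<union> {u}) \<le> subspace_dim U"
      unfolding subspace_dim_def using finite_card_independent_subsets[OF U] A u li
      by (intro Max_ge) auto
    ultimately show False by simp
  qed
  ultimately show thesis using that A finA by blast
qed

lemma subspace_dim_le:
  assumes "subspace K U V" shows "subspace_dim U \<le> dim"
  using assms subspace_dim_witness li_le_dim[OF fd] subspaceD(1)[OF assms] by (metis subset_trans)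

lemma subspace_dim_strict_mono:
  assumes "subspace K U V" "subspace K U' V" "U \<subset> U'"
  shows "subspace_dim U < subspace_dim U'"
proof -
  obtain A where A: "finite A" "A \<subseteq> U" "lin_indpt A" "card A = subspace_dim U" "span A = U"
    using subspace_dim_witness[OF assms(1)] .
  obtain u where u: "u \<in> U'" "u \<notin> U" using assms by auto
  have U': "U' \<subseteq> carrier V" using subspaceD[OF assms(2)] by auto
  have "u \<notin> A" using u A by auto
  moreover have li: "lin_indpt (A \<union> {u})"
    using lin_dep_iff_in_span[of A u] A U' u \<open>u \<notin> A\<close> assms by auto
  ultimately have "card (A \<union> {u}) = Suc (subspace_dim U)" using A by simp
  moreover have "card (A \<union> {u}) \<le> subspace_dim U'"
    unfolding subspace_dim_def using finite_card_independent_subsets[OF U'] A u li assms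
    by (intro Max_ge) auto
  ultimately show ?thesis by simp
qed

text \<open>The images of the powers of \<open>S\<close> form a descending chain, which is stationary by
  finite-dimensionality, and an injective map can be cancelled from an equality of images.\<close>

lemma injective_endomorphism_surjective:
  assumes U: "subspace K U V" and S: "S \<in> module_hom K V V" "S ` U \<subseteq> U"
    and inj: "inj_on S U"
  shows "S ` U = U"
proof -
  define I where "I n = (S ^^ n) ` U" for n
  have I_Suc: "I (Suc n) = S ` I n" for n by (auto simp: I_def image_comp)
  have sub: "subspace K (I n) V \<and> I n \<subseteq> U" for n
  proof (induction n)
    case 0 then show ?case using U by (simp add: I_def)
  next
    case (Suc n)
    then have s: "subspace K (I n) V" and c: "I n \<subseteq> carrier V" and iU: "I n \<subseteq> U"
      using subspaceD(1) by auto
    have "subspace K (S ` I n) V"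
    proof (rule subspaceI)
      show "S ` I n \<subseteq> carrier V" using module_hom_closed[OF S(1)] c by auto
      have "S \<zero>\<^bsub>V\<^esub> = \<zero>\<^bsub>V\<^esub>"
        using mod_hom.f0_is_0[of K V V S] S module_axioms by (auto simp: mod_hom_def mod_hom_axioms_def)
      then show "\<zero>\<^bsub>V\<^esub> \<in> S ` I n" using subspaceD(2)[OF s] by (metis imageI)
      show "x \<oplus>\<^bsub>V\<^esub> y \<in> S ` I n" if "x \<in> S ` I n" "y \<in> S ` I n" for x y
        using that subspaceD(3)[OF s] c module_hom_add[OF S(1)] by (smt (verit) image_iff subsetD)
      show "a \<odot>\<^bsub>V\<^esub> x \<in> S ` I n" if "a \<in> carrier K" "x \<in> S ` I n" for a x
        using that subspaceD(4)[OF s] c module_hom_smult[OF S(1)] by (smt (verit) image_iff subsetD)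
    qed
    then show ?case using iU S by (auto simp: I_Suc)
  qed
  obtain n where n: "\<And>m. subspace_dim (I n) \<le> subspace_dim (I m)"
    using ex_has_least_nat[of "\<lambda>_. True" 0 "\<lambda>n. subspace_dim (I n)"] by auto
  have dec: "I (Suc n) \<subseteq> I n" for n
  proof (induction n)
    case 0 then show ?case using S by (auto simp: I_def)
  next
    case (Suc n) then show ?case by (auto simp: I_Suc)
  qed
  have eq: "I (Suc n) = I n"
    using subspace_dim_strict_mono[of "I (Suc n)" "I n"] sub dec n[of "Suc n"] by force
  have "I (Suc n) = I n \<Longrightarrow> S ` U = U" for n
  proof (induction n)
    case 0 then show ?case by (simp add: I_def)
  next
    case (Suc n)
    then have "S ` I (Suc n) = S ` I n" by (simp add: I_Suc)
    then have "I (Suc n) = I n"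
      using inj sub by (meson inj_on_image_eq_iff)
    then show ?case by (rule Suc.IH)
  qed
  then show ?thesis using eq by blast
qed

end

end


section \<open>Polynomials in an endomorphism\<close>

text \<open>Polynomials are represented by expressions. The only operations that are needed are evaluation,
  at operators on different spaces, and the substitution of a multiple of the variable; both are
  recursive on expressions, and different expressions of one polynomial need not be identified.\<close>

datatype 'e poly_expr =
  Var | Const 'e | Plus "'e poly_expr" "'e poly_expr" | Times "'e poly_expr" "'e poly_expr"

primrec poly_eval ::
    "('e, 'v, 'm) module_scheme \<Rightarrow> ('v \<Rightarrow> 'v) \<Rightarrow> 'e poly_expr \<Rightarrow> 'v \<Rightarrow> 'v" where
  "poly_eval V T Var = T"
| "poly_eval V T (Const c) = (\<lambda>x. c \<odot>\<^bsub>V\<^esub> x)"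
| "poly_eval V T (Plus k l) = (\<lambda>x. poly_eval V T k x \<oplus>\<^bsub>V\<^esub> poly_eval V T l x)"
| "poly_eval V T (Times k l) = (\<lambda>x. poly_eval V T k (poly_eval V T l x))"

abbreviation polys_over :: "'e ring \<Rightarrow> 'e poly_expr set" where
  "polys_over K \<equiv> {k. set_poly_expr k \<subseteq> carrier K}"

text \<open>The algebra of polynomials in \<open>T\<close> is von Neumann regular. In contrast to semisimplicity, this is a
  statement about identities between polynomials, which pass to all spaces on which \<open>T\<close> acts
  compatibly.\<close>

definition regular_endomorphism ::
    "'e ring \<Rightarrow> ('e, 'v, 'm) module_scheme \<Rightarrow> ('v \<Rightarrow> 'v) \<Rightarrow> bool" where
  "regular_endomorphism K V T \<longleftrightarrow>
     (\<forall>k\<in>polys_over K. \<exists>l\<in>polys_over K. \<forall>x\<in>carrier V.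
        poly_eval V T (Times k (Times k l)) x = poly_eval V T k x)"

locale vector_endomorphism = vectorspace K V
  for K :: "'e ring" and V :: "('e, 'v, 'm) module_scheme" (structure) +
  fixes T
  assumes endo: "T \<in> module_hom K V V"
begin

abbreviation ev :: "'e poly_expr \<Rightarrow> 'v \<Rightarrow> 'v" where
  "ev \<equiv> poly_eval V T"

lemma ev_hom: "set_poly_expr k \<subseteq> carrier K \<Longrightarrow> ev k \<in> module_hom K V V"
proof (induction k)
  case Var then show ?case using endo by simp
next
  case (Const c)
  then show ?case
    by (auto simp: module_hom_def smult_r_distr R.m_comm simp flip: smult_assoc1)
next
  case (Plus k l)
  then show ?case
    by (auto simp: module_hom_def smult_r_distr Pi_iff M.a_ac)
next
  case (Times k l)
  then show ?case by (auto simp: module_hom_def Pi_iff)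
qed

lemma ev_closed [simp]:
  "set_poly_expr k \<subseteq> carrier K \<Longrightarrow> x \<in> carrier V \<Longrightarrow> ev k x \<in> carrier V"
  using ev_hom[of k] by (auto simp: module_hom_def)

lemma ev_add: "set_poly_expr k \<subseteq> carrier K \<Longrightarrow> x \<in> carrier V \<Longrightarrow> y \<in> carrier V \<Longrightarrow>
    ev k (x \<oplus> y) = ev k x \<oplus> ev k y"
  using ev_hom[of k] by (auto simp: module_hom_def)

lemma ev_smult: "set_poly_expr k \<subseteq> carrier K \<Longrightarrow> c \<in> carrier K \<Longrightarrow> x \<in> carrier V \<Longrightarrow>
    ev k (c \<odot> x) = c \<odot> ev k x"
  using ev_hom[of k] by (auto simp: module_hom_def)

lemma ev_mod_hom: "set_poly_expr k \<subseteq> carrier K \<Longrightarrow> mod_hom K V V (ev k)"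
  using ev_hom module_axioms by (auto simp: mod_hom_def mod_hom_axioms_def)

lemma ev_zero [simp]: "set_poly_expr k \<subseteq> carrier K \<Longrightarrow> ev k \<zero> = \<zero>"
  using mod_hom.f0_is_0[OF ev_mod_hom] .

lemma ev_minus: "set_poly_expr k \<subseteq> carrier K \<Longrightarrow> x \<in> carrier V \<Longrightarrow> y \<in> carrier V \<Longrightarrow>
    ev k (x \<ominus> y) = ev k x \<ominus> ev k y"
  using mod_hom.f_minus[OF ev_mod_hom] .

lemma ev_Var_commute:
  "set_poly_expr k \<subseteq> carrier K \<Longrightarrow> x \<in> carrier V \<Longrightarrow> ev k (T x) = T (ev k x)"
proof (induction k arbitrary: x)
  case (Const c) then show ?case using module_hom_smult[OF endo] by auto
next
  case (Plus k l) then show ?case using module_hom_add[OF endo] by auto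
qed auto

lemma ev_commute:
  assumes "set_poly_expr k \<subseteq> carrier K" "set_poly_expr l \<subseteq> carrier K" "x \<in> carrier V"
  shows "ev k (ev l x) = ev l (ev k x)"
  using assms
proof (induction k arbitrary: x)
  case Var then show ?case by (simp add: ev_Var_commute)
next
  case (Const c) then show ?case by (simp add: ev_smult)
next
  case (Plus k k') then show ?case by (simp add: ev_add)
next
  case (Times k k') then show ?case by simp
qed

lemma ev_stable:
  assumes U: "subspace K U V" "T ` U \<subseteq> U" and "set_poly_expr k \<subseteq> carrier K" "x \<in> U"
  shows "ev k x \<in> U"
  using assms(3,4)
proof (induction k arbitrary: x)
  case Var then show ?case using U by auto
qed (auto intro: subspaceD[OF U(1)])

abbreviation minus_expr where
  "minus_expr k l \<equiv> Plus k (Times (Const (\<ominus>\<^bsub>K\<^esub> \<one>\<^bsub>K\<^esub>)) l)"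

lemma ev_minus_expr:
  assumes "set_poly_expr k \<subseteq> carrier K" "set_poly_expr l \<subseteq> carrier K" "x \<in> carrier V"
  shows "ev (minus_expr k l) x = ev k x \<ominus> ev l x"
  using assms by (simp add: smult_l_minus a_minus_def)

text \<open>This is the \<open>l\<close> with \<open>k (1 - k l) = k (1 - k l\<^sub>1) (1 - k l\<^sub>2)\<close>.\<close>

definition combine_expr where
  "combine_expr k l1 l2 = minus_expr (Plus l1 l2) (Times k (Times l1 l2))"

end


lemma in_set_add_iff:
  "x \<in> U <+>\<^bsub>V\<^esub> Z \<longleftrightarrow> (\<exists>u\<in>U. \<exists>z\<in>Z. x = u \<oplus>\<^bsub>V\<^esub> z)"
  by (auto simp: set_add_def set_mult_def)

context vector_endomorphism
begin

abbreviation inverts_on :: "'e poly_expr \<Rightarrow> 'e poly_expr \<Rightarrow> 'v \<Rightarrow> bool" where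
  "inverts_on k l x \<equiv> ev (Times k (Times k l)) x = ev k x"

lemma combine_expr_polys:
  assumes "k \<in> polys_over K" "l1 \<in> polys_over K" "l2 \<in> polys_over K"
  shows "combine_expr k l1 l2 \<in> polys_over K"
  using assms by (auto simp: combine_expr_def)

lemma inverts_on_combine:
  assumes k: "k \<in> polys_over K" and l: "l1 \<in> polys_over K" "l2 \<in> polys_over K"
    and x: "x \<in> carrier V" and inv: "inverts_on k l1 x \<or> inverts_on k l2 x"
  shows "inverts_on k (combine_expr k l1 l2) x"
proof -
  have 1: "ev k (ev k (ev k (ev l1 (ev l2 x)))) = ev k (ev k (ev l2 x))" if "inverts_on k l1 x"
  proof -
    have "ev k (ev k (ev k (ev l1 (ev l2 x)))) = ev k (ev l2 (ev k (ev k (ev l1 x))))"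
      using k l x by (simp add: ev_commute)
    then show ?thesis using that k l x by (simp add: ev_commute)
  qed
  have 2: "ev k (ev k (ev k (ev l1 (ev l2 x)))) = ev k (ev k (ev l1 x))" if "inverts_on k l2 x"
  proof -
    have "ev k (ev k (ev k (ev l1 (ev l2 x)))) = ev k (ev l1 (ev k (ev k (ev l2 x))))"
      using k l x by (simp add: ev_commute)
    then show ?thesis using that k l x by (simp add: ev_commute)
  qed
  have "ev k (ev k (ev (combine_expr k l1 l2) x)) =
      (ev k (ev k (ev l1 x)) \<oplus> ev k (ev k (ev l2 x))) \<ominus> ev k (ev k (ev k (ev l1 (ev l2 x))))"
    using k l x ev_minus_expr[of "Plus l1 l2" "Times k (Times l1 l2)" x]
    by (simp add: combine_expr_def ev_minus ev_add del: poly_eval.simps(2))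
  then show ?thesis
    using inv 1 2 k l x by (auto simp: a_minus_def M.a_assoc M.r_neg M.a_lcomm M.a_comm)
qed

text \<open>Witnesses \<open>l\<close> for single vectors can be combined, so it is enough to treat the vectors of a
  finite spanning set.\<close>

lemma regular_endomorphismI_pointwise:
  assumes fd: fin_dim
    and pt: "\<And>k x. k \<in> polys_over K \<Longrightarrow> x \<in> carrier V \<Longrightarrow> \<exists>l\<in>polys_over K. inverts_on k l x"
  shows "regular_endomorphism K V T"
  unfolding regular_endomorphism_def
proof
  fix k assume k: "k \<in> polys_over K"
  obtain A where A: "finite A" "A \<subseteq> carrier V" "span A = carrier V"
    using fd by (auto simp: fin_dim_def)
  have "\<exists>l\<in>polys_over K. \<forall>x\<in>A. inverts_on k l x"
    using A(1,2)
  proof (induction A rule: finite_induct)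
    case empty
    have "Var \<in> polys_over K" by simp
    then show ?case by blast
  next
    case (insert a A)
    then obtain l1 l2 where l: "l1 \<in> polys_over K" "\<forall>x\<in>A. inverts_on k l1 x"
      "l2 \<in> polys_over K" "inverts_on k l2 a" using pt[OF k, of a] by auto
    show ?case
      by (rule bexI[of _ "combine_expr k l1 l2"])
        (use inverts_on_combine[OF k l(1,3)] combine_expr_polys[OF k l(1,3)] l insert.prems in blast)+
  qed
  then obtain l where l: "l \<in> polys_over K" "\<forall>x\<in>A. inverts_on k l x" by blast
  have "subspace K {x \<in> carrier V. inverts_on k l x} V"
    by (rule subspaceI) (use k l in \<open>auto simp: ev_add ev_smult\<close>)
  then have "span A \<subseteq> {x \<in> carrier V. inverts_on k l x}"
    using l A by (intro span_is_subset) auto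
  then show "\<exists>l\<in>polys_over K. \<forall>x\<in>carrier V. inverts_on k l x" using A l by blast
qed

definition cyclic :: "'v \<Rightarrow> 'v set" where
  "cyclic x = {ev a x | a. a \<in> polys_over K}"

lemma cyclic_subspace:
  assumes x: "x \<in> carrier V" shows "subspace K (cyclic x) V"
proof (rule subspaceI)
  show "cyclic x \<subseteq> carrier V" using x by (auto simp: cyclic_def)
  show "\<zero> \<in> cyclic x" unfolding cyclic_def
    using x by (intro CollectI exI[of _ "Const \<zero>\<^bsub>K\<^esub>"]) auto
  show "y \<oplus> z \<in> cyclic x" if yz: "y \<in> cyclic x" "z \<in> cyclic x" for y z
  proof -
    from yz obtain a b where "y = ev a x" "z = ev b x" "a \<in> polys_over K" "b \<in> polys_over K"
      unfolding cyclic_def by blast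
    then show ?thesis unfolding cyclic_def by (intro CollectI exI[of _ "Plus a b"]) auto
  qed
  show "c \<odot> y \<in> cyclic x" if cy: "c \<in> carrier K" "y \<in> cyclic x" for c y
  proof -
    from cy obtain a where "y = ev a x" "a \<in> polys_over K"
      unfolding cyclic_def by blast
    then show ?thesis unfolding cyclic_def using cy by (intro CollectI exI[of _ "Times (Const c) a"]) auto
  qed
qed

lemma ev_cyclic: "k \<in> polys_over K \<Longrightarrow> ev k ` cyclic x \<subseteq> cyclic x"
proof
  fix z assume k: "k \<in> polys_over K" and "z \<in> ev k ` cyclic x"
  then obtain y where "y \<in> cyclic x" and z: "z = ev k y" by blast
  then obtain a where "y = ev a x" "a \<in> polys_over K"
    unfolding cyclic_def by blast
  then show "z \<in> cyclic x"
    unfolding cyclic_def z using k by (intro CollectI exI[of _ "Times k a"]) auto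
qed

lemma self_in_cyclic: "x \<in> carrier V \<Longrightarrow> x \<in> cyclic x"
  unfolding cyclic_def by (intro CollectI exI[of _ "Const \<one>\<^bsub>K\<^esub>"]) auto

text \<open>On a stable complement of the kernel of \<open>k(T)\<close>, the operator \<open>k(T)\<close> is injective, so on each
  cyclic subspace of the complement it is bijective and has an inverse that is a polynomial in \<open>T\<close>.\<close>

lemma semisimple_imp_regular:
  assumes fd: fin_dim and ss: "semisimple_endomorphism K V T"
  shows "regular_endomorphism K V T"
proof (rule regular_endomorphismI_pointwise[OF fd])
  fix k x assume k: "k \<in> polys_over K" and x: "x \<in> carrier V"
  define U where "U = {y \<in> carrier V. ev k y = \<zero>}"
  have T_closed: "T y \<in> carrier V" if "y \<in> carrier V" for y
    using module_hom_closed[OF endo] that by auto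
  have T0: "T \<zero> = \<zero>" using ev_zero[of Var] by simp
  have "subspace K U V"
    by (rule subspaceI) (use k in \<open>auto simp: U_def ev_add ev_smult\<close>)
  moreover have "T ` U \<subseteq> U"
    using k ev_Var_commute T_closed T0 by (auto simp: U_def)
  ultimately obtain U' where U': "subspace K U' V" "T ` U' \<subseteq> U'"
    "U \<inter> U' = {\<zero>}" "U <+>\<^bsub>V\<^esub> U' = carrier V"
    using ss unfolding semisimple_endomorphism_def by blast
  have "x \<in> U <+>\<^bsub>V\<^esub> U'" using U'(4) x by simp
  then obtain u u' where u: "u \<in> U" "u' \<in> U'" "x = u \<oplus> u'"
    unfolding in_set_add_iff by blast
  have u': "u' \<in> carrier V" using u subspaceD[OF U'(1)] by auto
  have cyc: "cyclic u' \<subseteq> U'"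
    unfolding cyclic_def using ev_stable[OF U'(1,2)] u by auto
  have "inj_on (ev k) (cyclic u')"
  proof (rule inj_onI)
    fix y z assume yz: "y \<in> cyclic u'" "z \<in> cyclic u'" "ev k y = ev k z"
    then have c: "y \<in> carrier V" "z \<in> carrier V" "y \<in> U'" "z \<in> U'"
      using cyc subspaceD[OF U'(1)] by auto
    then have "ev k (y \<ominus> z) = \<zero>" using k yz by (simp add: ev_minus)
    then have "y \<ominus> z \<in> U \<inter> U'" using c subspaceD[OF U'(1)] by (auto simp: U_def)
    then have "y \<ominus> z = \<zero>" using U' by auto
    then show "y = z" using c add_minus_cancel[of y z] by simp
  qed
  then have "ev k ` cyclic u' = cyclic u'"
    using injective_endomorphism_surjective[OF fd cyclic_subspace[OF u'] ev_hom ev_cyclic] k by auto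
  then obtain a where a: "a \<in> polys_over K" "ev k (ev a u') = u'"
    using self_in_cyclic[OF u'] unfolding cyclic_def by (smt (verit) image_iff mem_Collect_eq)
  have "u \<in> carrier V" "ev k u = \<zero>" using u by (auto simp: U_def)
  moreover from this have "ev k (ev k (ev a u)) = \<zero>"
    using k a by (simp add: ev_commute[of k a])
  ultimately have "inverts_on k a x"
    using u u' k a by (simp add: ev_add)
  then show "\<exists>l\<in>polys_over K. inverts_on k l x" using a by blast
qed

text \<open>Take a vector \<open>v\<close> outside \<open>U\<close> with cyclic subspace as small as possible. If \<open>a(T) v\<close> is a nonzero element
  of \<open>U\<close> and \<open>a = a\<^sup>2 l\<close> on \<open>V\<close>, then \<open>(1 - a(T) l(T)) v\<close> also lies outside \<open>U\<close>, but is killed by \<open>a(T)\<close>, so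
  that its cyclic subspace is strictly smaller.\<close>

lemma regular_imp_disjoint_cyclic:
  assumes fd: fin_dim and reg: "regular_endomorphism K V T"
    and U: "subspace K U V" "T ` U \<subseteq> U" "U \<noteq> carrier V"
  obtains z where "z \<in> carrier V" "z \<notin> U" "U \<inter> cyclic z = {\<zero>}"
proof -
  obtain v where v: "v \<in> carrier V - U"
    and min: "\<And>w. w \<in> carrier V - U \<Longrightarrow> subspace_dim (cyclic v) \<le> subspace_dim (cyclic w)"
  proof -
    have "\<exists>w. w \<in> carrier V - U" using U subspaceD(1)[OF U(1)] by auto
    then show ?thesis
      using ex_has_least_nat[of "\<lambda>w. w \<in> carrier V - U" _ "\<lambda>w. subspace_dim (cyclic w)"] that
      by blast
  qed
  have vc: "v \<in> carrier V" using v by simp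
  have "y = \<zero>" if y: "y \<in> U" "y \<in> cyclic v" for y
  proof (rule ccontr)
    assume nz: "y \<noteq> \<zero>"
    obtain a where a: "a \<in> polys_over K" "y = ev a v" using y by (auto simp: cyclic_def)
    obtain l where l: "l \<in> polys_over K" "\<And>x. x \<in> carrier V \<Longrightarrow> inverts_on a l x"
      using reg a unfolding regular_endomorphism_def by blast
    define e where "e = minus_expr (Const \<one>\<^bsub>K\<^esub>) (Times l a)"
    have e: "e \<in> polys_over K" using a l by (auto simp: e_def)
    have ev_e: "ev e x = x \<ominus> ev l (ev a x)" if "x \<in> carrier V" for x
      using that a l ev_minus_expr[of "Const \<one>\<^bsub>K\<^esub>" "Times l a" x] by (simp add: e_def)
    have ae: "ev a (ev e x) = \<zero>" if "x \<in> carrier V" for x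
    proof -
      have "ev a (ev e x) = ev a x \<ominus> ev a (ev l (ev a x))"
        using that a l by (simp add: ev_e ev_minus)
      also have "ev a (ev l (ev a x)) = ev a (ev a (ev l x))"
        using that a l by (simp add: ev_commute)
      finally show ?thesis using l(2)[OF that] that a by (simp add: a_minus_def M.r_neg)
    qed
    define w where "w = ev e v"
    have wc: "w \<in> carrier V" using e vc by (simp add: w_def)
    have lU: "ev l y \<in> U" using ev_stable[OF U(1,2)] l y by auto
    have "w \<notin> U"
    proof
      assume "w \<in> U"
      then have "ev l y \<oplus> w \<in> U" using lU subspaceD[OF U(1)] by auto
      then have "v \<in> U" using a l vc by (simp add: w_def ev_e add_minus_cancel)
      then show False using v by simp
    qed
    have sub: "cyclic w \<subseteq> cyclic v"
    proof
      fix z assume "z \<in> cyclic w"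
      then obtain b where "b \<in> polys_over K" "z = ev (Times b e) v" by (auto simp: cyclic_def w_def)
      then show "z \<in> cyclic v" unfolding cyclic_def using e by (intro CollectI exI[of _ "Times b e"]) auto
    qed
    have "y \<notin> cyclic w"
    proof
      assume "y \<in> cyclic w"
      then obtain b where b: "b \<in> polys_over K" "y = ev b w" by (auto simp: cyclic_def)
      have "ev a y = ev b (ev a w)" using a b wc by (simp add: ev_commute)
      also have "\<dots> = \<zero>" using ae[OF vc] b by (simp add: w_def)
      finally have "ev a (ev a v) = \<zero>" using a by simp
      moreover have "ev a v = ev l (ev a (ev a v))"
        using l(2)[OF vc] a l vc by (simp add: ev_commute[of _ l])
      ultimately show False using nz a l by simp
    qed
    then have "cyclic w \<subset> cyclic v" using sub y by auto
    then have "subspace_dim (cyclic w) < subspace_dim (cyclic v)"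
      using subspace_dim_strict_mono[OF fd] cyclic_subspace wc vc by auto
    then show False using min[of w] wc \<open>w \<notin> U\<close> by simp
  qed
  then have "U \<inter> cyclic v = {\<zero>}"
    using subspaceD(2)[OF U(1)] subspaceD(2)[OF cyclic_subspace[OF vc]] by blast
  then show thesis using that v by blast
qed

lemma set_add_eq_subspace_sum: "U <+>\<^bsub>V\<^esub> Z = subspace_sum U Z"
  by (auto simp: submodule_sum_def in_set_add_iff image_iff) blast

lemma subspace_set_add:
  assumes U: "subspace K U V" and Z: "subspace K Z V"
  shows "subspace K (U <+>\<^bsub>V\<^esub> Z) V" "U \<subseteq> U <+>\<^bsub>V\<^esub> Z" "Z \<subseteq> U <+>\<^bsub>V\<^esub> Z"
  unfolding set_add_eq_subspace_sum
  using sum_is_subspace[OF U Z] in_sum_vs[OF U Z] in_sum_vs[OF Z U] vsum_comm[OF U Z] by simp_all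

lemma stable_set_add:
  assumes U: "subspace K U V" "T ` U \<subseteq> U" and Z: "subspace K Z V" "T ` Z \<subseteq> Z"
  shows "T ` (U <+>\<^bsub>V\<^esub> Z) \<subseteq> U <+>\<^bsub>V\<^esub> Z"
proof
  fix y assume "y \<in> T ` (U <+>\<^bsub>V\<^esub> Z)"
  then obtain u z where *: "u \<in> U" "z \<in> Z" "y = T (u \<oplus> z)"
    by (auto simp: in_set_add_iff)
  then have "y = T u \<oplus> T z"
    using module_hom_add[OF endo] subspaceD(1)[OF U(1)] subspaceD(1)[OF Z(1)] by auto
  then show "y \<in> U <+>\<^bsub>V\<^esub> Z" using * U Z by (force simp: in_set_add_iff)
qed

text \<open>A stable subspace of the largest possible dimension that meets \<open>U\<close> in 0 is a complement.\<close>

lemma regular_imp_semisimple: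
  assumes fd: fin_dim and reg: "regular_endomorphism K V T"
  shows "semisimple_endomorphism K V T"
  unfolding semisimple_endomorphism_def
proof (intro allI impI)
  fix U assume "subspace K U V \<and> T ` U \<subseteq> U"
  then have U: "subspace K U V" "T ` U \<subseteq> U" by auto
  note U' = subspaceD[OF U(1)]
  define P where "P Z \<longleftrightarrow> subspace K Z V \<and> T ` Z \<subseteq> Z \<and> U \<inter> Z = {\<zero>}" for Z
  have T0: "T \<zero> = \<zero>" using ev_zero[of Var] by simp
  have "P {\<zero>}" using T0 U'(2) by (auto simp: P_def intro: subspaceI)
  moreover have "\<forall>Y. P Y \<longrightarrow> subspace_dim Y < Suc dim"
    using subspace_dim_le[OF fd] by (simp add: P_def less_Suc_eq_le)
  ultimately obtain Z where Z: "P Z" and max: "\<And>Y. P Y \<Longrightarrow> subspace_dim Y \<le> subspace_dim Z"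
    using Lattices_Big.ex_has_greatest_nat[of P _ subspace_dim] by blast
  have Zs: "subspace K Z V" "T ` Z \<subseteq> Z" "U \<inter> Z = {\<zero>}" using Z by (auto simp: P_def)
  note Z' = subspaceD[OF Zs(1)]
  note sum = subspace_set_add(1)[OF U(1) Zs(1)] and st = stable_set_add[OF U Zs(1,2)]
  note sum' = subspaceD[OF sum]
  note UZ = subspace_set_add(2,3)[OF U(1) Zs(1)]
  have "U <+>\<^bsub>V\<^esub> Z = carrier V"
  proof (rule ccontr)
    assume "U <+>\<^bsub>V\<^esub> Z \<noteq> carrier V"
    then obtain z where z: "z \<in> carrier V" "z \<notin> U <+>\<^bsub>V\<^esub> Z" "(U <+>\<^bsub>V\<^esub> Z) \<inter> cyclic z = {\<zero>}"
      using regular_imp_disjoint_cyclic[OF fd reg sum st] by auto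
    note C = cyclic_subspace[OF z(1)]
    note C' = subspaceD[OF C]
    have Cst: "T ` cyclic z \<subseteq> cyclic z" using ev_cyclic[of Var z] by simp
    define Y where "Y = Z <+>\<^bsub>V\<^esub> cyclic z"
    have Ys: "subspace K Y V" using subspace_set_add(1)[OF Zs(1) C] by (simp add: Y_def)
    have "U \<inter> Y \<subseteq> {\<zero>}"
    proof
      fix u assume u: "u \<in> U \<inter> Y"
      then obtain a c where ac: "a \<in> Z" "c \<in> cyclic z" "u = a \<oplus> c"
        by (auto simp: Y_def in_set_add_iff)
      have cl: "a \<in> carrier V" "c \<in> carrier V" using ac Z'(1) C'(1) by auto
      have "u \<ominus> a \<in> U <+>\<^bsub>V\<^esub> Z" using sum'(6) UZ u ac by auto
      moreover have "u \<ominus> a = c"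
        using ac cl by (simp add: a_minus_def M.a_assoc M.a_comm[of c] M.r_neg1 M.r_neg2)
      ultimately have "c = \<zero>" using z ac by auto
      then have "u \<in> U \<inter> Z" using ac cl u by auto
      then show "u \<in> {\<zero>}" using Zs by auto
    qed
    then have "P Y"
      using Ys stable_set_add[OF Zs(1,2) C Cst] U'(2) subspaceD(2)[OF Ys] by (auto simp: P_def Y_def)
    moreover have "Z \<subset> Y"
    proof -
      have "Z \<subseteq> Y" "cyclic z \<subseteq> Y" using subspace_set_add(2,3)[OF Zs(1) C] by (simp_all add: Y_def)
      then show ?thesis using z(2) UZ(2) self_in_cyclic[OF z(1)] by blast
    qed
    ultimately show False using subspace_dim_strict_mono[OF fd Zs(1) Ys] max[of Y] by simp
  qed
  then show "\<exists>U'. subspace K U' V \<and> T ` U' \<subseteq> U' \<and> U \<inter> U' = {\<zero>} \<and> U <+>\<^bsub>V\<^esub> U' = carrier V"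
    using Zs by auto
qed

text \<open>Both conditions say that the polynomials in \<open>T\<close> form a product of fields.\<close>

theorem semisimple_iff_regular:
  "fin_dim \<Longrightarrow> semisimple_endomorphism K V T \<longleftrightarrow> regular_endomorphism K V T"
  using semisimple_imp_regular regular_imp_semisimple by blast

end

lemma poly_eval_natural:
  assumes V: "vector_endomorphism K V T" and g: "g \<in> module_hom K V W"
    and comm: "\<And>x. x \<in> carrier V \<Longrightarrow> S (g x) = g (T x)"
    and k: "set_poly_expr k \<subseteq> carrier K" and x: "x \<in> carrier V"
  shows "poly_eval W S k (g x) = g (poly_eval V T k x)"
  using k x
proof (induction k arbitrary: x)
  case Var then show ?case using comm by simp
next
  case (Const c) then show ?case using module_hom_smult[OF g] by simp
next
  case (Plus k l)
  then show ?case using module_hom_add[OF g] vector_endomorphism.ev_closed[OF V] by simp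
next
  case (Times k l)
  then show ?case using vector_endomorphism.ev_closed[OF V] by simp
qed

text \<open>The polynomial \<open>k(c X)\<close>.\<close>

primrec scale_expr :: "'e \<Rightarrow> 'e poly_expr \<Rightarrow> 'e poly_expr" where
  "scale_expr c Var = Times (Const c) Var"
| "scale_expr c (Const b) = Const b"
| "scale_expr c (Plus k l) = Plus (scale_expr c k) (scale_expr c l)"
| "scale_expr c (Times k l) = Times (scale_expr c k) (scale_expr c l)"

lemma set_scale_expr: "set_poly_expr (scale_expr c k) \<subseteq> insert c (set_poly_expr k)"
  by (induction k) auto

lemma poly_eval_scale_expr: "poly_eval V T (scale_expr c k) = poly_eval V (\<lambda>x. c \<odot>\<^bsub>V\<^esub> T x) k"
  by (induction k) auto

context vector_endomorphism
begin

lemma scaled_endomorphism: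
  assumes "c \<in> carrier K"
  shows "vector_endomorphism K V (\<lambda>x. c \<odot> T x)"
proof -
  have "(\<lambda>x. c \<odot> T x) \<in> module_hom K V V"
    using ev_hom[of "Times (Const c) Var"] assms by simp
  then show ?thesis
    using vectorspace_axioms by (simp add: vector_endomorphism_def vector_endomorphism_axioms_def)
qed

text \<open>For \<open>c \<noteq> 0\<close> the operators \<open>T\<close> and \<open>c T\<close> have the same polynomials, with \<open>k\<close> evaluated at \<open>c T\<close> being
  \<open>k(c X)\<close> evaluated at \<open>T\<close>.\<close>

lemma regular_scaled:
  assumes reg: "regular_endomorphism K V T" and c: "c \<in> carrier K" "c \<noteq> \<zero>\<^bsub>K\<^esub>"
  shows "regular_endomorphism K V (\<lambda>x. c \<odot> T x)"
  unfolding regular_endomorphism_def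
proof
  interpret S: vector_endomorphism K V "\<lambda>x. c \<odot> T x" by (rule scaled_endomorphism[OF c(1)])
  fix k assume k: "k \<in> polys_over K"
  have ic: "inv\<^bsub>K\<^esub> c \<in> carrier K" and icc: "inv\<^bsub>K\<^esub> c \<otimes>\<^bsub>K\<^esub> c = \<one>\<^bsub>K\<^esub>"
    using c field_Units by (auto)
  have "scale_expr c k \<in> polys_over K" using k c set_scale_expr[of c k] by auto
  then obtain l where l: "l \<in> polys_over K"
    "\<And>x. x \<in> carrier V \<Longrightarrow> ev (Times (scale_expr c k) (Times (scale_expr c k) l)) x = ev (scale_expr c k) x"
    using reg unfolding regular_endomorphism_def by blast
  define l' where "l' = scale_expr (inv\<^bsub>K\<^esub> c) l"
  have l': "l' \<in> polys_over K" using l(1) ic set_scale_expr[of "inv\<^bsub>K\<^esub> c" l] unfolding l'_def by auto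
  have "S.ev l' x = ev l x" if "x \<in> carrier V" for x
  proof -
    have "S.ev l' x = poly_eval V (\<lambda>x. inv\<^bsub>K\<^esub> c \<odot> (c \<odot> T x)) l (id x)"
      by (simp add: l'_def poly_eval_scale_expr)
    also have "\<dots> = id (ev l x)"
    proof (rule poly_eval_natural[OF vector_endomorphism_axioms _ _ _ that])
      show "id \<in> module_hom K V V" by (auto simp: module_hom_def)
      show "set_poly_expr l \<subseteq> carrier K" using l(1) by simp
      fix x assume "x \<in> carrier V"
      then have "T x \<in> carrier V" using ev_closed[of Var] by simp
      then show "inv\<^bsub>K\<^esub> c \<odot> (c \<odot> T (id x)) = id (T x)"
        using c ic icc by (simp flip: smult_assoc1)
    qed
    finally show ?thesis by simp
  qed
  then show "\<exists>l\<in>polys_over K. \<forall>x\<in>carrier V. S.ev (Times k (Times k l)) x = S.ev k x"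
    using l l' by (intro bexI[of _ l']) (auto simp: poly_eval_scale_expr)
qed

text \<open>As for single vectors, witnesses for different multiples of \<open>T\<close> can be combined.\<close>

lemma regular_scaled_simultaneously:
  assumes reg: "regular_endomorphism K V T" and k: "k \<in> polys_over K"
    and B: "finite B" "B \<subseteq> carrier K - {\<zero>\<^bsub>K\<^esub>}"
  obtains l where "l \<in> polys_over K"
    "\<And>c x. c \<in> B \<Longrightarrow> x \<in> carrier V \<Longrightarrow>
       poly_eval V (\<lambda>x. c \<odot> T x) (Times k (Times k l)) x = poly_eval V (\<lambda>x. c \<odot> T x) k x"
proof -
  have "\<exists>l\<in>polys_over K. \<forall>c\<in>B. \<forall>x\<in>carrier V.
       poly_eval V (\<lambda>x. c \<odot> T x) (Times k (Times k l)) x = poly_eval V (\<lambda>x. c \<odot> T x) k x"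
    using B
  proof (induction B rule: finite_induct)
    case empty
    have "Var \<in> polys_over K" by simp
    then show ?case by blast
  next
    case (insert c B)
    then have c: "c \<in> carrier K" "c \<noteq> \<zero>\<^bsub>K\<^esub>" by auto
    obtain l1 where l1: "l1 \<in> polys_over K" "\<forall>c\<in>B. \<forall>x\<in>carrier V.
       poly_eval V (\<lambda>x. c \<odot> T x) (Times k (Times k l1)) x = poly_eval V (\<lambda>x. c \<odot> T x) k x"
      using insert by blast
    obtain l2 where l2: "l2 \<in> polys_over K" "\<forall>x\<in>carrier V.
       poly_eval V (\<lambda>x. c \<odot> T x) (Times k (Times k l2)) x = poly_eval V (\<lambda>x. c \<odot> T x) k x"
      using regular_scaled[OF reg c] k unfolding regular_endomorphism_def by blast
    have "poly_eval V (\<lambda>x. b \<odot> T x) (Times k (Times k (combine_expr k l1 l2))) x =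
        poly_eval V (\<lambda>x. b \<odot> T x) k x" if "b \<in> insert c B" "x \<in> carrier V" for b x
    proof -
      have "b \<in> carrier K" using that insert.prems by auto
      then show ?thesis
        using vector_endomorphism.inverts_on_combine[OF scaled_endomorphism k l1(1) l2(1) that(2)]
          that l1 l2 by blast
    qed
    then show ?case using combine_expr_polys[OF k l1(1) l2(1)] by blast
  qed
  then show thesis using that by blast
qed

end


section \<open>Quotients\<close>

text \<open>Quotient representations are extensions of the record of the quotient module, and their ring
  multiplication is unspecified, so that being a module has to be carried over operation by
  operation.\<close>

lemma module_cong:
  assumes M: "module R M"
    and eq: "carrier M' = carrier M" "add M' = add M" "zero M' = zero M"
      "module.smult M' = module.smult M"
  shows "module R M'"
proof -
  interpret module R M by (rule M)
  have "\<exists>y\<in>carrier M. x \<oplus>\<^bsub>M\<^esub> y = \<zero>\<^bsub>M\<^esub>" if "x \<in> carrier M" for x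
    using that M.r_neg by blast
  then show ?thesis
    by (intro module_criteria) (auto simp: eq M.a_ac smult_assoc1 smult_l_distr smult_r_distr R.is_cring)
qed

locale quotient_space = module R M
  for R :: "('e, 'n) ring_scheme" and M :: "('e, 'v, 'm) module_scheme" (structure) and U +
  assumes sub: "submodule R U M"
begin

lemma U_closed:
  shows "U \<subseteq> carrier M" "\<zero> \<in> U"
    "\<And>x y. x \<in> U \<Longrightarrow> y \<in> U \<Longrightarrow> x \<oplus> y \<in> U"
    "\<And>c x. c \<in> carrier R \<Longrightarrow> x \<in> U \<Longrightarrow> c \<odot> x \<in> U"
    "\<And>x. x \<in> U \<Longrightarrow> \<ominus> x \<in> U"
proof -
  show sb: "U \<subseteq> carrier M" and "\<zero> \<in> U"
    and "\<And>x y. x \<in> U \<Longrightarrow> y \<in> U \<Longrightarrow> x \<oplus> y \<in> U"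
    and sm: "\<And>c x. c \<in> carrier R \<Longrightarrow> x \<in> U \<Longrightarrow> c \<odot> x \<in> U"
    using sub by (auto simp: submodule_def)
  show "\<ominus> x \<in> U" if "x \<in> U" for x
    using sm[of "\<ominus>\<^bsub>R\<^esub> \<one>\<^bsub>R\<^esub>" x] that sb by (auto simp: smult_l_minus)
qed

sublocale abelian_subgroup U M
proof (rule abelian_subgroupI3)
  show "additive_subgroup U M"
    by (rule additive_subgroupI) (use U_closed in \<open>auto intro!: M.add.subgroupI simp flip: a_inv_def\<close>)
qed (rule M.abelian_group_axioms)

abbreviation cls where "cls x \<equiv> U +> x"
abbreviation Q where "Q \<equiv> quotient_module M U"

lemma quotient_sel:
  "carrier Q = cls ` carrier M" "zero Q = U" "add Q = set_add M"
  "module.smult Q c = coset_map M U (\<lambda>x. c \<odot> x)"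
  by (auto simp: quotient_module_def A_RCOSETS_def' )

lemma cls_eq_iff:
  assumes "x \<in> carrier M" "y \<in> carrier M"
  shows "cls x = cls y \<longleftrightarrow> x \<ominus> y \<in> U"
proof
  assume "cls x = cls y"
  then have "x \<in> cls y" using a_rcos_self[OF assms(1)] by simp
  then show "x \<ominus> y \<in> U" using assms
    by (simp add: a_minus_def a_rcos_module)
next
  assume "x \<ominus> y \<in> U"
  then have "x \<in> cls y" using assms by (simp add: a_minus_def a_rcos_module)
  then show "cls x = cls y" using a_repr_independence[OF _ assms(2) a_subgroup] by metis
qed

lemma cls_zero: "cls \<zero> = U"
  using a_coset_add_zero[OF U_closed(1)] .

lemma cls_eq_U_iff: "x \<in> carrier M \<Longrightarrow> cls x = U \<longleftrightarrow> x \<in> U"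
  using a_coset_join2[OF _ a_subgroup] a_rcos_self by metis

lemma cls_add: "x \<in> carrier M \<Longrightarrow> y \<in> carrier M \<Longrightarrow> cls x \<oplus>\<^bsub>Q\<^esub> cls y = cls (x \<oplus> y)"
  using a_rcos_sum[of x y] by (simp add: quotient_sel)

lemma coset_map_cls:
  assumes Q': "quotient_space R M' U'" and f: "f \<in> module_hom R M M'" "f ` U \<subseteq> U'"
    and x: "x \<in> carrier M"
  shows "coset_map M' U' f (cls x) = U' +>\<^bsub>M'\<^esub> f x"
proof -
  interpret Q': quotient_space R M' U' by (rule Q')
  have "U' +>\<^bsub>M'\<^esub> f y = U' +>\<^bsub>M'\<^esub> f x" if y: "y \<in> cls x" for y
  proof -
    obtain u where u: "u \<in> U" "y = u \<oplus> x" using y by (auto simp: a_r_coset_def')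
    then have uc: "u \<in> carrier M" using U_closed by auto
    have fx: "f x \<in> carrier M'" "f u \<in> carrier M'" "f u \<in> U'"
      using module_hom_closed[OF f(1)] x uc u f(2) by auto
    have "f y = f u \<oplus>\<^bsub>M'\<^esub> f x" using module_hom_add[OF f(1) uc x] u by simp
    then have "f y \<ominus>\<^bsub>M'\<^esub> f x = f u" using fx by (simp add: a_minus_def Q'.M.a_assoc Q'.M.r_neg)
    then show ?thesis
      using Q'.cls_eq_iff[of "f y" "f x"] fx \<open>f y = _\<close> by simp
  qed
  moreover have "x \<in> cls x" using a_rcos_self[OF x] .
  ultimately show ?thesis unfolding coset_map_def by blast
qed

lemma cls_smult:
  assumes "c \<in> carrier R" "x \<in> carrier M"
  shows "c \<odot>\<^bsub>Q\<^esub> cls x = cls (c \<odot> x)"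
proof -
  have "(\<lambda>x. c \<odot> x) \<in> module_hom R M M"
    using assms by (auto simp: module_hom_def smult_r_distr R.m_comm simp flip: smult_assoc1)
  then show ?thesis
    using coset_map_cls[OF quotient_space_axioms, of "\<lambda>x. c \<odot> x" x] assms U_closed
    by (auto simp: quotient_sel)
qed

lemma module_quotient: "module R Q"
proof (rule module_criteria)
  show "cring R" by (rule R.is_cring)
  show "\<zero>\<^bsub>Q\<^esub> \<in> carrier Q" by (auto simp: quotient_sel image_iff intro!: bexI[of _ "\<zero>"] cls_zero[symmetric])
  have z: "\<zero>\<^bsub>Q\<^esub> = cls \<zero>" by (simp add: quotient_sel cls_zero)
  have c: "carrier Q = cls ` carrier M" by (simp add: quotient_sel)
  show "\<forall>v w. v \<in> carrier Q \<and> w \<in> carrier Q \<longrightarrow> v \<oplus>\<^bsub>Q\<^esub> w \<in> carrier Q"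
    unfolding c by (auto simp: cls_add)
  show "\<forall>v\<in>carrier Q. \<exists>w\<in>carrier Q. v \<oplus>\<^bsub>Q\<^esub> w = \<zero>\<^bsub>Q\<^esub>"
  proof
    fix v assume "v \<in> carrier Q"
    then obtain x where x: "x \<in> carrier M" "v = cls x" unfolding c by auto
    then show "\<exists>w\<in>carrier Q. v \<oplus>\<^bsub>Q\<^esub> w = \<zero>\<^bsub>Q\<^esub>" unfolding c z
      by (intro bexI[of _ "cls (\<ominus> x)"]) (auto simp: cls_add M.r_neg)
  qed
  show "\<forall>a v. a \<in> carrier R \<and> v \<in> carrier Q \<longrightarrow> a \<odot>\<^bsub>Q\<^esub> v \<in> carrier Q"
    unfolding c by (auto simp: cls_smult)
  show "\<forall>v w. v \<in> carrier Q \<and> w \<in> carrier Q \<longrightarrow> v \<oplus>\<^bsub>Q\<^esub> w = w \<oplus>\<^bsub>Q\<^esub> v"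
    unfolding c by (auto simp: cls_add M.a_comm)
  show "\<forall>v w x. v \<in> carrier Q \<and> w \<in> carrier Q \<and> x \<in> carrier Q \<longrightarrow>
      v \<oplus>\<^bsub>Q\<^esub> w \<oplus>\<^bsub>Q\<^esub> x = v \<oplus>\<^bsub>Q\<^esub> (w \<oplus>\<^bsub>Q\<^esub> x)"
    unfolding c by (auto simp: cls_add M.a_assoc)
  show "\<forall>v\<in>carrier Q. v \<oplus>\<^bsub>Q\<^esub> \<zero>\<^bsub>Q\<^esub> = v" unfolding c z by (auto simp: cls_add)
  show "\<forall>a b v. a \<in> carrier R \<and> b \<in> carrier R \<and> v \<in> carrier Q \<longrightarrow>
      (a \<otimes>\<^bsub>R\<^esub> b) \<odot>\<^bsub>Q\<^esub> v = a \<odot>\<^bsub>Q\<^esub> (b \<odot>\<^bsub>Q\<^esub> v)"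
    unfolding c by (auto simp: cls_smult smult_assoc1)
  show "\<forall>v\<in>carrier Q. \<one>\<^bsub>R\<^esub> \<odot>\<^bsub>Q\<^esub> v = v" unfolding c by (auto simp: cls_smult)
  show "\<forall>a b v. a \<in> carrier R \<and> b \<in> carrier R \<and> v \<in> carrier Q \<longrightarrow>
      (a \<oplus>\<^bsub>R\<^esub> b) \<odot>\<^bsub>Q\<^esub> v = a \<odot>\<^bsub>Q\<^esub> v \<oplus>\<^bsub>Q\<^esub> b \<odot>\<^bsub>Q\<^esub> v"
    unfolding c by (auto simp: cls_smult cls_add smult_l_distr)
  show "\<forall>a v w. a \<in> carrier R \<and> v \<in> carrier Q \<and> w \<in> carrier Q \<longrightarrow>
      a \<odot>\<^bsub>Q\<^esub> (v \<oplus>\<^bsub>Q\<^esub> w) = a \<odot>\<^bsub>Q\<^esub> v \<oplus>\<^bsub>Q\<^esub> a \<odot>\<^bsub>Q\<^esub> w"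
    unfolding c by (auto simp: cls_smult cls_add smult_r_distr)
qed

lemma cls_hom: "cls \<in> module_hom R M Q"
  by (auto simp: module_hom_def quotient_sel(1) cls_add cls_smult)

lemma coset_map_hom:
  assumes Q': "quotient_space R M' U'" and f: "f \<in> module_hom R M M'" "f ` U \<subseteq> U'"
  shows "coset_map M' U' f \<in> module_hom R Q (quotient_module M' U')"
proof -
  interpret Q': quotient_space R M' U' by (rule Q')
  note cm = coset_map_cls[OF Q' f]
  have "f x \<in> carrier M'" if "x \<in> carrier M" for x using module_hom_closed[OF f(1)] that by auto
  then show ?thesis
    by (auto simp: module_hom_def quotient_sel(1) Q'.quotient_sel(1) cm cls_add cls_smult
      Q'.cls_add Q'.cls_smult module_hom_add[OF f(1)] module_hom_smult[OF f(1)])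
qed

end


section \<open>Extension of scalars\<close>

text \<open>The linear map of free modules that carries the basis vector of \<open>x\<close> to that of \<open>g x\<close>; the
  map \<open>free_map\<close> is the case of equal index sets.\<close>

definition free_push :: "'e ring \<Rightarrow> 'v set \<Rightarrow> 'w set \<Rightarrow> ('v \<Rightarrow> 'w) \<Rightarrow> ('v \<Rightarrow> 'e) \<Rightarrow> 'w \<Rightarrow> 'e" where
  "free_push F S S' g s = (\<lambda>y\<in>S'. finsum F s {x \<in> S. s x \<noteq> \<zero>\<^bsub>F\<^esub> \<and> g x = y})"

lemma free_map_eq_free_push: "free_map F S T = free_push F S S T"
  by (simp add: free_map_def free_push_def fun_eq_iff)

locale scalar_ring = cring R for R :: "'e ring" (structure)
begin

abbreviation supp where "supp S s \<equiv> {x \<in> S. s x \<noteq> \<zero>}"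
abbreviation FM where "FM S \<equiv> free_module R S"

lemma free_module_sel:
  "carrier (FM S) = {s \<in> S \<rightarrow>\<^sub>E carrier R. finite (supp S s)}"
  "zero (FM S) = (\<lambda>x\<in>S. \<zero>)"
  "s \<oplus>\<^bsub>FM S\<^esub> t = (\<lambda>x\<in>S. s x \<oplus> t x)"
  "c \<odot>\<^bsub>FM S\<^esub> s = (\<lambda>x\<in>S. c \<otimes> s x)"
  by (auto simp: free_module_def func_space_def)

lemma module_free_module: "module R (FM S)"
proof -
  interpret P: module R "func_space S" by (rule func_space_is_module)
  have "submodule R (carrier (FM S)) (func_space S)"
  proof (rule submodule.intro)
    show "module R (func_space S)" by (rule func_space_is_module)
    show "carrier (FM S) \<subseteq> carrier (func_space S)"
      by (auto simp: free_module_sel func_space_def)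
    show "\<zero>\<^bsub>func_space S\<^esub> \<in> carrier (FM S)"
      by (auto simp: free_module_sel func_space_def)
    fix v w assume vw: "v \<in> carrier (FM S)" "w \<in> carrier (FM S)"
    then have f: "finite (supp S v \<union> supp S w)" by (auto simp: free_module_sel)
    have "supp S (v \<oplus>\<^bsub>func_space S\<^esub> w) \<subseteq> supp S v \<union> supp S w"
      by (auto simp: func_space_def)
    then have "finite (supp S (v \<oplus>\<^bsub>func_space S\<^esub> w))" using f finite_subset by blast
    then show "v \<oplus>\<^bsub>func_space S\<^esub> w \<in> carrier (FM S)"
      using vw by (auto simp: free_module_sel func_space_def PiE_mem)
  next
    fix c v assume cv: "c \<in> carrier R" "v \<in> carrier (FM S)"
    have "supp S (c \<odot>\<^bsub>func_space S\<^esub> v) \<subseteq> supp S v"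
      using cv by (auto simp: func_space_def)
    then have "finite (supp S (c \<odot>\<^bsub>func_space S\<^esub> v))" using cv finite_subset
      by (auto simp: free_module_sel)
    then show "c \<odot>\<^bsub>func_space S\<^esub> v \<in> carrier (FM S)"
      using cv by (auto simp: free_module_sel func_space_def PiE_mem)
  qed
  then have "module R (func_space S\<lparr>carrier := carrier (FM S)\<rparr>)"
    by (rule P.submodule_is_module)
  then show ?thesis by (simp add: free_module_def)
qed

lemma free_basis_closed: "x \<in> S \<Longrightarrow> free_basis R S x \<in> carrier (FM S)"
proof -
  assume "x \<in> S"
  have "supp S (free_basis R S x) \<subseteq> {x}" by (auto simp: free_basis_def)
  then show ?thesis using finite_subset by (auto simp: free_module_sel free_basis_def)
qed

text \<open>Induction on the size of the support, removing one basis vector at a time.\<close>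

lemma free_module_induct [consumes 1, case_names zero add_basis]:
  assumes s: "s \<in> carrier (FM S)"
    and zero: "P \<zero>\<^bsub>FM S\<^esub>"
    and step: "\<And>c x s. c \<in> carrier R \<Longrightarrow> x \<in> S \<Longrightarrow> s \<in> carrier (FM S) \<Longrightarrow> P s \<Longrightarrow>
      P (c \<odot>\<^bsub>FM S\<^esub> free_basis R S x \<oplus>\<^bsub>FM S\<^esub> s)"
  shows "P s"
proof -
  have "P s" if "finite A" "s \<in> carrier (FM S)" "supp S s = A" for A s
    using that
  proof (induction A arbitrary: s rule: finite_induct)
    case empty
    then have "s = \<zero>\<^bsub>FM S\<^esub>"
      by (auto simp: free_module_sel fun_eq_iff PiE_def extensional_def)
    then show ?case using zero by simp
  next
    case (insert a A)
    define t where "t = (\<lambda>x\<in>S. if x = a then \<zero> else s x)"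
    have a: "a \<in> S" using insert by auto
    have supt: "supp S t = A" using insert by (auto simp: t_def)
    moreover have tc: "t \<in> carrier (FM S)"
      using insert.prems(1) insert.hyps(1) supt by (auto simp: free_module_sel t_def)
    ultimately have "P t" using insert.IH by blast
    moreover have "s = s a \<odot>\<^bsub>FM S\<^esub> free_basis R S a \<oplus>\<^bsub>FM S\<^esub> t"
      using insert.prems(1) a by (auto simp: free_module_sel t_def free_basis_def fun_eq_iff PiE_def extensional_def Pi_iff)
    moreover have "s a \<in> carrier R" using insert.prems(1) a by (auto simp: free_module_sel)
    ultimately show ?case using step[OF _ a tc] by metis
  qed
  then show ?thesis using s by (auto simp: free_module_sel)
qed

lemma finsum_supp:
  assumes "finite A" "A' \<subseteq> A" "s \<in> A \<rightarrow> carrier R" "\<And>x. x \<in> A - A' \<Longrightarrow> s x = \<zero>"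
  shows "finsum R s A' = finsum R s A"
  using assms by (intro add.finprod_mono_neutral_cong_left) auto

lemma free_push_eq_finsum:
  assumes s: "s \<in> S \<rightarrow> carrier R" and A: "finite A" "A \<subseteq> S" "supp S s \<subseteq> A" and y: "y \<in> S'"
  shows "free_push R S S' g s y = finsum R s {x \<in> A. g x = y}"
  unfolding free_push_def using y
  by simp (rule finsum_supp, use s A in auto)

lemma free_push_hom:
  assumes g: "g \<in> S \<rightarrow> S'"
  shows "free_push R S S' g \<in> module_hom R (FM S) (FM S')"
  unfolding module_hom_def
proof (intro CollectI conjI allI impI funcsetI)
  fix s assume s: "s \<in> carrier (FM S)"
  have sup: "supp S' (free_push R S S' g s) \<subseteq> g ` supp S s"
  proof
    fix y assume y: "y \<in> supp S' (free_push R S S' g s)"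
    have "{x \<in> S. s x \<noteq> \<zero> \<and> g x = y} \<noteq> {}"
    proof
      assume empty: "{x \<in> S. s x \<noteq> \<zero> \<and> g x = y} = {}"
      have "free_push R S S' g s y = finsum R s {x \<in> S. s x \<noteq> \<zero> \<and> g x = y}"
        using y by (simp add: free_push_def)
      also have "\<dots> = \<zero>" unfolding empty by simp
      finally show False using y by simp
    qed
    then show "y \<in> g ` supp S s" by auto
  qed
  show "free_push R S S' g s \<in> carrier (FM S')"
    using s finite_subset[OF sup] by (auto simp: free_module_sel free_push_def intro!: finsum_closed)
next
  fix s t assume st: "s \<in> carrier (FM S) \<and> t \<in> carrier (FM S)"
  define A where "A = supp S s \<union> supp S t"
  have A: "finite A" "A \<subseteq> S" "supp S s \<subseteq> A" "supp S t \<subseteq> A"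
    "supp S (s \<oplus>\<^bsub>FM S\<^esub> t) \<subseteq> A"
    using st by (auto simp: A_def free_module_sel)
  have sc: "s \<in> S \<rightarrow> carrier R" "t \<in> S \<rightarrow> carrier R" using st by (auto simp: free_module_sel)
  then have stc: "s \<oplus>\<^bsub>FM S\<^esub> t \<in> S \<rightarrow> carrier R" by (auto simp: free_module_sel)
  show "free_push R S S' g (s \<oplus>\<^bsub>FM S\<^esub> t) =
      free_push R S S' g s \<oplus>\<^bsub>FM S'\<^esub> free_push R S S' g t"
  proof
    fix y
    show "free_push R S S' g (s \<oplus>\<^bsub>FM S\<^esub> t) y =
        (free_push R S S' g s \<oplus>\<^bsub>FM S'\<^esub> free_push R S S' g t) y"
    proof (cases "y \<in> S'")
      case True
      have "finsum R (s \<oplus>\<^bsub>FM S\<^esub> t) {x \<in> A. g x = y} =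
          finsum R (\<lambda>x. s x \<oplus> t x) {x \<in> A. g x = y}"
        by (rule add.finprod_cong') (use sc A in \<open>auto simp: free_module_sel\<close>)
      also have "\<dots> = finsum R s {x \<in> A. g x = y} \<oplus> finsum R t {x \<in> A. g x = y}"
        by (rule finsum_addf) (use sc A in auto)
      finally show ?thesis
        using True by (simp add: free_push_eq_finsum[OF sc(1) A(1,2,3)] free_push_eq_finsum[OF sc(2) A(1,2,4)]
          free_push_eq_finsum[OF stc A(1,2,5)] free_module_sel(3)[of S'])
    qed (auto simp: free_push_def free_module_sel)
  qed
next
  fix c s assume cs: "c \<in> carrier R \<and> s \<in> carrier (FM S)"
  define A where "A = supp S s"
  have A: "finite A" "A \<subseteq> S" "supp S s \<subseteq> A" "supp S (c \<odot>\<^bsub>FM S\<^esub> s) \<subseteq> A"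
    using cs by (auto simp: A_def free_module_sel)
  have sc: "s \<in> S \<rightarrow> carrier R" "c \<in> carrier R" using cs by (auto simp: free_module_sel)
  then have stc: "c \<odot>\<^bsub>FM S\<^esub> s \<in> S \<rightarrow> carrier R" by (auto simp: free_module_sel)
  show "free_push R S S' g (c \<odot>\<^bsub>FM S\<^esub> s) = c \<odot>\<^bsub>FM S'\<^esub> free_push R S S' g s"
  proof
    fix y
    show "free_push R S S' g (c \<odot>\<^bsub>FM S\<^esub> s) y = (c \<odot>\<^bsub>FM S'\<^esub> free_push R S S' g s) y"
    proof (cases "y \<in> S'")
      case True
      have "finsum R (c \<odot>\<^bsub>FM S\<^esub> s) {x \<in> A. g x = y} =
          finsum R (\<lambda>x. c \<otimes> s x) {x \<in> A. g x = y}"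
        by (rule add.finprod_cong') (use sc A in \<open>auto simp: free_module_sel\<close>)
      also have "\<dots> = c \<otimes> finsum R s {x \<in> A. g x = y}"
        by (rule finsum_rdistr[symmetric]) (use sc A in auto)
      finally show ?thesis
        using True by (simp add: free_push_eq_finsum[OF sc(1) A(1,2,3)]
          free_push_eq_finsum[OF stc A(1,2,4)] free_module_sel(4)[of S'])
    qed (auto simp: free_push_def free_module_sel)
  qed
qed

lemma free_push_basis:
  assumes g: "g \<in> S \<rightarrow> S'" and x: "x \<in> S"
  shows "free_push R S S' g (free_basis R S x) = free_basis R S' (g x)"
proof
  fix y
  show "free_push R S S' g (free_basis R S x) y = free_basis R S' (g x) y"
  proof (cases "y \<in> S'")
    case True
    have b: "free_basis R S x \<in> S \<rightarrow> carrier R" using free_basis_closed[OF x] by (auto simp: free_module_sel)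
    have "free_push R S S' g (free_basis R S x) y = finsum R (free_basis R S x) {z \<in> {x}. g z = y}"
      by (rule free_push_eq_finsum[OF b]) (use x True in \<open>auto simp: free_basis_def\<close>)
    also have "{z \<in> {x}. g z = y} = (if g x = y then {x} else {})" by auto
    also have "finsum R (free_basis R S x) \<dots> = (if g x = y then \<one> else \<zero>)"
      using x by (auto simp: free_basis_def)
    finally show ?thesis using True by (simp add: free_basis_def[of R S'] eq_commute)
  qed (auto simp: free_push_def free_basis_def)
qed

end


lemma module_hom_submodule_vimage:
  assumes M: "module R M" and N: "module R N" and h: "h \<in> module_hom R M N"
    and sub: "submodule R B N"
  shows "submodule R {v \<in> carrier M. h v \<in> B} M"
proof -
  interpret h: mod_hom R M N h
    using M N h by (simp add: mod_hom_def mod_hom_axioms_def)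
  show ?thesis
    by (rule submodule.intro[OF M]) (use sub in \<open>auto simp: submodule_def\<close>)
qed

lemma module_hom_span:
  assumes M: "module R M" and N: "module R N" and h: "h \<in> module_hom R M N"
    and A: "A \<subseteq> carrier M" "h ` A \<subseteq> B" and B: "B \<subseteq> carrier N"
    and v: "v \<in> module.span R M A"
  shows "h v \<in> module.span R N B"
proof -
  have "submodule R {v \<in> carrier M. h v \<in> module.span R N B} M"
    by (rule module_hom_submodule_vimage[OF M N h module.span_is_submodule[OF N B]])
  moreover have "A \<subseteq> {v \<in> carrier M. h v \<in> module.span R N B}"
    using A module.in_own_span[OF N B] by auto
  ultimately show ?thesis using module.span_is_subset[OF M] v by blast
qed

locale scalar_extension = scalar_ring R for R :: "'e ring" (structure) +
  fixes E :: "'e set" and A :: "('e, 'v, 'm) module_scheme"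
  assumes E_sub: "E \<subseteq> carrier R" and module_A: "module (R\<lparr>carrier := E\<rparr>) A"
begin

sublocale A: module "R\<lparr>carrier := E\<rparr>" A by (rule module_A)

abbreviation P where "P \<equiv> free_module R (carrier A)"
abbreviation b where "b \<equiv> free_basis R (carrier A)"
abbreviation Rel where "Rel \<equiv> tensor_relations R E A"
abbreviation ext where "ext \<equiv> extend_scalars R E A"
abbreviation tens where "tens \<equiv> one_tensor R E A"

abbreviation generators where
  "generators \<equiv>
     {b (x \<oplus>\<^bsub>A\<^esub> y) \<ominus>\<^bsub>P\<^esub> (b x \<oplus>\<^bsub>P\<^esub> b y) | x y. x \<in> carrier A \<and> y \<in> carrier A} \<union>
     {b (c \<odot>\<^bsub>A\<^esub> x) \<ominus>\<^bsub>P\<^esub> (c \<odot>\<^bsub>P\<^esub> b x) | c x. c \<in> E \<and> x \<in> carrier A}"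

sublocale P: module R P by (rule module_free_module)

lemma b_closed [simp]: "x \<in> carrier A \<Longrightarrow> b x \<in> carrier P"
  by (rule free_basis_closed)

lemma A_smult_closed [simp]: "c \<in> E \<Longrightarrow> x \<in> carrier A \<Longrightarrow> c \<odot>\<^bsub>A\<^esub> x \<in> carrier A"
  using A.smult_closed by simp

lemma generators_closed: "generators \<subseteq> carrier P"
  using E_sub by auto

lemma Rel_eq: "Rel = P.span generators"
  by (simp add: tensor_relations_def Let_def)

lemma Rel_submodule: "submodule R Rel P"
  unfolding Rel_eq by (rule P.span_is_submodule[OF generators_closed])

sublocale quotient_space R P Rel
  using Rel_submodule module_free_module by (simp add: quotient_space_def quotient_space_axioms_def)

lemma ext_eq: "ext = quotient_module P Rel"
  by (simp add: extend_scalars_def)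

sublocale ext: module R ext
  unfolding ext_eq by (rule module_quotient)

lemma one_tensor_eq: "tens x = cls (b x)"
  by (simp add: one_tensor_def)

lemma one_tensor_closed [simp]: "x \<in> carrier A \<Longrightarrow> tens x \<in> carrier ext"
  by (auto simp: one_tensor_eq ext_eq quotient_sel)

lemma one_tensor_add:
  assumes "x \<in> carrier A" "y \<in> carrier A"
  shows "tens (x \<oplus>\<^bsub>A\<^esub> y) = tens x \<oplus>\<^bsub>ext\<^esub> tens y"
proof -
  have "b (x \<oplus>\<^bsub>A\<^esub> y) \<ominus>\<^bsub>P\<^esub> (b x \<oplus>\<^bsub>P\<^esub> b y) \<in> Rel"
    unfolding Rel_eq using P.in_own_span[OF generators_closed] assms by blast
  then show ?thesis
    using cls_eq_iff[of "b (x \<oplus>\<^bsub>A\<^esub> y)" "b x \<oplus>\<^bsub>P\<^esub> b y"] assms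
    by (simp add: one_tensor_eq ext_eq cls_add)
qed

lemma one_tensor_smult:
  assumes "c \<in> E" "x \<in> carrier A"
  shows "tens (c \<odot>\<^bsub>A\<^esub> x) = c \<odot>\<^bsub>ext\<^esub> tens x"
proof -
  have c: "c \<in> carrier R" using assms E_sub by auto
  have "b (c \<odot>\<^bsub>A\<^esub> x) \<ominus>\<^bsub>P\<^esub> (c \<odot>\<^bsub>P\<^esub> b x) \<in> Rel"
    unfolding Rel_eq using P.in_own_span[OF generators_closed] assms by blast
  then show ?thesis
    using cls_eq_iff[of "b (c \<odot>\<^bsub>A\<^esub> x)" "c \<odot>\<^bsub>P\<^esub> b x"] assms c
    by (simp add: one_tensor_eq ext_eq cls_smult)
qed

text \<open>The vectors \<open>1 \<otimes> x\<close> generate the extension of scalars, so linear maps that agree on them are equal.\<close>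

lemma hom_extI:
  assumes Z: "module R Z" and h: "h \<in> module_hom R ext Z" "h' \<in> module_hom R ext Z"
    and eq: "\<And>x. x \<in> carrier A \<Longrightarrow> h (tens x) = h' (tens x)"
    and u: "u \<in> carrier ext"
  shows "h u = h' u"
proof -
  interpret Z: module R Z by (rule Z)
  interpret h: mod_hom R ext Z h using h Z ext.module_axioms by (simp add: mod_hom_def mod_hom_axioms_def)
  interpret h': mod_hom R ext Z h' using h Z ext.module_axioms by (simp add: mod_hom_def mod_hom_axioms_def)
  obtain s where s: "s \<in> carrier P" "u = cls s" using u by (auto simp: ext_eq quotient_sel)
  have cl: "cls s \<in> carrier ext" if "s \<in> carrier P" for s using that by (auto simp: ext_eq quotient_sel)
  have "h (cls s) = h' (cls s)" using s(1)
  proof (induction s rule: free_module_induct)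
    case zero
    have "cls \<zero>\<^bsub>P\<^esub> = \<zero>\<^bsub>ext\<^esub>" by (simp add: ext_eq quotient_sel cls_zero)
    then show ?case by simp
  next
    case (add_basis c x s)
    have "cls (c \<odot>\<^bsub>P\<^esub> b x \<oplus>\<^bsub>P\<^esub> s) = c \<odot>\<^bsub>ext\<^esub> tens x \<oplus>\<^bsub>ext\<^esub> cls s"
      using add_basis by (simp add: ext_eq cls_smult cls_add one_tensor_eq)
    then show ?case using add_basis eq cl by simp
  qed
  then show ?thesis using s by simp
qed

end

text \<open>The map \<open>F \<otimes> A \<rightarrow> F \<otimes> B\<close> obtained from \<open>g : A \<rightarrow> B\<close>.\<close>

definition extend_hom where
  "extend_hom F E A B g =
     coset_map (free_module F (carrier B)) (tensor_relations F E B) (free_push F (carrier A) (carrier B) g)"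

lemma extend_scalars_map_eq: "extend_scalars_map F E A T = extend_hom F E A A T"
  by (simp add: extend_scalars_map_def extend_hom_def free_map_eq_free_push[abs_def])

locale scalar_extension_hom = A: scalar_extension R E A + B: scalar_extension R E B
  for R :: "'e ring" (structure) and E and A :: "('e, 'v, 'm) module_scheme"
    and B :: "('e, 'v, 'n) module_scheme" +
  fixes g
  assumes g: "g \<in> module_hom (R\<lparr>carrier := E\<rparr>) A B"
begin

abbreviation push where "push \<equiv> free_push R (carrier A) (carrier B) g"

lemma g_closed [simp]: "x \<in> carrier A \<Longrightarrow> g x \<in> carrier B"
  using module_hom_closed[OF g] by auto

lemma g_Pi: "g \<in> carrier A \<rightarrow> carrier B"
  using module_hom_closed[OF g] .

lemma push_hom: "push \<in> module_hom R A.P B.P"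
  by (rule A.free_push_hom[OF g_Pi])

sublocale push: mod_hom R A.P B.P push
  using push_hom A.P.module_axioms B.P.module_axioms by (simp add: mod_hom_def mod_hom_axioms_def)

lemma push_b: "x \<in> carrier A \<Longrightarrow> push (A.b x) = B.b (g x)"
  by (rule A.free_push_basis[OF g_Pi])

text \<open>Linearity of \<open>g\<close> carries each defining relation to a defining relation.\<close>

lemma push_Rel: "push ` A.Rel \<subseteq> B.Rel"
proof -
  have "push ` A.generators \<subseteq> B.generators"
  proof
    fix t assume "t \<in> push ` A.generators"
    then consider x y where "x \<in> carrier A" "y \<in> carrier A"
        "t = push (A.b (x \<oplus>\<^bsub>A\<^esub> y) \<ominus>\<^bsub>A.P\<^esub> (A.b x \<oplus>\<^bsub>A.P\<^esub> A.b y))"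
      | c x where "c \<in> E" "x \<in> carrier A" "t = push (A.b (c \<odot>\<^bsub>A\<^esub> x) \<ominus>\<^bsub>A.P\<^esub> (c \<odot>\<^bsub>A.P\<^esub> A.b x))"
      by blast
    then show "t \<in> B.generators"
    proof cases
      case 1
      then have "t = B.b (g x \<oplus>\<^bsub>B\<^esub> g y) \<ominus>\<^bsub>B.P\<^esub> (B.b (g x) \<oplus>\<^bsub>B.P\<^esub> B.b (g y))"
        by (simp add: push_b module_hom_add[OF g])
      then show ?thesis using 1 g_closed by blast
    next
      case 2
      then have c: "c \<in> carrier R" using A.E_sub by auto
      then have "t = B.b (c \<odot>\<^bsub>B\<^esub> g x) \<ominus>\<^bsub>B.P\<^esub> (c \<odot>\<^bsub>B.P\<^esub> B.b (g x))"
        using 2 module_hom_smult[OF g, of c x] by (simp add: push_b)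
      then show ?thesis using 2 g_closed by blast
    qed
  qed
  then show ?thesis
    using module_hom_span[OF A.P.module_axioms B.P.module_axioms push_hom A.generators_closed _ B.generators_closed]
    unfolding A.Rel_eq B.Rel_eq by blast
qed

abbreviation G where "G \<equiv> extend_hom R E A B g"

lemma G_hom: "G \<in> module_hom R A.ext B.ext"
  unfolding extend_hom_def A.ext_eq B.ext_eq
  by (rule A.coset_map_hom[OF B.quotient_space_axioms push_hom push_Rel])

lemma G_one_tensor: "x \<in> carrier A \<Longrightarrow> G (A.tens x) = B.tens (g x)"
  unfolding extend_hom_def A.one_tensor_eq B.one_tensor_eq
  using A.coset_map_cls[OF B.quotient_space_axioms push_hom push_Rel] by (simp add: push_b)

end

text \<open>If \<open>S g = c g T\<close>, then \<open>(S - c \<alpha>)\<^sup>n g = c\<^sup>n g (T - \<alpha>)\<^sup>n\<close>.\<close>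

lemma generalized_eigenspace_hom:
  assumes M: "module R M" and N: "module R N" and T: "T \<in> module_hom R M M" and S: "S \<in> module_hom R N N"
    and g: "g \<in> module_hom R M N" and c: "c \<in> carrier R" and a: "\<alpha> \<in> carrier R"
    and comm: "\<And>v. v \<in> carrier M \<Longrightarrow> S (g v) = c \<odot>\<^bsub>N\<^esub> g (T v)"
    and v: "v \<in> generalized_eigenspace M T \<alpha>"
  shows "g v \<in> generalized_eigenspace N S (c \<otimes>\<^bsub>R\<^esub> \<alpha>)"
proof -
  interpret M: module R M by (rule M)
  interpret N: module R N by (rule N)
  interpret T: mod_hom R M M T using M T by (simp add: mod_hom_def mod_hom_axioms_def)
  interpret S: mod_hom R N N S using N S by (simp add: mod_hom_def mod_hom_axioms_def)
  interpret g: mod_hom R M N g using M N g by (simp add: mod_hom_def mod_hom_axioms_def)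
  define D where "D y = T y \<ominus>\<^bsub>M\<^esub> \<alpha> \<odot>\<^bsub>M\<^esub> y" for y
  define D' where "D' y = S y \<ominus>\<^bsub>N\<^esub> (c \<otimes>\<^bsub>R\<^esub> \<alpha>) \<odot>\<^bsub>N\<^esub> y" for y
  have D_closed: "(D ^^ n) v \<in> carrier M" if "v \<in> carrier M" for n v
    using that a by (induction n) (auto simp: D_def)
  have DD: "D' (g v) = c \<odot>\<^bsub>N\<^esub> g (D v)" if "v \<in> carrier M" for v
    using that a c
    by (simp add: D_def D'_def comm N.smult_assoc1 a_minus_def N.smult_r_distr N.smult_r_minus)
  have D'_smult: "D' (r \<odot>\<^bsub>N\<^esub> y) = r \<odot>\<^bsub>N\<^esub> D' y" if "r \<in> carrier R" "y \<in> carrier N" for r y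
    using that a c M.R.m_comm[of r "c \<otimes>\<^bsub>R\<^esub> \<alpha>"]
    by (simp add: D'_def a_minus_def N.smult_r_distr N.smult_r_minus flip: N.smult_assoc1)
  have pow: "(D' ^^ n) (g v) = (c [^]\<^bsub>R\<^esub> n) \<odot>\<^bsub>N\<^esub> g ((D ^^ n) v)" if "v \<in> carrier M" for n :: nat and v
  proof (induction n)
    case (Suc n)
    have "(D' ^^ Suc n) (g v) = D' ((c [^]\<^bsub>R\<^esub> n) \<odot>\<^bsub>N\<^esub> g ((D ^^ n) v))" using Suc by simp
    also have "\<dots> = (c [^]\<^bsub>R\<^esub> n) \<odot>\<^bsub>N\<^esub> (c \<odot>\<^bsub>N\<^esub> g (D ((D ^^ n) v)))"
      using D'_smult DD D_closed that c by simp
    finally show ?case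
      using c D_closed[OF that, of "Suc n"] by (simp add: N.smult_assoc1)
  qed (use that in simp)
  obtain n where n: "v \<in> carrier M" "(D ^^ n) v = \<zero>\<^bsub>M\<^esub>"
    using v by (auto simp: generalized_eigenspace_def D_def[abs_def])
  then have "(D' ^^ n) (g v) = \<zero>\<^bsub>N\<^esub>" using pow[OF n(1), of n] c by simp
  then show ?thesis using n unfolding generalized_eigenspace_def D'_def[abs_def] by auto
qed

text \<open>A map \<open>g\<close> with \<open>S g = c g T\<close> carries the generalized eigenspace of \<open>T\<close> for \<open>\<alpha>\<close> to that of \<open>S\<close> for \<open>c \<alpha>\<close>, so it
  shifts weights in the way in which multiplication by \<open>c\<close> shifts the weights of Weil numbers.\<close>

lemma weight_space_hom:
  fixes A :: "('e, 'v, 'k \<Rightarrow> 'k) wd_rep" and B :: "('e, 'v, 'k \<Rightarrow> 'k) wd_rep"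
  assumes "scalar_extension F E A" "scalar_extension F E B"
    and g: "g \<in> module_hom (F\<lparr>carrier := E\<rparr>) A B"
    and T: "weil_action A frob \<in> module_hom (F\<lparr>carrier := E\<rparr>) A A"
    and S: "weil_action B frob \<in> module_hom (F\<lparr>carrier := E\<rparr>) B B"
    and c: "c \<in> E"
    and comm: "\<And>x. x \<in> carrier A \<Longrightarrow> weil_action B frob (g x) = c \<odot>\<^bsub>B\<^esub> g (weil_action A frob x)"
    and weil: "\<And>\<alpha>. weil_number q F i \<alpha> \<Longrightarrow> weil_number q F i' (c \<otimes>\<^bsub>F\<^esub> \<alpha>)"
    and x: "x \<in> weight_space q F E frob A i"
  shows "g x \<in> weight_space q F E frob B i'"
proof -
  interpret A: scalar_extension F E A by fact
  interpret B: scalar_extension F E B by fact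
  interpret g: scalar_extension_hom F E A B g by unfold_locales (rule g)
  interpret T: scalar_extension_hom F E A A "weil_action A frob" by unfold_locales (rule T)
  interpret S: scalar_extension_hom F E B B "weil_action B frob" by unfold_locales (rule S)
  have cF: "c \<in> carrier F" using c A.E_sub by auto
  have comm': "S.G (g.G u) = c \<odot>\<^bsub>B.ext\<^esub> g.G (T.G u)" if u: "u \<in> carrier A.ext" for u
  proof (rule A.hom_extI[OF B.ext.module_axioms _ _ _ u])
    have cl: "T.G u \<in> carrier A.ext" "g.G u \<in> carrier B.ext" if "u \<in> carrier A.ext" for u
      using that module_hom_closed[OF T.G_hom] module_hom_closed[OF g.G_hom] by auto
    have cl': "S.G u \<in> carrier B.ext" if "u \<in> carrier B.ext" for u
      using that module_hom_closed[OF S.G_hom] by auto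
    show "(\<lambda>u. S.G (g.G u)) \<in> module_hom F A.ext B.ext"
      using cl cl' by (auto simp: module_hom_def module_hom_add[OF S.G_hom] module_hom_smult[OF S.G_hom]
        module_hom_add[OF g.G_hom] module_hom_smult[OF g.G_hom])
    show "(\<lambda>u. c \<odot>\<^bsub>B.ext\<^esub> g.G (T.G u)) \<in> module_hom F A.ext B.ext"
      using cl cF by (auto simp: module_hom_def module_hom_add[OF T.G_hom] module_hom_smult[OF T.G_hom]
        module_hom_add[OF g.G_hom] module_hom_smult[OF g.G_hom] B.ext.smult_r_distr A.m_comm
        simp flip: B.ext.smult_assoc1)
    fix x assume x: "x \<in> carrier A"
    then have "g (weil_action A frob x) \<in> carrier B" by simp
    then show "S.G (g.G (A.tens x)) = c \<odot>\<^bsub>B.ext\<^esub> g.G (T.G (A.tens x))"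
      using x c by (simp add: T.G_one_tensor S.G_one_tensor g.G_one_tensor comm B.one_tensor_smult)
  qed
  let ?GA = "\<Union>\<alpha>\<in>{\<alpha>. weil_number q F i \<alpha>}. generalized_eigenspace A.ext T.G \<alpha>"
  let ?GB = "\<Union>\<alpha>\<in>{\<alpha>. weil_number q F i' \<alpha>}. generalized_eigenspace B.ext S.G \<alpha>"
  have "g.G ` ?GA \<subseteq> ?GB"
  proof safe
    fix \<alpha> v assume a: "weil_number q F i \<alpha>" and v: "v \<in> generalized_eigenspace A.ext T.G \<alpha>"
    have "\<alpha> \<in> carrier F" using a by (simp add: weil_number_def algebraic_numbers_def)
    then have "g.G v \<in> generalized_eigenspace B.ext S.G (c \<otimes>\<^bsub>F\<^esub> \<alpha>)"
      using generalized_eigenspace_hom[OF A.ext.module_axioms B.ext.module_axioms T.G_hom S.G_hom g.G_hom cF _ comm' v]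
      by simp
    then show "g.G v \<in> ?GB" using weil[OF a] by blast
  qed
  moreover have "?GA \<subseteq> carrier A.ext" "?GB \<subseteq> carrier B.ext" by (auto simp: generalized_eigenspace_def)
  ultimately have "g.G (A.tens x) \<in> B.ext.span ?GB"
    using x module_hom_span[OF A.ext.module_axioms B.ext.module_axioms g.G_hom, of ?GA ?GB]
    by (simp add: weight_space_def extend_scalars_map_eq)
  then show ?thesis
    using x by (simp add: weight_space_def extend_scalars_map_eq g.G_one_tensor)
qed

lemma submodule_weight_space:
  fixes A :: "('e, 'v, 'k \<Rightarrow> 'k) wd_rep"
  assumes "scalar_extension F E A"
  shows "submodule (F\<lparr>carrier := E\<rparr>) (weight_space q F E frob A i) A"
proof -
  interpret A: scalar_extension F E A by fact
  let ?GA = "\<Union>\<alpha>\<in>{\<alpha>. weil_number q F i \<alpha>}.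
    generalized_eigenspace A.ext (extend_scalars_map F E A (weil_action A frob)) \<alpha>"
  have "submodule F (A.ext.span ?GA) A.ext"
    by (rule A.ext.span_is_submodule) (auto simp: generalized_eigenspace_def)
  then have A: "\<And>x y. x \<in> A.ext.span ?GA \<Longrightarrow> y \<in> A.ext.span ?GA \<Longrightarrow> x \<oplus>\<^bsub>A.ext\<^esub> y \<in> A.ext.span ?GA"
    "\<And>c x. c \<in> carrier F \<Longrightarrow> x \<in> A.ext.span ?GA \<Longrightarrow> c \<odot>\<^bsub>A.ext\<^esub> x \<in> A.ext.span ?GA"
    "\<zero>\<^bsub>A.ext\<^esub> \<in> A.ext.span ?GA"
    by (auto simp: submodule_def)
  have "A.tens \<zero>\<^bsub>A\<^esub> = \<zero>\<^bsub>A.ext\<^esub>"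
    using A.one_tensor_add[of "\<zero>\<^bsub>A\<^esub>" "\<zero>\<^bsub>A\<^esub>"] by simp
  then show ?thesis
    using A A.E_sub
    by (intro submodule.intro[OF A.module_A])
      (auto simp: weight_space_def A.one_tensor_add A.one_tensor_smult)
qed


section \<open>The residue field of a p-adic field\<close>

context ring
begin

abbreviation of_integer :: "int \<Rightarrow> 'a" where
  "of_integer n \<equiv> [n] \<cdot> \<one>"

lemma of_integer_simps:
  "of_integer 0 = \<zero>" "of_integer 1 = \<one>"
  "of_integer (m + n) = of_integer m \<oplus> of_integer n"
  "of_integer (m * n) = of_integer m \<otimes> of_integer n"
  "of_integer (- n) = \<ominus> of_integer n"
  "of_integer (m - n) = of_integer m \<ominus> of_integer n"
proof -
  show *: "of_integer (m + n) = of_integer m \<oplus> of_integer n" for m n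
    by (simp add: add.int_pow_mult)
  show **: "of_integer (- n) = \<ominus> of_integer n" for n
    by (simp add: add.int_pow_neg)
  show "of_integer (m - n) = of_integer m \<ominus> of_integer n"
    using *[of m "- n"] ** by (simp add: a_minus_def)
  show "of_integer (m * n) = of_integer m \<otimes> of_integer n"
    by (simp add: add_pow_ldistr_int add.int_pow_pow mult.commute)
qed (simp_all add: add_pow_int_ge)

lemma minus_telescope:
  "x \<in> carrier R \<Longrightarrow> y \<in> carrier R \<Longrightarrow> z \<in> carrier R \<Longrightarrow> x \<ominus> z = (x \<ominus> y) \<oplus> (y \<ominus> z)"
  by (simp add: a_minus_def a_ac r_neg1 r_neg2)

text \<open>Counting with respect to a basis. The hypotheses say that \<open>k\<close> is a subfield of \<open>R\<close>.\<close>

lemma card_dimension: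
  assumes k: "k \<subseteq> carrier R" "\<one> \<in> k" "\<And>x. x \<in> k \<Longrightarrow> \<ominus> x \<in> k"
    "\<And>x y. x \<in> k \<Longrightarrow> y \<in> k \<Longrightarrow> x \<oplus> y \<in> k" "\<And>x y. x \<in> k \<Longrightarrow> y \<in> k \<Longrightarrow> x \<otimes> y \<in> k"
    and inv: "\<And>x. x \<in> k \<Longrightarrow> x \<noteq> \<zero> \<Longrightarrow> \<exists>y\<in>k. y \<otimes> x = \<one>"
    and fin: "finite k" and dim: "dimension n k U"
  shows "finite U \<and> card U = card k ^ n"
proof -
  have "finite U \<and> card U = card k ^ n \<and> U \<subseteq> carrier R \<and> \<zero> \<in> U \<and>
      (\<forall>x\<in>U. \<forall>y\<in>U. x \<oplus> y \<in> U) \<and> (\<forall>c\<in>k. \<forall>x\<in>U. c \<otimes> x \<in> U)"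
    using dim k inv fin
  proof (induction rule: dimension.induct)
    case (zero_dim k) then show ?case by auto
  next
    case (Suc_dim v U n k)
    note k = Suc_dim.prems(1-5) and inv = Suc_dim.prems(6) and fin = Suc_dim.prems(7)
    have U: "finite U" "card U = card k ^ n" "U \<subseteq> carrier R" "\<zero> \<in> U"
      "\<And>x y. x \<in> U \<Longrightarrow> y \<in> U \<Longrightarrow> x \<oplus> y \<in> U" "\<And>c x. c \<in> k \<Longrightarrow> x \<in> U \<Longrightarrow> c \<otimes> x \<in> U"
      using Suc_dim.IH[OF k inv fin] by auto
    have v: "v \<in> carrier R" "v \<notin> U" by fact+
    have kc: "c \<in> carrier R" if "c \<in> k" for c using k that by auto
    have Uc: "u \<in> carrier R" if "u \<in> U" for u using U that by auto
    have U_neg: "\<ominus> u \<in> U" if "u \<in> U" for u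
      using U(6)[of "\<ominus> \<one>" u] k that Uc[OF that] by (simp add: l_minus)
    have mem: "line_extension k v U = (\<lambda>(c, u). c \<otimes> v \<oplus> u) ` (k \<times> U)"
      by (auto simp: line_extension_mem_iff) blast
    have inj: "inj_on (\<lambda>(c, u). c \<otimes> v \<oplus> u) (k \<times> U)"
    proof (rule inj_onI, clarify)
      fix c u d w assume cu: "c \<in> k" "u \<in> U" "d \<in> k" "w \<in> U" and eq: "c \<otimes> v \<oplus> u = d \<otimes> v \<oplus> w"
      note cl = kc[OF cu(1)] Uc[OF cu(2)] kc[OF cu(3)] Uc[OF cu(4)]
      have eq': "(c \<ominus> d) \<otimes> v = w \<oplus> \<ominus> u"
      proof -
        have "(c \<ominus> d) \<otimes> v = (c \<otimes> v \<oplus> u) \<oplus> \<ominus> (d \<otimes> v) \<oplus> \<ominus> u"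
          using cl v(1) by (simp add: a_minus_def l_distr l_minus a_ac r_neg1 r_neg2 r_neg)
        also have "\<dots> = w \<oplus> \<ominus> u" unfolding eq
          using cl v(1) by (simp add: a_ac r_neg1 r_neg2 r_neg)
        finally show ?thesis .
      qed
      have "c = d"
      proof (rule ccontr)
        assume "c \<noteq> d"
        then have "c \<ominus> d \<noteq> \<zero>" using cl by simp
        moreover have cd: "c \<ominus> d \<in> k" using k cu by (simp add: a_minus_def)
        ultimately obtain e where e: "e \<in> k" "e \<otimes> (c \<ominus> d) = \<one>" using inv by blast
        have "v = e \<otimes> ((c \<ominus> d) \<otimes> v)"
          using e kc[OF e(1)] kc[OF cd] v(1) by (simp flip: m_assoc)
        also have "\<dots> \<in> U" unfolding eq' using U(5,6) U_neg e cu by auto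
        finally show False using v by simp
      qed
      then show "c = d \<and> u = w" using eq cl v(1) by simp
    qed
    have "finite (line_extension k v U)" unfolding mem using fin U by simp
    moreover have "card (line_extension k v U) = card k ^ Suc n"
      unfolding mem card_image[OF inj] by (simp add: card_cartesian_product U)
    moreover have "line_extension k v U \<subseteq> carrier R"
      using line_extension_in_carrier k v U by simp
    moreover have "\<zero> \<in> line_extension k v U"
    proof -
      have "\<zero> \<in> k" using k(4)[OF k(2) k(3)[OF k(2)]] k(1,2) by (auto simp: r_neg)
      then have "\<zero> = \<zero> \<otimes> v \<oplus> \<zero>" "\<zero> \<in> k" using v by auto
      then show ?thesis using U(4) line_extension_mem_iff by blast
    qed
    moreover have "x \<oplus> y \<in> line_extension k v U"
      if xy: "x \<in> line_extension k v U" "y \<in> line_extension k v U" for x y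
    proof -
      obtain c u d w where *: "c \<in> k" "u \<in> U" "d \<in> k" "w \<in> U" "x = c \<otimes> v \<oplus> u" "y = d \<otimes> v \<oplus> w"
        using xy unfolding line_extension_mem_iff by blast
      have "x \<oplus> y = (c \<oplus> d) \<otimes> v \<oplus> (u \<oplus> w)"
        using * kc[OF *(1)] Uc[OF *(2)] kc[OF *(3)] Uc[OF *(4)] v by (simp add: l_distr a_ac)
      then show ?thesis using k(4)[OF *(1,3)] U(5)[OF *(2,4)] line_extension_mem_iff by blast
    qed
    moreover have "d \<otimes> x \<in> line_extension k v U"
      if dx: "d \<in> k" "x \<in> line_extension k v U" for d x
    proof -
      obtain c u where *: "c \<in> k" "u \<in> U" "x = c \<otimes> v \<oplus> u"
        using dx unfolding line_extension_mem_iff by blast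
      have "d \<otimes> x = (d \<otimes> c) \<otimes> v \<oplus> (d \<otimes> u)"
        using * kc[OF *(1)] Uc[OF *(2)] kc[OF dx(1)] v by (simp add: r_distr m_assoc)
      then show ?thesis using k(5)[OF dx(1) *(1)] U(6)[OF dx(1) *(2)] line_extension_mem_iff by blast
    qed
    ultimately show ?case by blast
  qed
  then show ?thesis by blast
qed

end

locale p_adic =
  fixes p :: nat and L :: "'k ring" (structure) and a :: "'k \<Rightarrow> real" and Qp K :: "'k set"
  assumes p_adic_field: "p_adic_field p L a Qp K"
begin

lemma prime_p: "Factorial_Ring.prime p"
  using p_adic_field by (simp add: p_adic_field_def)

sublocale field L
  using p_adic_field by (simp add: p_adic_field_def algebraic_closure_def)

lemma subfields: "subfield K L" "subfield Qp L" "Qp \<subseteq> K" "Qp \<subseteq> carrier L" "K \<subseteq> carrier L"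
proof -
  show 1: "subfield K L" "subfield Qp L" "Qp \<subseteq> K"
    using p_adic_field by (auto simp: p_adic_field_def algebraic_closure_def p_adic_numbers_def)
  show "Qp \<subseteq> carrier L" "K \<subseteq> carrier L" using subfieldE(3) 1 by auto
qed

lemma subfields_closed: "x \<in> K \<Longrightarrow> x \<in> carrier L" "x \<in> Qp \<Longrightarrow> x \<in> carrier L"
  using subfields(4,5) by (blast, blast)

lemma absolute_value:
  shows a_nonneg: "x \<in> carrier L \<Longrightarrow> 0 \<le> a x"
    and a_eq_0: "x \<in> carrier L \<Longrightarrow> a x = 0 \<longleftrightarrow> x = \<zero>"
    and a_mult: "x \<in> carrier L \<Longrightarrow> y \<in> carrier L \<Longrightarrow> a (x \<otimes> y) = a x * a y"
    and a_add: "x \<in> carrier L \<Longrightarrow> y \<in> carrier L \<Longrightarrow> a (x \<oplus> y) \<le> max (a x) (a y)"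
  using p_adic_field by (auto simp: p_adic_field_def nonarchimedean_absolute_value_def)

lemma a_one: "a \<one> = 1"
  using a_mult[of \<one> \<one>] a_eq_0[of \<one>] by simp

lemma a_neg: assumes "x \<in> carrier L" shows "a (\<ominus> x) = a x"
proof -
  have "a (\<ominus> \<one>) * a (\<ominus> \<one>) = 1" using a_mult[of "\<ominus> \<one>" "\<ominus> \<one>"] by (simp add: l_minus a_one)
  then have "a (\<ominus> \<one>) = 1"
    using a_nonneg[of "\<ominus> \<one>"] by (metis a_inv_closed one_closed abs_of_nonneg abs_square_eq_1 power2_eq_square)
  then show ?thesis using a_mult[of "\<ominus> \<one>" x] assms by (simp add: l_minus)
qed

lemma a_minus: "x \<in> carrier L \<Longrightarrow> y \<in> carrier L \<Longrightarrow> a (x \<ominus> y) \<le> max (a x) (a y)"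
  using a_add[of x "\<ominus> y"] by (simp add: a_neg a_minus_def)

lemma a_minus_commute: "x \<in> carrier L \<Longrightarrow> y \<in> carrier L \<Longrightarrow> a (x \<ominus> y) = a (y \<ominus> x)"
  using a_neg[of "x \<ominus> y"] by (simp add: a_minus_def minus_add a_comm)

lemma of_integer_closed: "of_integer n \<in> carrier L" by simp

lemma a_of_integer_less_1: "a (of_integer n) < 1 \<longleftrightarrow> int p dvd n"
proof (cases "n = 0")
  case True then show ?thesis using a_eq_0[of "\<zero>"] by (simp add: of_integer_simps)
next
  case False
  then have "a (of_integer n) = (1 / real p) ^ multiplicity (int p) n"
    using p_adic_field by (simp add: p_adic_field_def p_adic_numbers_def)
  moreover have "p > 1" using prime_p prime_gt_1_nat by blast
  moreover have "multiplicity (int p) n = 0 \<longleftrightarrow> \<not> int p dvd n"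
    using False \<open>p > 1\<close> by (simp add: multiplicity_eq_zero_iff)
  moreover have "(1 / real p) ^ Suc k < 1" for k
    using power_Suc_less_one[of "1 / real p" k] \<open>p > 1\<close> by simp
  ultimately show ?thesis
    by (cases "multiplicity (int p) n") (simp_all del: power_Suc)
qed

lemma a_of_integer_le_1: "a (of_integer n) \<le> 1"
proof (cases "n = 0")
  case True then show ?thesis using a_eq_0[of "\<zero>"] by (simp add: of_integer_simps)
next
  case False
  then have "a (of_integer n) = (1 / real p) ^ multiplicity (int p) n"
    using p_adic_field by (simp add: p_adic_field_def p_adic_numbers_def)
  moreover have "p > 1" using prime_p prime_gt_1_nat by blast
  ultimately show ?thesis by (simp add: power_le_one)
qed

lemma of_integer_eq_0: "of_integer n = \<zero> \<longleftrightarrow> n = 0"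
proof
  assume z: "of_integer n = \<zero>"
  show "n = 0"
  proof (rule ccontr)
    assume "n \<noteq> 0"
    then have "a (of_integer n) = (1 / real p) ^ multiplicity (int p) n"
      using p_adic_field by (simp add: p_adic_field_def p_adic_numbers_def)
    moreover have "p > 1" using prime_p prime_gt_1_nat by blast
    ultimately show False using z a_eq_0[of \<zero>] by simp
  qed
qed (simp add: of_integer_simps)

text \<open>Elements of the prime field are fractions, written without division.\<close>

lemma prime_field_fraction:
  assumes "y \<in> generate_field L {}"
  shows "y \<in> carrier L \<and> (\<exists>m n. n \<noteq> 0 \<and> y \<otimes> of_integer n = of_integer m)"
  using assms
proof (induction rule: generate_field.induct)
  case one
  have "\<one> \<otimes> of_integer 1 = of_integer 1" by simp
  then show ?case by (metis one_closed zero_neq_one)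
next
  case (incl h) then show ?case by simp
next
  case (a_inv h)
  then obtain m n where *: "n \<noteq> 0" "h \<otimes> of_integer n = of_integer m" "h \<in> carrier L" by blast
  then have "\<ominus> h \<otimes> of_integer n = of_integer (- m)" by (simp add: l_minus of_integer_simps)
  then show ?case using * by blast
next
  case (m_inv h)
  then obtain m n where *: "n \<noteq> 0" "h \<otimes> of_integer n = of_integer m" "h \<in> carrier L" by blast
  have h: "inv h \<in> carrier L" "inv h \<otimes> h = \<one>" using m_inv * field_Units by auto
  have "m \<noteq> 0"
  proof
    assume "m = 0"
    then have "h \<otimes> of_integer n = \<zero>" using * by (simp add: of_integer_simps)
    then show False using * m_inv of_integer_eq_0 integral[of h "of_integer n"] by auto
  qed
  moreover have "inv h \<otimes> of_integer m = of_integer n"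
    using h * by (simp flip: *(2) m_assoc)
  ultimately show ?case using h by blast
next
  case (eng_add x y)
  then obtain m n m' n' where *: "n \<noteq> 0" "x \<otimes> of_integer n = of_integer m" "x \<in> carrier L"
    "n' \<noteq> 0" "y \<otimes> of_integer n' = of_integer m'" "y \<in> carrier L" by blast
  have "(x \<oplus> y) \<otimes> of_integer (n * n') =
      (x \<otimes> of_integer n) \<otimes> of_integer n' \<oplus> (y \<otimes> of_integer n') \<otimes> of_integer n"
    using *(3,6) by (simp add: of_integer_simps l_distr m_assoc m_comm[of "of_integer n" "of_integer n'"])
  also have "\<dots> = of_integer (m * n' + m' * n)" using * by (simp add: of_integer_simps)
  finally show ?case using * by (metis a_closed mult_eq_0_iff)
next
  case (eng_mult x y)
  then obtain m n m' n' where *: "n \<noteq> 0" "x \<otimes> of_integer n = of_integer m" "x \<in> carrier L"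
    "n' \<noteq> 0" "y \<otimes> of_integer n' = of_integer m'" "y \<in> carrier L" by blast
  have "(x \<otimes> y) \<otimes> of_integer (n * n') = (x \<otimes> of_integer n) \<otimes> (y \<otimes> of_integer n')"
    using *(3,6) by (simp add: of_integer_simps m_ac)
  also have "\<dots> = of_integer (m * m')" using * by (simp add: of_integer_simps)
  finally show ?case using * by (metis m_closed mult_eq_0_iff)
qed

text \<open>For a fraction \<open>m / n\<close> in lowest terms that is p-integral, \<open>n\<close> is prime to \<open>p\<close>, so the congruence
  \<open>k n \<equiv> m\<close> modulo \<open>p\<close> has a solution \<open>k\<close>.\<close>

lemma rational_near_integer:
  assumes y: "y \<in> generate_field L {}" "a y \<le> 1"
  obtains k where "a (y \<ominus> of_integer k) < 1"
proof -
  obtain m n where mn: "n \<noteq> 0" "y \<otimes> of_integer n = of_integer m" and yc: "y \<in> carrier L"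
    using prime_field_fraction[OF y(1)] by blast
  obtain m' n' where cop: "m = gcd m n * m'" "n = gcd m n * n'" "coprime m' n'"
    using gcd_coprime_exists[of m n] mn(1) by (metis gcd_eq_0_iff mult.commute)
  have g: "gcd m n \<noteq> 0" using mn by simp
  have "of_integer (gcd m n) \<otimes> (y \<otimes> of_integer n') = of_integer (gcd m n) \<otimes> of_integer m'"
  proof -
    have "of_integer (gcd m n) \<otimes> (y \<otimes> of_integer n') = y \<otimes> of_integer (gcd m n * n')"
      using yc by (simp only: of_integer_simps) (simp add: m_ac)
    also have "\<dots> = of_integer (gcd m n * m')" using mn(2) cop by metis
    finally show ?thesis by (simp only: of_integer_simps)
  qed
  then have red: "y \<otimes> of_integer n' = of_integer m'"
    using g of_integer_eq_0 yc by (simp add: m_lcancel)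
  have "\<not> int p dvd n'"
  proof
    assume d: "int p dvd n'"
    then have "\<not> int p dvd m'"
      using cop(3) prime_p by (metis coprime_common_divisor not_prime_unit of_nat_0_le_iff prime_nat_int_transfer)
    then have "a (of_integer m') = 1" using a_of_integer_less_1 a_of_integer_le_1 by (meson linorder_not_less order_antisym)
    moreover have "a (of_integer m') = a y * a (of_integer n')" using red yc a_mult by (metis of_integer_closed)
    moreover have "a y * a (of_integer n') \<le> a (of_integer n')"
      using y a_nonneg[of "of_integer n'"] by (simp add: mult_left_le_one_le a_nonneg yc)
    ultimately show False using d a_of_integer_less_1[of n'] by simp
  qed
  then have "coprime n' (int p)"
    using prime_p by (metis coprime_commute prime_imp_coprime prime_nat_int_transfer)
  then obtain z where z: "[n' * z = 1] (mod int p)" using cong_solve_coprime_int by blast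
  define k where "k = z * m'"
  have "[m' - k * n' = 0] (mod int p)"
  proof -
    have "[n' * z * m' = 1 * m'] (mod int p)" using z by (rule cong_scalar_right)
    then show ?thesis by (simp add: k_def cong_iff_dvd_diff mult_ac dvd_diff_commute)
  qed
  then have "int p dvd m' - k * n'" by (simp add: cong_0_iff)
  then have "a (of_integer (m' - k * n')) < 1" using a_of_integer_less_1 by blast
  moreover have "of_integer (m' - k * n') = (y \<ominus> of_integer k) \<otimes> of_integer n'"
    using yc by (simp add: of_integer_simps red[symmetric] a_minus_def l_distr l_minus)
  moreover have "a (of_integer n') = 1"
    using \<open>\<not> int p dvd n'\<close> a_of_integer_less_1 a_of_integer_le_1 by (meson linorder_not_less order_antisym)
  ultimately have "a (y \<ominus> of_integer k) < 1" using yc by (simp add: a_mult)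
  then show thesis using that by blast
qed

text \<open>The rationals are dense in \<open>Qp\<close>, and a p-integral rational is congruent to an integer.\<close>

lemma p_adic_integer_near_integer:
  assumes x: "x \<in> Qp" "a x \<le> 1"
  obtains k where "k \<in> {0..<int p}" "a (x \<ominus> of_integer k) < 1"
proof -
  have xc: "x \<in> carrier L" using x subfields_closed by auto
  interpret M: Metric_space Qp "absolute_value_dist L a"
  proof
    show "0 \<le> absolute_value_dist L a x y" for x y
      by (simp add: absolute_value_dist_def a_nonneg)
    show "absolute_value_dist L a x y = absolute_value_dist L a y x" for x y
      by (auto simp: absolute_value_dist_def a_minus_commute)
    show "absolute_value_dist L a x y = 0 \<longleftrightarrow> x = y" if "x \<in> Qp" "y \<in> Qp" for x y
      using that subfields_closed by (auto simp: absolute_value_dist_def a_eq_0)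
    show "absolute_value_dist L a x z \<le> absolute_value_dist L a x y + absolute_value_dist L a y z"
      if "x \<in> Qp" "y \<in> Qp" "z \<in> Qp" for x y z
    proof -
      have c: "x \<in> carrier L" "y \<in> carrier L" "z \<in> carrier L" using that subfields_closed by auto
      then have "x \<ominus> z = (x \<ominus> y) \<oplus> (y \<ominus> z)" by (rule minus_telescope)
      then have "a (x \<ominus> z) \<le> max (a (x \<ominus> y)) (a (y \<ominus> z))" using a_add[of "x \<ominus> y" "y \<ominus> z"] c by simp
      also have "\<dots> \<le> a (x \<ominus> y) + a (y \<ominus> z)" using a_nonneg c by simp
      finally show ?thesis using c by (simp add: absolute_value_dist_def)
    qed
  qed
  have "x \<in> M.mtopology closure_of (generate_field L {})"
    using x p_adic_field by (simp add: p_adic_field_def p_adic_numbers_def)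
  then have "\<forall>r>0. \<exists>y\<in>generate_field L {}. y \<in> M.mball x r"
    unfolding M.metric_closure_of by (rule CollectE) (rule conjunct2)
  then have "\<exists>y\<in>generate_field L {}. y \<in> M.mball x 1"
    by (simp only: zero_less_one)
  then obtain y where y: "y \<in> generate_field L {}" "y \<in> Qp" "absolute_value_dist L a x y < 1"
    by auto
  have yc: "y \<in> carrier L" using y subfields_closed by auto
  have xy: "a (x \<ominus> y) < 1" using y xc yc by (simp add: absolute_value_dist_def)
  have "x \<ominus> (x \<ominus> y) = (x \<oplus> \<ominus> x) \<oplus> y" using xc yc by (simp add: a_minus_def minus_add a_assoc)
  then have "y = x \<ominus> (x \<ominus> y)" using xc yc by (simp add: r_neg)
  then have "a y \<le> 1" using a_minus[of x "x \<ominus> y"] xc yc x xy by simp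
  then obtain k where k: "a (y \<ominus> of_integer k) < 1" using rational_near_integer[OF y(1)] by blast
  define k' where "k' = k mod int p"
  have p0: "int p > 0" using prime_p prime_gt_0_nat by simp
  have "a (of_integer (k - k')) < 1" unfolding a_of_integer_less_1 k'_def by (simp add: minus_mod_eq_mult_div)
  moreover have "x \<ominus> of_integer k' = ((x \<ominus> y) \<oplus> (y \<ominus> of_integer k)) \<oplus> of_integer (k - k')"
    using minus_telescope[of x "of_integer k" "of_integer k'"] minus_telescope[of x y "of_integer k"] xc yc
    by (simp add: of_integer_simps)
  ultimately have "a (x \<ominus> of_integer k') < 1"
    using a_add[of "x \<ominus> y" "y \<ominus> of_integer k"] a_add[of "(x \<ominus> y) \<oplus> (y \<ominus> of_integer k)" "of_integer (k - k')"]
      xc yc xy k by simp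
  then show thesis using that[of k'] p0 by (simp add: k'_def)
qed

abbreviation OK where "OK \<equiv> valuation_ring L a K"
abbreviation mK where "mK \<equiv> valuation_ideal a K"

lemma subring_OK: "subring (carrier OK) L"
proof (rule subringI)
  note K = subringE[OF subfieldE(1)[OF subfields(1)]]
  have c: "x \<in> carrier L" if "x \<in> K" for x using that subfields_closed by auto
  show "carrier OK \<subseteq> carrier L" using subfields_closed by (auto simp: valuation_ring_def)
  show "\<one> \<in> carrier OK" using K(3) by (simp add: valuation_ring_def a_one)
  show "\<ominus> h \<in> carrier OK" if "h \<in> carrier OK" for h
    using that K(5) c by (simp add: valuation_ring_def a_neg)
  show "h \<otimes> h' \<in> carrier OK" if "h \<in> carrier OK" "h' \<in> carrier OK" for h h'
    using that K(6) c by (simp add: valuation_ring_def a_mult mult_le_one a_nonneg)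
  show "h \<oplus> h' \<in> carrier OK" if "h \<in> carrier OK" "h' \<in> carrier OK" for h h'
  proof -
    have "a (h \<oplus> h') \<le> max (a h) (a h')" using that c by (intro a_add) (auto simp: valuation_ring_def)
    then show ?thesis using that K(7)[of h h'] by (auto simp: valuation_ring_def)
  qed
qed

lemma OK_eq: "OK = L\<lparr>carrier := carrier OK\<rparr>"
  by (simp add: valuation_ring_def)

lemma cring_OK: "cring OK"
  using subcring_iff[OF subringE(1)[OF subring_OK]] subcringI'[OF subring_OK] OK_eq by simp

lemma OK_simps:
  "x \<in> carrier OK \<longleftrightarrow> x \<in> K \<and> a x \<le> 1"
  "x \<otimes>\<^bsub>OK\<^esub> y = x \<otimes> y" "x \<oplus>\<^bsub>OK\<^esub> y = x \<oplus> y" "\<one>\<^bsub>OK\<^esub> = \<one>" "\<zero>\<^bsub>OK\<^esub> = \<zero>"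
  by (simp_all add: valuation_ring_def)

lemma OK_neg:
  assumes "x \<in> carrier OK" shows "\<ominus>\<^bsub>OK\<^esub> x = \<ominus> x"
proof -
  interpret O: cring OK by (rule cring_OK)
  have xc: "x \<in> carrier L" and n: "\<ominus> x \<in> carrier OK" using assms subringE[OF subring_OK] by auto
  have "\<ominus> x \<oplus> x = \<zero>" using xc by (simp add: l_neg)
  then have "\<ominus> x \<oplus>\<^bsub>OK\<^esub> x = \<zero>\<^bsub>OK\<^esub>" by (simp add: OK_simps)
  then show ?thesis using O.minus_equality[OF _ assms n] by simp
qed

lemma mK_ideal: "ideal mK OK"
proof (rule idealI)
  interpret O: cring OK by (rule cring_OK)
  note K = subringE[OF subfieldE(1)[OF subfields(1)]]
  have c: "x \<in> carrier L" if "x \<in> K" for x using that subfields_closed by auto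
  show "ring OK" ..
  have sub: "mK \<subseteq> carrier OK" by (auto simp: valuation_ideal_def OK_simps)
  have add: "x \<oplus> y \<in> mK" if "x \<in> mK" "y \<in> mK" for x y
  proof -
    have "a (x \<oplus> y) \<le> max (a x) (a y)" using that c by (intro a_add) (auto simp: valuation_ideal_def)
    then show ?thesis using that K(7)[of x y] by (auto simp: valuation_ideal_def)
  qed
  show "subgroup mK (add_monoid OK)"
  proof (rule O.add.subgroupI)
    show "mK \<subseteq> carrier OK" by (rule sub)
    have "\<zero> \<in> mK" using K(2) a_eq_0[of \<zero>] by (simp add: valuation_ideal_def)
    then show "mK \<noteq> {}" by auto
    show "\<ominus>\<^bsub>OK\<^esub> x \<in> mK" if "x \<in> mK" for x
    proof -
      have x: "x \<in> K" "a x < 1" "x \<in> carrier OK" using that sub by (auto simp: valuation_ideal_def)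
      then show ?thesis using OK_neg[OF x(3)] K(5)[OF x(1)] a_neg[OF c[OF x(1)]] by (simp add: valuation_ideal_def)
    qed
    show "x \<oplus>\<^bsub>OK\<^esub> y \<in> mK" if "x \<in> mK" "y \<in> mK" for x y
      using that add by (simp add: OK_simps)
  qed
  have mult: "x \<otimes> y \<in> mK" if "x \<in> mK" "y \<in> carrier OK" for x y
  proof -
    have cx: "x \<in> carrier L" "y \<in> carrier L" "a x < 1" "a y \<le> 1"
      using that c by (auto simp: valuation_ideal_def OK_simps)
    have "a x * a y \<le> a x" using cx a_nonneg by (simp add: mult_right_le_one_le)
    then show ?thesis using that K(6)[of x y] cx by (auto simp: valuation_ideal_def OK_simps a_mult)
  qed
  show "x \<otimes>\<^bsub>OK\<^esub> y \<in> mK" "y \<otimes>\<^bsub>OK\<^esub> x \<in> mK" if "x \<in> mK" "y \<in> carrier OK" for x y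
    using mult[OF that] that sub O.m_comm[of x y] by (auto simp: OK_simps(2))
qed

text \<open>The residue field of \<open>K\<close> has dimension \<open>f\<close> over that of \<open>Qp\<close>, whose elements are the classes of
  \<open>0, \<dots>, p - 1\<close>.\<close>

lemma residue_card_eq:
  assumes f: "has_residue_degree L a Qp K f"
  shows "residue_card L a K = p ^ f"
proof -
  interpret O: cring OK by (rule cring_OK)
  interpret m: ideal mK OK by (rule mK_ideal)
  let ?k = "residue_field L a K"
  let ?c = "residue_class L a K"
  interpret k: cring ?k
    unfolding residue_field_def by (rule m.quotient_is_cring[OF cring_OK])
  interpret c: ring_hom_ring OK ?k ?c
    using m.rcos_ring_hom_ring unfolding residue_field_def residue_class_def .
  note K = subringE[OF subfieldE(1)[OF subfields(1)]] and Q = subringE[OF subfieldE(1)[OF subfields(2)]]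
  define Zp where "Zp = carrier (valuation_ring L a Qp)"
  have Zp: "x \<in> Zp \<longleftrightarrow> x \<in> Qp \<and> a x \<le> 1" for x by (simp add: Zp_def valuation_ring_def)
  have Zp_OK: "Zp \<subseteq> carrier OK" using subfields by (auto simp: Zp OK_simps)
  have lc: "x \<in> carrier L" if "x \<in> carrier OK" for x using that subfields_closed by (auto simp: OK_simps)
  have eq_iff: "?c x = ?c y \<longleftrightarrow> a (x \<ominus> y) < 1" if xy: "x \<in> carrier OK" "y \<in> carrier OK" for x y
  proof -
    have "?c x = ?c y \<longleftrightarrow> x \<ominus>\<^bsub>OK\<^esub> y \<in> mK"
      unfolding residue_class_def using O.quotient_eq_iff_same_a_r_cos[OF mK_ideal xy] by blast
    also have "x \<ominus>\<^bsub>OK\<^esub> y = x \<ominus> y" using OK_neg[OF xy(2)] by (simp add: a_minus_def OK_simps)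
    also have "x \<ominus> y \<in> mK \<longleftrightarrow> a (x \<ominus> y) < 1"
      using K(7)[OF _ K(5), of x y] xy by (auto simp: valuation_ideal_def a_minus_def OK_simps)
    finally show ?thesis .
  qed
  have int_Qp: "of_integer n \<in> Qp" for n :: int
  proof -
    have nat: "[n] \<cdot> \<one> \<in> Qp" for n :: nat by (induction n) (use Q in auto)
    show ?thesis
    proof (cases "n \<ge> 0")
      case True then show ?thesis using nat[of "nat n"] by (simp add: add_pow_int_ge)
    next
      case False then show ?thesis using nat[of "nat (- n)"] Q by (simp add: add_pow_int_lt)
    qed
  qed
  have int_Zp: "of_integer n \<in> Zp" for n :: int using int_Qp by (simp add: Zp a_of_integer_le_1)
  have k0: "?c ` Zp = (\<lambda>n. ?c (of_integer n)) ` {0..<int p}"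
  proof (intro subset_antisym subsetI)
    fix y assume "y \<in> ?c ` Zp"
    then obtain x where x: "x \<in> Zp" "y = ?c x" by blast
    then obtain n where n: "n \<in> {0..<int p}" "a (x \<ominus> of_integer n) < 1"
      using p_adic_integer_near_integer[of x] Zp by blast
    have "x \<in> carrier OK" "of_integer n \<in> carrier OK" using x int_Zp Zp_OK by blast+
    then have "y = ?c (of_integer n)" using eq_iff n x by blast
    then show "y \<in> (\<lambda>n. ?c (of_integer n)) ` {0..<int p}" using n by blast
  qed (use int_Zp in auto)
  have inj: "inj_on (\<lambda>n. ?c (of_integer n)) {0..<int p}"
  proof (rule inj_onI)
    fix m n assume mn: "m \<in> {0..<int p}" "n \<in> {0..<int p}" "?c (of_integer m) = ?c (of_integer n)"
    then have "a (of_integer m \<ominus> of_integer n) < 1" using eq_iff int_Zp Zp_OK by blast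
    then have "int p dvd m - n" using a_of_integer_less_1[of "m - n"] by (simp add: of_integer_simps)
    moreover have "\<bar>m - n\<bar> < int p" using mn by auto
    ultimately show "m = n" by (metis abs_of_nat dvd_imp_le_int eq_iff_diff_eq_0 linorder_not_less)
  qed
  have card_k0: "finite (?c ` Zp)" "card (?c ` Zp) = p"
    unfolding k0 by (simp_all add: card_image[OF inj])
  have Zp_cl: "\<one> \<in> Zp" "\<And>x. x \<in> Zp \<Longrightarrow> \<ominus> x \<in> Zp" "\<And>x y. x \<in> Zp \<Longrightarrow> y \<in> Zp \<Longrightarrow> x \<oplus> y \<in> Zp"
    "\<And>x y. x \<in> Zp \<Longrightarrow> y \<in> Zp \<Longrightarrow> x \<otimes> y \<in> Zp"
  proof -
    have OKc: "x \<in> Zp \<longleftrightarrow> x \<in> Qp \<and> x \<in> carrier OK" for x using Zp_OK by (auto simp: Zp OK_simps)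
    note O' = subringE[OF subring_OK]
    show "\<one> \<in> Zp" unfolding OKc using Q(3) O'(3) by simp
    show "\<ominus> x \<in> Zp" if "x \<in> Zp" for x using that Q(5) O'(5) unfolding OKc by simp
    show "x \<oplus> y \<in> Zp" "x \<otimes> y \<in> Zp" if "x \<in> Zp" "y \<in> Zp" for x y
      using that Q(6,7) O'(6,7) unfolding OKc by simp_all
  qed
  have "finite (carrier ?k) \<and> card (carrier ?k) = card (?c ` Zp) ^ f"
  proof (rule k.card_dimension)
    show "?c ` Zp \<subseteq> carrier ?k" using Zp_OK c.hom_closed by blast
    show "\<one>\<^bsub>?k\<^esub> \<in> ?c ` Zp" using c.hom_one Zp_cl(1) by (metis OK_simps(4) imageI)
    show "\<ominus>\<^bsub>?k\<^esub> x \<in> ?c ` Zp" if xy: "x \<in> ?c ` Zp" for x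
    proof -
      obtain z where z: "z \<in> Zp" "x = ?c z" using xy by blast
      then have "\<ominus>\<^bsub>?k\<^esub> x = ?c (\<ominus> z)" using Zp_OK OK_neg[of z] by (metis c.hom_a_inv subsetD)
      then show ?thesis using Zp_cl(2) z by blast
    qed
    show "x \<oplus>\<^bsub>?k\<^esub> y \<in> ?c ` Zp" if xy: "x \<in> ?c ` Zp" "y \<in> ?c ` Zp" for x y
    proof -
      obtain z w where z: "z \<in> Zp" "x = ?c z" "w \<in> Zp" "y = ?c w" using xy by blast
      then have "x \<oplus>\<^bsub>?k\<^esub> y = ?c (z \<oplus> w)" using Zp_OK c.hom_add[of z w] by (auto simp: OK_simps(3))
      then show ?thesis using Zp_cl(3) z by blast
    qed
    show "x \<otimes>\<^bsub>?k\<^esub> y \<in> ?c ` Zp" if xy: "x \<in> ?c ` Zp" "y \<in> ?c ` Zp" for x y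
    proof -
      obtain z w where z: "z \<in> Zp" "x = ?c z" "w \<in> Zp" "y = ?c w" using xy by blast
      then have "x \<otimes>\<^bsub>?k\<^esub> y = ?c (z \<otimes> w)" using Zp_OK c.hom_mult[of z w] by (auto simp: OK_simps(2))
      then show ?thesis using Zp_cl(4) z by blast
    qed
    show "\<exists>y\<in>?c ` Zp. y \<otimes>\<^bsub>?k\<^esub> x = \<one>\<^bsub>?k\<^esub>" if x: "x \<in> ?c ` Zp" "x \<noteq> \<zero>\<^bsub>?k\<^esub>" for x
    proof -
      obtain z where z: "z \<in> Zp" "x = ?c z" using x by blast
      have zO: "z \<in> carrier OK" and zL: "z \<in> carrier L" using z Zp_OK lc by auto
      have "\<not> a z < 1"
      proof
        assume "a z < 1"
        then have "?c z = ?c \<zero>" using eq_iff[OF zO] O.zero_closed zL by (simp add: OK_simps(5) a_minus_def)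
        then show False using x z c.hom_zero by (simp add: OK_simps(5))
      qed
      then have az: "a z = 1" using z by (simp add: Zp)
      then have nz: "z \<noteq> \<zero>" using a_eq_0[OF zL] by auto
      then have iz: "inv z \<in> Qp" "inv z \<otimes> z = \<one>"
        using subfield_m_inv[OF subfields(2)] z by (auto simp: Zp)
      have "a (inv z) * a z = 1" using a_mult[of "inv z" z] iz zL subfields_closed a_one by auto
      then have izZ: "inv z \<in> Zp" using iz az by (simp add: Zp)
      then have "?c (inv z) \<otimes>\<^bsub>?k\<^esub> x = \<one>\<^bsub>?k\<^esub>"
        using c.hom_mult[of "inv z" z] c.hom_one z zO iz Zp_OK by (auto simp: OK_simps(2,4))
      then show ?thesis using izZ by blast
    qed
    show "finite (?c ` Zp)" by (rule card_k0)
    show "ring.dimension ?k f (?c ` Zp) (carrier ?k)"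
      using f by (simp add: has_residue_degree_def Zp_def)
  qed
  then show ?thesis by (simp add: residue_card_def card_k0)
qed

end

section \<open>The effect of the cyclotomic character on weights\<close>

text \<open>Every complex embedding maps \<open>c\<close> to \<open>1 / q\<close>, and dividing by \<open>q\<close> lowers the
  exponent \<open>i / 2\<close> by 1.\<close>

lemma weil_number_shift:
  assumes F: "field F" and c: "c \<in> carrier F" "c \<otimes>\<^bsub>F\<^esub> ([q] \<cdot>\<^bsub>F\<^esub> \<one>\<^bsub>F\<^esub>) = \<one>\<^bsub>F\<^esub>" and q: "0 < q"
    and a: "weil_number q F i \<alpha>"
  shows "weil_number q F (i - 2) (c \<otimes>\<^bsub>F\<^esub> \<alpha>)"
proof -
  interpret F: field F by (rule F)
  let ?A = "algebraic_numbers F"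
  have gf: "subfield (generate_field F {}) F" by (rule F.generate_field_is_subfield) simp
  have Aeq: "?A = {x \<in> carrier F. (F.algebraic over generate_field F {}) x}"
    by (simp add: algebraic_numbers_def over_def)
  have A: "subfield ?A F" unfolding Aeq by (rule F.subfield_of_algebraics[OF gf])
  note A' = subringE[OF subfieldE(1)[OF A]]
  have nat_A: "[n] \<cdot>\<^bsub>F\<^esub> \<one>\<^bsub>F\<^esub> \<in> ?A" for n :: nat by (induction n) (use A' in auto)
  let ?q = "[q] \<cdot>\<^bsub>F\<^esub> \<one>\<^bsub>F\<^esub>"
  have qnz: "?q \<noteq> \<zero>\<^bsub>F\<^esub>" using c by auto
  have cA: "c \<in> ?A"
  proof -
    have "c = inv\<^bsub>F\<^esub> ?q" using c by (simp add: F.inv_unique' F.m_comm)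
    then show ?thesis using F.subfield_m_inv[OF A, of ?q] nat_A qnz by simp
  qed
  have aA: "\<alpha> \<in> ?A" using a by (simp add: weil_number_def)
  have "cmod (\<iota> (c \<otimes>\<^bsub>F\<^esub> \<alpha>)) = real q powr (real_of_int (i - 2) / 2)"
    if \<iota>: "\<iota> \<in> ring_hom (F\<lparr>carrier := ?A\<rparr>) (ring_of_type_algebra :: complex ring)" for \<iota>
  proof -
    have mult: "\<iota> (x \<otimes>\<^bsub>F\<^esub> y) = \<iota> x * \<iota> y" if "x \<in> ?A" "y \<in> ?A" for x y
      using ring_hom_mult[OF \<iota>, of x y] that by (simp add: ring_of_type_algebra_def)
    have add: "\<iota> (x \<oplus>\<^bsub>F\<^esub> y) = \<iota> x + \<iota> y" if "x \<in> ?A" "y \<in> ?A" for x y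
      using ring_hom_add[OF \<iota>, of x y] that by (simp add: ring_of_type_algebra_def)
    have one: "\<iota> \<one>\<^bsub>F\<^esub> = 1"
      using ring_hom_one[OF \<iota>] by (simp add: ring_of_type_algebra_def)
    have zero: "\<iota> \<zero>\<^bsub>F\<^esub> = 0" using add[of "\<zero>\<^bsub>F\<^esub>" "\<zero>\<^bsub>F\<^esub>"] A' by simp
    have nat: "\<iota> ([n] \<cdot>\<^bsub>F\<^esub> \<one>\<^bsub>F\<^esub>) = of_nat n" for n :: nat
      by (induction n) (use nat_A A' in \<open>auto simp: add one zero\<close>)
    have "\<iota> c * of_nat q = 1" using mult[OF cA nat_A[of q]] c one nat by simp
    then have "cmod (\<iota> c) * real q = 1" by (metis norm_mult norm_of_nat norm_one)
    then have "cmod (\<iota> c) = 1 / real q" using q by (simp add: field_simps)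
    moreover have "cmod (\<iota> \<alpha>) = real q powr (real_of_int i / 2)"
      using a \<iota> by (simp add: weil_number_def)
    moreover have "real q powr (real_of_int (i - 2) / 2) = real q powr (real_of_int i / 2) / real q"
    proof -
      have half: "real_of_int (i - 2) / 2 = real_of_int i / 2 - 1" by simp
      show ?thesis unfolding half using q by (simp add: powr_diff)
    qed
    ultimately show ?thesis by (simp add: mult[OF cA aA] norm_mult)
  qed
  then show ?thesis using A'(6)[OF cA aA] by (simp add: weil_number_def)
qed


section \<open>Internal direct sums\<close>

context module
begin

lemma finsum_submodule:
  assumes B: "submodule R B M" and f: "\<And>j. j \<in> A \<Longrightarrow> f j \<in> B"
  shows "finsum M f A \<in> B"
  using f
proof (induction A rule: infinite_finite_induct)
  case (insert x A)
  have "B \<subseteq> carrier M" using B by (simp add: submodule_def)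
  then have "finsum M f (insert x A) = f x \<oplus>\<^bsub>M\<^esub> finsum M f A"
    using insert by (intro finsum_insert) auto
  then show ?case using insert B by (simp add: submodule_def)
qed (use B in \<open>auto simp: submodule_def\<close>)

lemma internal_direct_sum_minimal:
  assumes ds: "internal_direct_sum M Y" and B: "submodule R B M" and sub: "\<And>j. Y j \<subseteq> B"
  shows "carrier M \<subseteq> B"
proof
  fix v assume "v \<in> carrier M"
  then obtain f where "\<forall>j. f j \<in> Y j" "v = finsum M f {j. f j \<noteq> \<zero>\<^bsub>M\<^esub>}"
    using ds unfolding internal_direct_sum_def by blast
  then show "v \<in> B" using finsum_submodule[OF B, of "{j. f j \<noteq> \<zero>\<^bsub>M\<^esub>}" f] sub by blast
qed

text \<open>The sum over the support of a family, which occurs in the definition of internal direct sums, can be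
  taken over any finite set of indices outside of which the family vanishes.\<close>

lemma finsum_support:
  assumes J: "finite J" "\<And>j. j \<notin> J \<Longrightarrow> f j = \<zero>\<^bsub>M\<^esub>" and f: "\<And>j. f j \<in> carrier M"
  shows "finsum M f {j. f j \<noteq> \<zero>\<^bsub>M\<^esub>} = finsum M f J"
  by (rule M.add.finprod_mono_neutral_cong_left) (use assms in auto)

text \<open>The finitely many vectors of a spanning set have components in finitely many summands, and these
  already exhaust the module.\<close>

lemma internal_direct_sum_finite:
  assumes ds: "internal_direct_sum M Y" and Y: "\<And>j. submodule R (Y j) M"
    and A: "finite A" "A \<subseteq> carrier M" "span A = carrier M"
  shows "finite {j. Y j \<noteq> {\<zero>\<^bsub>M\<^esub>}}"
proof -
  have Yc: "x \<in> carrier M" if "x \<in> Y j" for x j using that Y[of j] by (auto simp: submodule_def)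
  have Y0: "\<zero>\<^bsub>M\<^esub> \<in> Y j" for j using Y[of j] by (auto simp: submodule_def)
  have "\<exists>f. (\<forall>j. f j \<in> Y j) \<and> finite {j. f j \<noteq> \<zero>\<^bsub>M\<^esub>} \<and> v = finsum M f {j. f j \<noteq> \<zero>\<^bsub>M\<^esub>}"
    if "v \<in> carrier M" for v
    using ds that unfolding internal_direct_sum_def by blast
  then obtain rep where rep: "\<And>v. v \<in> carrier M \<Longrightarrow> (\<forall>j. rep v j \<in> Y j) \<and>
      finite {j. rep v j \<noteq> \<zero>\<^bsub>M\<^esub>} \<and> v = finsum M (rep v) {j. rep v j \<noteq> \<zero>\<^bsub>M\<^esub>}" by metis
  define J where "J = (\<Union>v\<in>A. {j. rep v j \<noteq> \<zero>\<^bsub>M\<^esub>})"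
  have finJ: "finite J" unfolding J_def using A rep by blast
  define B where "B = {finsum M f J | f. \<forall>j. f j \<in> Y j}"
  have "submodule R B M"
  proof (rule submodule.intro)
    show "module R M" by (rule module_axioms)
    have "finsum M f J \<in> carrier M" if "\<forall>j. f j \<in> Y j" for f
      by (rule M.finsum_closed) (use that Yc in auto)
    then show "B \<subseteq> carrier M" by (auto simp: B_def)
    have "finsum M (\<lambda>_. \<zero>\<^bsub>M\<^esub>) J = \<zero>\<^bsub>M\<^esub>" by simp
    then show "\<zero>\<^bsub>M\<^esub> \<in> B"
      unfolding B_def using Y0 by (intro CollectI exI[of _ "\<lambda>_. \<zero>\<^bsub>M\<^esub>"]) simp
    show "v \<oplus>\<^bsub>M\<^esub> w \<in> B" if vw: "v \<in> B" "w \<in> B" for v w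
    proof -
      obtain f g where fg: "\<forall>j. f j \<in> Y j" "v = finsum M f J" "\<forall>j. g j \<in> Y j" "w = finsum M g J"
        using vw by (auto simp: B_def)
      have "v \<oplus>\<^bsub>M\<^esub> w = finsum M (\<lambda>j. f j \<oplus>\<^bsub>M\<^esub> g j) J"
        unfolding fg(2,4) by (rule M.finsum_addf[symmetric]) (use fg(1,3) Yc in auto)
      moreover have "\<forall>j. f j \<oplus>\<^bsub>M\<^esub> g j \<in> Y j" using fg Y by (simp add: submodule_def)
      ultimately show ?thesis unfolding B_def by blast
    qed
    show "c \<odot>\<^bsub>M\<^esub> v \<in> B" if cv: "c \<in> carrier R" "v \<in> B" for c v
    proof -
      obtain f where f: "\<forall>j. f j \<in> Y j" "v = finsum M f J" using cv by (auto simp: B_def)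
      have "c \<odot>\<^bsub>M\<^esub> v = finsum M (\<lambda>j. c \<odot>\<^bsub>M\<^esub> f j) J"
        using f cv Yc finJ by (auto intro!: finsum_smult_ldistr)
      moreover have "\<forall>j. c \<odot>\<^bsub>M\<^esub> f j \<in> Y j" using f cv Y by (simp add: submodule_def)
      ultimately show ?thesis unfolding B_def by blast
    qed
  qed
  moreover have "A \<subseteq> B"
  proof
    fix v assume v: "v \<in> A"
    then have vc: "v \<in> carrier M" using A by auto
    have "rep v j = \<zero>\<^bsub>M\<^esub>" if "j \<notin> J" for j using that v by (auto simp: J_def)
    then have "v = finsum M (rep v) J"
      using rep[OF vc] finsum_support[OF finJ, of "rep v"] Yc by metis
    then show "v \<in> B" using rep[OF vc] unfolding B_def by blast
  qed
  ultimately have all: "carrier M \<subseteq> B" using span_is_subset A by blast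
  have "{j. Y j \<noteq> {\<zero>\<^bsub>M\<^esub>}} \<subseteq> J"
  proof (rule subsetI, rule ccontr)
    fix j assume j: "j \<in> {j. Y j \<noteq> {\<zero>\<^bsub>M\<^esub>}}" "j \<notin> J"
    then obtain v where v: "v \<in> Y j" "v \<noteq> \<zero>\<^bsub>M\<^esub>" using Y0 by blast
    then have vc: "v \<in> carrier M" using Yc by auto
    obtain f where f: "\<forall>j. f j \<in> Y j" "v = finsum M f J" using all vc unfolding B_def by blast
    define f1 where "f1 i = (if i \<in> J then f i else \<zero>\<^bsub>M\<^esub>)" for i
    define f2 where "f2 i = (if i = j then v else \<zero>\<^bsub>M\<^esub>)" for i
    have "finsum M f1 {i. f1 i \<noteq> \<zero>\<^bsub>M\<^esub>} = finsum M f1 J"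
      by (rule finsum_support[OF finJ]) (use f Yc in \<open>auto simp: f1_def\<close>)
    also have "\<dots> = finsum M f J"
      by (rule M.add.finprod_cong') (use f Yc in \<open>auto simp: f1_def\<close>)
    finally have 1: "v = finsum M f1 {i. f1 i \<noteq> \<zero>\<^bsub>M\<^esub>}" using f by simp
    have "{i. f2 i \<noteq> \<zero>\<^bsub>M\<^esub>} = {j}" using v by (auto simp: f2_def)
    then have 2: "v = finsum M f2 {i. f2 i \<noteq> \<zero>\<^bsub>M\<^esub>}" using vc by (simp add: f2_def)
    have "finite {i. f1 i \<noteq> \<zero>\<^bsub>M\<^esub>}" using finJ by (rule rev_finite_subset) (auto simp: f1_def)
    moreover have "finite {i. f2 i \<noteq> \<zero>\<^bsub>M\<^esub>}" by (simp add: \<open>_ = {j}\<close>)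
    moreover have "\<forall>i. f1 i \<in> Y i" "\<forall>i. f2 i \<in> Y i" using f v Y0 by (auto simp: f1_def f2_def)
    ultimately have "f1 = f2" using ds vc 1 2 unfolding internal_direct_sum_def by blast
    then have "f1 j = f2 j" by simp
    then show False using j(2) v(2) by (simp add: f1_def f2_def)
  qed
  then show ?thesis using finJ finite_subset by blast
qed

end


section \<open>Graded pieces of a mixed representation\<close>

lemma wd_quotient_sel:
  "carrier (wd_quotient V U) = carrier (quotient_module V U)"
  "add (wd_quotient V U) = add (quotient_module V U)"
  "zero (wd_quotient V U) = zero (quotient_module V U)"
  "module.smult (wd_quotient V U) = module.smult (quotient_module V U)"
  "weil_action (wd_quotient V U) w = coset_map V U (weil_action V w)"
  "monodromy (wd_quotient V U) = coset_map V U (monodromy V)"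
  by (simp_all add: wd_quotient_def module.defs wd_rep.defs quotient_module_def)

lemma poly_eval_cong_ops:
  assumes "add V' = add V" "module.smult V' = module.smult V"
  shows "poly_eval V' T k = poly_eval V T k"
  by (induction k) (simp_all add: assms)

text \<open>A mixed representation, seen as a filtered vector space with two operators. For the field
  \<open>K\<close>, the scalar \<open>c\<close> is \<open>p\<close> to the power \<open>v(\<phi>)\<close>, the inverse of the cardinality \<open>q\<close> of the residue field.\<close>

locale mixed_rep = vector_endomorphism "F\<lparr>carrier := E\<rparr>" V "weil_action V frob"
  for F :: "'e ring" and E and V :: "('e, 'v, 'k \<Rightarrow> 'k) wd_rep" (structure) and frob +
  fixes W :: "int \<Rightarrow> 'v set" and q :: nat and c :: 'e
  assumes field_F: "field F" and subfield_E: "subfield E F" and fd: fin_dim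
    and N_hom: "monodromy V \<in> module_hom (F\<lparr>carrier := E\<rparr>) V V"
    and c: "c \<in> E" "c \<noteq> \<zero>\<^bsub>F\<^esub>"
    and T_N: "\<And>x. x \<in> carrier V \<Longrightarrow>
      weil_action V frob (monodromy V x) = c \<odot> monodromy V (weil_action V frob x)"
    and W_subspace: "\<And>i. subspace (F\<lparr>carrier := E\<rparr>) (W i) V"
    and T_W: "\<And>i. weil_action V frob ` W i \<subseteq> W i" and N_W: "\<And>i. monodromy V ` W i \<subseteq> W i"
    and W_mono: "mono W" and W_exhaustive: "(\<Union>i. W i) = carrier V"
    and W_separated: "(\<Inter>i. W i) = {\<zero>}"
    and pure: "\<And>i. pure_of_weight q F E frob i (graded_piece V W i)"
    and weil_shift: "\<And>i \<alpha>. weil_number q F i \<alpha> \<Longrightarrow> weil_number q F (i - 2) (c \<otimes>\<^bsub>F\<^esub> \<alpha>)"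
begin

abbreviation EE where "EE \<equiv> F\<lparr>carrier := E\<rparr>"
abbreviation T where "T \<equiv> weil_action V frob"
abbreviation N where "N \<equiv> monodromy V"
abbreviation gr where "gr \<equiv> graded_piece V W"
abbreviation cl where "cl i x \<equiv> W (i - 1) +> x"
abbreviation T_gr where "T_gr i \<equiv> weil_action (gr i) frob"
abbreviation wt_gr where "wt_gr i \<equiv> weight_space q F E frob (gr i)"

lemma W_closed:
  shows W_carrier: "x \<in> W i \<Longrightarrow> x \<in> carrier V" and W_zero: "\<zero> \<in> W i"
    and W_add: "x \<in> W i \<Longrightarrow> y \<in> W i \<Longrightarrow> x \<oplus> y \<in> W i"
    and W_smult: "r \<in> E \<Longrightarrow> x \<in> W i \<Longrightarrow> r \<odot> x \<in> W i"
  using subspaceD[OF W_subspace[of i]] by auto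

lemma W_le: "i \<le> j \<Longrightarrow> x \<in> W i \<Longrightarrow> x \<in> W j"
  using W_mono by (auto simp: mono_def)

lemma T_in_W: "x \<in> W i \<Longrightarrow> T x \<in> W i" and N_in_W: "x \<in> W i \<Longrightarrow> N x \<in> W i"
  using T_W[of i] N_W[of i] by auto

lemma N_pow_in_W: "x \<in> W i \<Longrightarrow> (N ^^ n) x \<in> W i"
  by (induction n) (auto intro: N_in_W)

lemma T_closed: "x \<in> carrier V \<Longrightarrow> T x \<in> carrier V"
  using module_hom_closed[OF endo] by auto

lemma N_linear:
  shows N_closed: "x \<in> carrier V \<Longrightarrow> N x \<in> carrier V"
    and N_smult: "r \<in> E \<Longrightarrow> x \<in> carrier V \<Longrightarrow> N (r \<odot> x) = r \<odot> N x"
    and N_minus: "x \<in> carrier V \<Longrightarrow> y \<in> carrier V \<Longrightarrow> N (x \<ominus> y) = N x \<ominus> N y"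
proof -
  interpret N: mod_hom EE V V N
    using N_hom module_axioms by (simp add: mod_hom_def mod_hom_axioms_def)
  show "x \<in> carrier V \<Longrightarrow> N x \<in> carrier V"
    "r \<in> E \<Longrightarrow> x \<in> carrier V \<Longrightarrow> N (r \<odot> x) = r \<odot> N x"
    "x \<in> carrier V \<Longrightarrow> y \<in> carrier V \<Longrightarrow> N (x \<ominus> y) = N x \<ominus> N y"
    by simp_all
qed

lemma N_pow_closed: "x \<in> carrier V \<Longrightarrow> (N ^^ n) x \<in> carrier V"
  by (induction n) (auto intro: N_closed)

lemma N_pow_minus:
  "x \<in> carrier V \<Longrightarrow> y \<in> carrier V \<Longrightarrow> (N ^^ n) (x \<ominus> y) = (N ^^ n) x \<ominus> (N ^^ n) y"
  by (induction n) (auto simp: N_minus N_pow_closed)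

lemma W_step_submodule: "submodule EE (W (i - 1)) (V\<lparr>carrier := W i\<rparr>)"
  by (rule submodule.intro)
    (use submodule_is_module[OF is_module[OF W_subspace]] W_closed W_le[of "i - 1" i] in auto)

lemma quotient_space_gr: "quotient_space EE (V\<lparr>carrier := W i\<rparr>) (W (i - 1))"
  using W_step_submodule[of i] submodule_is_module[OF is_module[OF W_subspace[of i]]]
  by (simp add: quotient_space_def quotient_space_axioms_def)

lemma coset_restrict: "U +>\<^bsub>V\<lparr>carrier := A\<rparr>\<^esub> x = U +> x"
  by (simp add: a_r_coset_def')

lemma minus_restrict:
  assumes "x \<in> W i" "y \<in> W i" shows "x \<ominus>\<^bsub>V\<lparr>carrier := W i\<rparr>\<^esub> y = x \<ominus> y"
proof -
  interpret Wi: module EE "V\<lparr>carrier := W i\<rparr>"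
    by (rule submodule_is_module[OF is_module[OF W_subspace]])
  have "\<ominus> y \<in> W i" using assms subspaceD(5)[OF W_subspace] by blast
  moreover have "\<ominus> y \<oplus> y = \<zero>" using W_carrier[OF assms(2)] by (rule M.l_neg)
  ultimately have "\<ominus>\<^bsub>V\<lparr>carrier := W i\<rparr>\<^esub> y = \<ominus> y"
    using Wi.M.minus_equality[of "\<ominus> y" y] assms by simp
  then show ?thesis by (simp add: a_minus_def)
qed

lemma module_gr: "module EE (gr i)"
  unfolding graded_piece_def
  by (rule module_cong[OF quotient_space.module_quotient[OF quotient_space_gr]]) (simp_all add: wd_quotient_sel)

lemma carrier_gr: "carrier (gr i) = cl i ` W i"
  using quotient_space.quotient_sel(1)[OF quotient_space_gr]
  by (simp add: graded_piece_def wd_quotient_sel coset_restrict)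

lemma zero_gr: "\<zero>\<^bsub>gr i\<^esub> = W (i - 1)"
  by (simp add: graded_piece_def wd_quotient_sel quotient_module_def)

lemma cl_hom: "cl i \<in> module_hom EE (V\<lparr>carrier := W i\<rparr>) (gr i)"
  using quotient_space.cls_hom[OF quotient_space_gr[of i]]
  by (simp add: graded_piece_def module_hom_def wd_quotient_sel coset_restrict)

lemma cl_in_gr: "x \<in> W i \<Longrightarrow> cl i x \<in> carrier (gr i)"
  by (simp add: carrier_gr)

lemma cl_eq_iff: "x \<in> W i \<Longrightarrow> y \<in> W i \<Longrightarrow> cl i x = cl i y \<longleftrightarrow> x \<ominus> y \<in> W (i - 1)"
  using quotient_space.cls_eq_iff[OF quotient_space_gr[of i], of x y]
  by (simp add: coset_restrict minus_restrict)

lemma cl_eq_zero_iff: "x \<in> W i \<Longrightarrow> cl i x = \<zero>\<^bsub>gr i\<^esub> \<longleftrightarrow> x \<in> W (i - 1)"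
  using quotient_space.cls_eq_U_iff[OF quotient_space_gr[of i], of x]
  by (simp add: coset_restrict zero_gr)

lemma cl_add: "x \<in> W i \<Longrightarrow> y \<in> W i \<Longrightarrow> cl i (x \<oplus> y) = cl i x \<oplus>\<^bsub>gr i\<^esub> cl i y"
  using module_hom_add[OF cl_hom[of i], of x y] by simp

lemma cl_smult: "r \<in> E \<Longrightarrow> x \<in> W i \<Longrightarrow> cl i (r \<odot> x) = r \<odot>\<^bsub>gr i\<^esub> cl i x"
  using module_hom_smult[OF cl_hom[of i], of r x] by simp

lemma induced_map:
  assumes g: "g \<in> module_hom EE V V" "g ` W i \<subseteq> W j" "g ` W (i - 1) \<subseteq> W (j - 1)"
  shows "coset_map (V\<lparr>carrier := W j\<rparr>) (W (j - 1)) g \<in> module_hom EE (gr i) (gr j)"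
    and "x \<in> W i \<Longrightarrow> coset_map (V\<lparr>carrier := W j\<rparr>) (W (j - 1)) g (cl i x) = cl j (g x)"
proof -
  have g': "g \<in> module_hom EE (V\<lparr>carrier := W i\<rparr>) (V\<lparr>carrier := W j\<rparr>)"
    using g W_carrier by (auto simp: module_hom_def)
  show "coset_map (V\<lparr>carrier := W j\<rparr>) (W (j - 1)) g \<in> module_hom EE (gr i) (gr j)"
    using quotient_space.coset_map_hom[OF quotient_space_gr quotient_space_gr g' g(3)]
    by (simp add: graded_piece_def module_hom_def wd_quotient_sel)
  show "x \<in> W i \<Longrightarrow> coset_map (V\<lparr>carrier := W j\<rparr>) (W (j - 1)) g (cl i x) = cl j (g x)"
    using quotient_space.coset_map_cls[OF quotient_space_gr quotient_space_gr g' g(3)]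
    by (simp add: coset_restrict)
qed

lemma weil_action_gr:
  shows weil_action_gr_hom: "T_gr i \<in> module_hom EE (gr i) (gr i)"
    and weil_action_gr_cl: "x \<in> W i \<Longrightarrow> T_gr i (cl i x) = cl i (T x)"
  using induced_map[OF endo T_W[of i] T_W[of "i - 1"]] by (auto simp: graded_piece_def wd_quotient_sel)

lemma monodromy_gr:
  shows monodromy_gr_hom: "monodromy (gr i) \<in> module_hom EE (gr i) (gr i)"
    and monodromy_gr_cl: "x \<in> W i \<Longrightarrow> monodromy (gr i) (cl i x) = cl i (N x)"
  using induced_map[OF N_hom N_W[of i] N_W[of "i - 1"]] by (auto simp: graded_piece_def wd_quotient_sel)

lemma monodromy_pow_gr_cl: "x \<in> W i \<Longrightarrow> (monodromy (gr i) ^^ n) (cl i x) = cl i ((N ^^ n) x)"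
  by (induction n) (auto simp: monodromy_gr_cl N_pow_in_W)

lemma E_sub: "E \<subseteq> carrier F"
  using subfieldE(3)[OF subfield_E] .

lemma scalar_extension_gr: "scalar_extension F E (gr i)"
  using field_F E_sub module_gr[of i]
  by (simp add: scalar_extension_def scalar_extension_axioms_def scalar_ring_def fieldE)


subsection \<open>Weight spaces of the graded pieces, lifted to the representation\<close>

text \<open>The preimages in \<open>V\<close> of the weight spaces of the graded pieces. They allow one to argue with vectors
  of \<open>V\<close> modulo \<open>W (i - 1)\<close> instead of cosets.\<close>

definition Wt :: "int \<Rightarrow> int \<Rightarrow> 'v set" where
  "Wt i j = {x \<in> W i. cl i x \<in> wt_gr i j}"

lemma Wt_W: "x \<in> Wt i j \<Longrightarrow> x \<in> W i"
  by (simp add: Wt_def)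

lemma Wt_minus:
  assumes "x \<in> Wt i j" "y \<in> Wt i j" shows "x \<ominus> y \<in> Wt i j"
proof -
  interpret gr: module EE "gr i" by (rule module_gr)
  have s: "submodule EE (wt_gr i j) (gr i)"
    by (rule submodule_weight_space[OF scalar_extension_gr])
  have y: "\<ominus> y = (\<ominus>\<^bsub>EE\<^esub> \<one>\<^bsub>EE\<^esub>) \<odot> y" "\<ominus>\<^bsub>EE\<^esub> \<one>\<^bsub>EE\<^esub> \<in> carrier EE"
    using W_carrier[OF Wt_W[OF assms(2)]] smult_l_minus[of "\<one>\<^bsub>EE\<^esub>" y] smult_one[of y]
      R.a_inv_closed[OF R.one_closed] R.one_closed
    by (auto simp del: smult_one)
  have yW: "\<ominus> y \<in> W i" using assms Wt_W subspaceD(5)[OF W_subspace] by blast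
  have "cl i (\<ominus> y) \<in> wt_gr i j"
    unfolding y(1) using cl_smult[of _ y i] y(2) assms s by (simp add: Wt_def submodule_def)
  then show ?thesis
    using assms yW s W_add[of x i "\<ominus> y"] by (simp add: Wt_def submodule_def a_minus_def cl_add)
qed

lemma N_Wt: assumes x: "x \<in> Wt i j" shows "N x \<in> Wt i (j - 2)"
proof -
  have "T_gr i (monodromy (gr i) y) = c \<odot>\<^bsub>gr i\<^esub> monodromy (gr i) (T_gr i y)"
    if y: "y \<in> carrier (gr i)" for y
  proof -
    obtain x where x: "x \<in> W i" "y = cl i x" using y by (auto simp: carrier_gr)
    then show ?thesis
      by (simp add: monodromy_gr_cl weil_action_gr_cl T_in_W N_in_W T_N W_carrier cl_smult c)
  qed
  then have "monodromy (gr i) (cl i x) \<in> wt_gr i (j - 2)"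
    using weight_space_hom[OF scalar_extension_gr scalar_extension_gr monodromy_gr_hom
        weil_action_gr_hom weil_action_gr_hom c(1) _ weil_shift] x by (simp add: Wt_def)
  then show ?thesis using x by (simp add: Wt_def monodromy_gr_cl N_in_W)
qed

lemma N_pow_Wt: "x \<in> Wt i j \<Longrightarrow> (N ^^ n) x \<in> Wt i (j - 2 * int n)"
proof (induction n)
  case (Suc n)
  then show ?case using N_Wt[of "(N ^^ n) x" i "j - 2 * int n"] by (simp add: algebra_simps)
qed simp

text \<open>The map \<open>gr i \<rightarrow> gr (i - k)\<close> induced by \<open>g\<close> commutes with Frobenius.\<close>

lemma hom_Wt:
  assumes g: "g \<in> module_hom EE V V" and comm: "\<And>x. x \<in> carrier V \<Longrightarrow> T (g x) = g (T x)"
    and shift: "\<And>i. g ` W i \<subseteq> W (i - k)" and x: "x \<in> Wt i j"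
  shows "g x \<in> Wt (i - k) j"
proof -
  have s: "g ` W (i - 1) \<subseteq> W (i - k - 1)" using shift[of "i - 1"] by (simp add: algebra_simps)
  let ?g = "coset_map (V\<lparr>carrier := W (i - k)\<rparr>) (W (i - k - 1)) g"
  note ind = induced_map[OF g shift s]
  interpret gr: module EE "gr (i - k)" by (rule module_gr)
  have one: "\<one>\<^bsub>F\<^esub> \<in> E" "\<one>\<^bsub>F\<^esub> \<odot>\<^bsub>gr (i - k)\<^esub> y = y" if "y \<in> carrier (gr (i - k))" for y
    using R.one_closed gr.smult_one[OF that] by simp_all
  have oneE: "\<one>\<^bsub>F\<^esub> \<in> E" using R.one_closed by simp
  have "T_gr (i - k) (?g y) = \<one>\<^bsub>F\<^esub> \<odot>\<^bsub>gr (i - k)\<^esub> ?g (T_gr i y)"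
    if y: "y \<in> carrier (gr i)" for y
  proof -
    obtain x where x: "x \<in> W i" "y = cl i x" using y by (auto simp: carrier_gr)
    have gx: "g x \<in> W (i - k)" "g (T x) \<in> W (i - k)" using shift[of i] x T_in_W by auto
    show ?thesis
      using x gx by (simp add: ind(2) weil_action_gr_cl T_in_W comm[OF W_carrier] one(2) cl_in_gr)
  qed
  moreover have "weil_number q F j (\<one>\<^bsub>F\<^esub> \<otimes>\<^bsub>F\<^esub> \<alpha>)" if "weil_number q F j \<alpha>" for \<alpha>
  proof -
    interpret F: field F by (rule field_F)
    have "\<alpha> \<in> carrier F" using that by (simp add: weil_number_def algebraic_numbers_def)
    then show ?thesis using that by simp
  qed
  ultimately have "?g (cl i x) \<in> wt_gr (i - k) j"
    using weight_space_hom[OF scalar_extension_gr scalar_extension_gr ind(1)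
        weil_action_gr_hom weil_action_gr_hom oneE, of q j j "cl i x"] x by (simp add: Wt_def)
  then show ?thesis using x shift[of i] ind(2)[of x] by (auto simp: Wt_def)
qed

text \<open>Purity of \<open>gr i\<close>, stated modulo \<open>W (i - 1)\<close>: the power \<open>N\<^sup>m\<close> is injective from weight \<open>i + m\<close>, and
  reaches all of weight \<open>i - m\<close>.\<close>

lemma N_pow_injective:
  assumes x: "x \<in> Wt i (i + int m)" and N: "(N ^^ m) x \<in> W (i - 1)"
  shows "x \<in> W (i - 1)"
proof -
  let ?Y = "wt_gr i (i + int m)"
  have xW: "x \<in> W i" using x by (rule Wt_W)
  have "inj_on (monodromy (gr i) ^^ m) ?Y"
    using pure[of i] by (auto simp: pure_of_weight_def bij_betw_def)
  moreover have "cl i \<zero> \<in> ?Y"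
    using submodule_weight_space[OF scalar_extension_gr, of q frob i "i + int m"]
      cl_eq_zero_iff[OF W_zero[of i]] W_zero by (simp add: submodule_def)
  moreover have "(N ^^ m) \<zero> = \<zero>"
    using N_pow_minus[of "\<zero>" "\<zero>" m] N_pow_closed[of "\<zero>" m] by (simp add: a_minus_def M.r_neg)
  moreover have "(monodromy (gr i) ^^ m) (cl i x) = (monodromy (gr i) ^^ m) (cl i \<zero>)"
    unfolding monodromy_pow_gr_cl[OF xW] monodromy_pow_gr_cl[OF W_zero]
      \<open>(N ^^ m) \<zero> = \<zero>\<close>
    using N cl_eq_zero_iff[OF N_pow_in_W[OF xW]] cl_eq_zero_iff[OF W_zero[of i]] W_zero by simp
  ultimately have "cl i x = cl i \<zero>" using x by (auto simp: Wt_def dest: inj_onD)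
  then show ?thesis
    using cl_eq_zero_iff[OF xW] cl_eq_zero_iff[OF W_zero[of i]] W_zero by simp
qed

lemma N_pow_surjective:
  assumes y: "y \<in> Wt i (i - int m)"
  obtains z where "z \<in> Wt i (i + int m)" "y \<ominus> (N ^^ m) z \<in> W (i - 1)"
proof -
  have "(monodromy (gr i) ^^ m) ` wt_gr i (i + int m) =
      wt_gr i (i - int m)"
    using pure[of i] by (auto simp: pure_of_weight_def bij_betw_def)
  then obtain u where u: "u \<in> wt_gr i (i + int m)"
    "cl i y = (monodromy (gr i) ^^ m) u"
    using y by (auto simp: Wt_def)
  then obtain z where z: "z \<in> W i" "u = cl i z"
    by (auto simp: weight_space_def carrier_gr)
  then have "cl i y = cl i ((N ^^ m) z)" using u by (simp add: monodromy_pow_gr_cl)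
  then have "y \<ominus> (N ^^ m) z \<in> W (i - 1)" using cl_eq_iff[OF Wt_W[OF y] N_pow_in_W[OF z(1)]] by simp
  then show thesis using that z u by (simp add: Wt_def)
qed

text \<open>A pure representation is the sum of its weight spaces.\<close>

lemma Wt_generate:
  assumes U: "subspace EE U V" and sub: "W (i - 1) \<subseteq> U" "\<And>j. Wt i j \<subseteq> U"
  shows "W i \<subseteq> U"
proof
  fix y assume y: "y \<in> W i"
  interpret gr: module EE "gr i" by (rule module_gr)
  note U' = subspaceD[OF U]
  have "submodule EE (cl i ` (U \<inter> W i)) (gr i)"
  proof (rule submodule.intro[OF module_gr])
    show "cl i ` (U \<inter> W i) \<subseteq> carrier (gr i)" by (auto simp: carrier_gr)
    show "\<zero>\<^bsub>gr i\<^esub> \<in> cl i ` (U \<inter> W i)"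
      using cl_eq_zero_iff[OF W_zero[of i]] W_zero U'(2) by (metis IntI imageI)
    show "v \<oplus>\<^bsub>gr i\<^esub> w \<in> cl i ` (U \<inter> W i)" if vw: "v \<in> cl i ` (U \<inter> W i)" "w \<in> cl i ` (U \<inter> W i)" for v w
    proof -
      obtain x y where xy: "x \<in> U" "x \<in> W i" "v = cl i x" "y \<in> U" "y \<in> W i" "w = cl i y"
        using vw by blast
      then have "v \<oplus>\<^bsub>gr i\<^esub> w = cl i (x \<oplus> y)" by (simp add: cl_add)
      moreover have "x \<oplus> y \<in> U \<inter> W i" using xy U'(3) W_add by blast
      ultimately show ?thesis by blast
    qed
    show "r \<odot>\<^bsub>gr i\<^esub> v \<in> cl i ` (U \<inter> W i)" if rv: "r \<in> carrier EE" "v \<in> cl i ` (U \<inter> W i)" for r v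
    proof -
      obtain x where x: "x \<in> U" "x \<in> W i" "v = cl i x" using rv by blast
      then have "r \<odot>\<^bsub>gr i\<^esub> v = cl i (r \<odot> x)" using rv by (simp add: cl_smult)
      moreover have "r \<odot> x \<in> U \<inter> W i" using x rv U'(4) W_smult by auto
      ultimately show ?thesis by blast
    qed
  qed
  moreover have "wt_gr i j \<subseteq> cl i ` (U \<inter> W i)" for j
  proof
    fix u assume u: "u \<in> wt_gr i j"
    then obtain x where x: "x \<in> W i" "u = cl i x" by (auto simp: weight_space_def carrier_gr)
    then have "x \<in> Wt i j" using u by (simp add: Wt_def)
    then show "u \<in> cl i ` (U \<inter> W i)" using x sub by blast
  qed
  moreover have "internal_direct_sum (gr i) (wt_gr i)"
    using pure[of i] by (simp add: pure_of_weight_def)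
  ultimately have "carrier (gr i) \<subseteq> cl i ` (U \<inter> W i)"
    using gr.internal_direct_sum_minimal by blast
  then obtain u where u: "u \<in> U" "u \<in> W i" "cl i y = cl i u" using cl_in_gr[OF y] by blast
  then have "y \<ominus> u \<in> U" using cl_eq_iff[OF y u(2)] sub by blast
  then have "u \<oplus> (y \<ominus> u) \<in> U" using u U' by blast
  then show "y \<in> U" using y u W_carrier by (simp add: add_minus_cancel)
qed

end


context mixed_rep
begin

subsection \<open>Finiteness\<close>

lemma W_top: obtains n where "W n = carrier V"
proof -
  obtain A where A: "finite A" "A \<subseteq> carrier V" "span A = carrier V"
    using fd by (auto simp: fin_dim_def)
  have "\<exists>n. A \<subseteq> W n"
    using A(1,2)
  proof (induction A rule: finite_induct)
    case (insert a A)
    then obtain n m where nm: "A \<subseteq> W n" "a \<in> W m" using W_exhaustive by blast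
    then have "insert a A \<subseteq> W (max n m)"
      using W_le[of n "max n m"] W_le[of m "max n m"] by auto
    then show ?case by blast
  qed simp
  then obtain n where "A \<subseteq> W n" by blast
  then have "span A \<subseteq> W n" using span_is_subset is_module[OF W_subspace] by blast
  then show thesis using that A subspaceD(1)[OF W_subspace] by blast
qed

text \<open>A step of the filtration of minimal dimension is contained in all others, hence zero.\<close>

lemma W_bottom: obtains n where "W n = {\<zero>}"
proof -
  obtain n where n: "\<And>m. subspace_dim (W n) \<le> subspace_dim (W m)"
    using ex_has_least_nat[of "\<lambda>_. True" 0 "\<lambda>n. subspace_dim (W n)"] by auto
  have "W n \<subseteq> W m" for m
  proof (cases "n \<le> m")
    case True then show ?thesis using W_mono by (simp add: mono_def)
  next
    case False
    then have "W m \<subseteq> W n" using W_mono by (simp add: mono_def)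
    then have "W m = W n"
      using subspace_dim_strict_mono[OF fd W_subspace W_subspace, of m n] n[of m] by force
    then show ?thesis by simp
  qed
  then have "W n \<subseteq> {\<zero>}" using W_separated by blast
  then show thesis using that[of n] W_zero[of n] by blast
qed

lemma finitely_many_jumps: "finite {i. W i \<noteq> W (i - 1)}"
proof -
  obtain m where m: "W m = carrier V" by (rule W_top)
  obtain n where n: "W n = {\<zero>}" by (rule W_bottom)
  have "i \<in> {n..m}" if i: "W i \<noteq> W (i - 1)" for i
  proof (rule ccontr)
    assume "i \<notin> {n..m}"
    then consider "i < n" | "m \<le> i - 1" by fastforce
    then show False
    proof cases
      case 1
      have "W j = {\<zero>}" if j: "j < n" for j
      proof -
        have "W j \<subseteq> W n" using W_mono j by (simp add: mono_def)
        then show ?thesis using n W_zero[of j] by blast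
      qed
      then show False using i 1 by simp
    next
      case 2
      have "W j = carrier V" if j: "m \<le> j" for j
      proof -
        have "W m \<subseteq> W j" using W_mono j by (simp add: mono_def)
        then show ?thesis using m subspaceD(1)[OF W_subspace[of j]] by blast
      qed
      then show False using i 2 by simp
    qed
  qed
  then have "{i. W i \<noteq> W (i - 1)} \<subseteq> {n..m}" by blast
  then show ?thesis by (rule finite_subset) simp
qed

lemma gr_spanned:
  obtains A where "finite A" "A \<subseteq> carrier (gr i)" "LinearCombinations.module.span EE (gr i) A = carrier (gr i)"
proof -
  interpret gr: module EE "gr i" by (rule module_gr)
  obtain A where "finite A" "A \<subseteq> W i" "lin_indpt A" "card A = subspace_dim (W i)" "span A = W i"
    by (rule subspace_dim_witness[OF fd W_subspace[of i]])
  then have A: "finite A" "A \<subseteq> W i" "span A = W i" by simp_all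
  have sub: "submodule EE (W i) V" by (rule is_module[OF W_subspace])
  have sp: "LinearCombinations.module.span EE (V\<lparr>carrier := W i\<rparr>) A = W i"
    using span_li_not_depend(1)[OF A(2) sub] A(3) by simp
  have "carrier (gr i) \<subseteq> gr.span (cl i ` A)"
  proof
    fix y assume "y \<in> carrier (gr i)"
    then obtain x where x: "x \<in> W i" "y = cl i x" by (auto simp: carrier_gr)
    show "y \<in> gr.span (cl i ` A)"
      unfolding x(2)
      by (rule module_hom_span[OF submodule_is_module[OF sub] module_gr cl_hom, of A])
        (use A sp x cl_in_gr in auto)
  qed
  moreover have sub: "cl i ` A \<subseteq> carrier (gr i)" using A cl_in_gr by blast
  ultimately have "gr.span (cl i ` A) = carrier (gr i)"
    using gr.span_is_subset2[OF sub] by (simp add: subset_antisym)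
  then show thesis by (rule that[OF finite_imageI[OF A(1)] sub])
qed

text \<open>Only finitely many graded pieces are nonzero, and each has finitely many weights. The bound is
  formulated so that it also holds for the indices with \<open>W i = W (i - 1)\<close>.\<close>

lemma weights_bounded:
  obtains J :: nat where "\<And>i j. int J < \<bar>j - i\<bar> \<Longrightarrow> Wt i j \<subseteq> W (i - 1)"
proof -
  have fin: "finite {j. wt_gr i j \<noteq> {\<zero>\<^bsub>gr i\<^esub>}}" for i
  proof -
    interpret gr: module EE "gr i" by (rule module_gr)
    obtain A where "finite A" "A \<subseteq> carrier (gr i)" "LinearCombinations.module.span EE (gr i) A = carrier (gr i)"
      by (rule gr_spanned)
    then show ?thesis
      using gr.internal_direct_sum_finite[of "wt_gr i" A] pure[of i]
        submodule_weight_space[OF scalar_extension_gr]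
      by (simp add: pure_of_weight_def)
  qed
  define S where "S = (\<Union>i\<in>{i. W i \<noteq> W (i - 1)}.
    (\<lambda>j. nat \<bar>j - i\<bar>) ` {j. wt_gr i j \<noteq> {\<zero>\<^bsub>gr i\<^esub>}})"
  have "finite S" unfolding S_def using fin finitely_many_jumps by blast
  then obtain J where J: "\<forall>s\<in>S. s \<le> J" using finite_nat_set_iff_bounded_le by blast
  have "Wt i j \<subseteq> W (i - 1)" if ij: "int J < \<bar>j - i\<bar>" for i j
  proof (cases "W i = W (i - 1)")
    case True then show ?thesis using Wt_W by blast
  next
    case False
    have "wt_gr i j = {\<zero>\<^bsub>gr i\<^esub>}"
    proof (rule ccontr)
      assume "wt_gr i j \<noteq> {\<zero>\<^bsub>gr i\<^esub>}"
      then have "nat \<bar>j - i\<bar> \<in> S" using False unfolding S_def by blast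
      then show False using J ij by fastforce
    qed
    then show ?thesis using cl_eq_zero_iff by (auto simp: Wt_def)
  qed
  then show thesis using that by blast
qed


subsection \<open>Maps that lower the filtration\<close>

text \<open>The maps \<open>gr i \<rightarrow> gr (i - k)\<close> induced by the family \<open>h\<close> vanish. In \<open>gr i\<close>, a vector \<open>y\<close> of weight \<open>i + m\<close> with \<open>m \<ge> 0\<close>
  differs from some \<open>N z\<close>, where \<open>z\<close> has weight \<open>i + m + 2\<close>, by a vector \<open>x\<close> with \<open>N\<^sup>m\<^sup>+\<^sup>1 x = 0\<close>,
  because \<open>N\<^sup>m\<^sup>+\<^sup>2\<close> maps weight \<open>i + m + 2\<close> onto the weight \<open>i - m - 2\<close> of \<open>N\<^sup>m\<^sup>+\<^sup>1 y\<close>. The image of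
  \<open>x\<close> is killed by \<open>N\<^sup>m\<^sup>+\<^sup>1\<close> but lies in a weight of \<open>gr (i - k)\<close> on which \<open>N\<^sup>m\<^sup>+\<^sup>k\<close> is injective, so it is zero.
  A vector of weight \<open>i - m\<close> is of the form \<open>N\<^sup>m z\<close>, where \<open>z\<close> has weight \<open>i + m\<close>. In both cases
  the claim for \<open>y\<close> is reduced to the claim for the vector \<open>z\<close> of larger weight, and weights are bounded.
  Since moving \<open>N\<close> past \<open>h b\<close> changes \<open>b\<close>, the conclusion holds on a smaller range of \<open>b\<close>.\<close>

lemma lowering_step:
  fixes h :: "int \<Rightarrow> 'v \<Rightarrow> 'v" and k J :: nat and B :: int
  assumes h_hom: "\<And>b. h b \<in> module_hom EE V V"
    and h_T: "\<And>b x. x \<in> carrier V \<Longrightarrow> T (h b x) = h b (T x)"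
    and h_N: "\<And>b x. x \<in> carrier V \<Longrightarrow> h b (N x) = N (h (b + 1) x)"
    and k: "0 < k" and J: "\<And>i j. int J < \<bar>j - i\<bar> \<Longrightarrow> Wt i j \<subseteq> W (i - 1)"
    and low: "\<And>b i. \<bar>b\<bar> \<le> B \<Longrightarrow> h b ` W i \<subseteq> W (i - int k)"
    and b: "\<bar>b\<bar> \<le> B - (3 * int J + 3)"
  shows "h b ` W i \<subseteq> W (i - int (Suc k))"
proof -
  have h_closed: "h b x \<in> carrier V" if "x \<in> carrier V" for b x
    using module_hom_closed[OF h_hom] that by auto
  have h_add: "h b (x \<oplus> y) = h b x \<oplus> h b y" if "x \<in> carrier V" "y \<in> carrier V" for b x y
    using module_hom_add[OF h_hom that] .
  have h_N_pow: "h b ((N ^^ n) x) = (N ^^ n) (h (b + int n) x)" if x: "x \<in> carrier V" for b n x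
  proof (induction n arbitrary: b)
    case (Suc n)
    have "h b ((N ^^ Suc n) x) = N (h (b + 1) ((N ^^ n) x))" using h_N N_pow_closed x by simp
    also have "\<dots> = (N ^^ Suc n) (h (b + 1 + int n) x)" using Suc by simp
    finally show ?case by (simp add: algebra_simps)
  qed simp
  have low': "h b x \<in> W (i - int k - 1)" if "x \<in> W (i - 1)" "\<bar>b\<bar> \<le> B" for b i x
    using low[OF that(2), of "i - 1"] that(1) by (auto simp: algebra_simps)
  \<comment> \<open>Downward induction on the weight \<open>j\<close>. Each step decreases \<open>s\<close> by at least the amount by which it
    changes \<open>b\<close>; the margin \<open>J + 1\<close> is for the index \<open>b - (m + 1)\<close>, which occurs for \<open>m \<le> J\<close>. As \<open>s\<close> is at
    most \<open>2 J + 1\<close> for weights between \<open>i - J\<close> and \<open>i + J\<close>, a loss of \<open>3 J + 3\<close> is enough.\<close>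
  have weight: "h b y \<in> W (i - int k - 1)"
    if "y \<in> Wt i j" "nat (i + int J + 1 - j) = s" "\<bar>b\<bar> + int s \<le> B - (int J + 1)" for s j b y
    using that
  proof (induction s arbitrary: j b y rule: less_induct)
    case (less s)
    have yc: "y \<in> carrier V" and yW: "y \<in> W i" using less.prems(1) Wt_W W_carrier by blast+
    have bB: "\<bar>b\<bar> \<le> B" using less.prems by linarith
    show ?case
    proof (cases "int J < \<bar>j - i\<bar>")
      case True
      then show ?thesis using J[OF True] less.prems low' bB by blast
    next
      case small: False
      have s: "int s = i + int J + 1 - j" using small less.prems by linarith
      show ?thesis
      proof (cases "i \<le> j")
        case True
        define m where "m = nat (j - i)"
        have m: "j = i + int m" "m \<le> J" using True small by (auto simp: m_def)
        have "(N ^^ Suc m) y \<in> Wt i (i - int (m + 2))"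
          using N_pow_Wt[OF less.prems(1), of "Suc m"] by (simp add: m(1) algebra_simps)
        then obtain z where z: "z \<in> Wt i (i + int (m + 2))"
          "(N ^^ Suc m) y \<ominus> (N ^^ (m + 2)) z \<in> W (i - 1)"
          by (rule N_pow_surjective)
        have zc: "z \<in> carrier V" using z Wt_W W_carrier by blast
        define x where "x = y \<ominus> N z"
        have "N z \<in> Wt i j" using N_Wt[OF z(1)] by (simp add: m(1))
        then have x: "x \<in> Wt i j" unfolding x_def using Wt_minus less.prems by blast
        then have xc: "x \<in> carrier V" using Wt_W W_carrier by blast
        have "(N ^^ (m + 2)) z = (N ^^ Suc m) (N z)" by (simp add: funpow_swap1)
        then have "(N ^^ Suc m) x \<in> W (i - 1)"
          unfolding x_def using z(2) yc zc N_closed by (simp add: N_pow_minus del: funpow.simps)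
        then have "h (b - int (Suc m)) ((N ^^ Suc m) x) \<in> W (i - int k - 1)"
          using low' less.prems m(2) s by simp
        then have "(N ^^ Suc m) (h b x) \<in> W (i - int k - 1)"
          using h_N_pow[OF xc, of "b - int (Suc m)" "Suc m"] by (simp del: funpow.simps of_nat_Suc)
        then have "(N ^^ (k - 1)) ((N ^^ Suc m) (h b x)) \<in> W (i - int k - 1)" by (rule N_pow_in_W)
        moreover have "(N ^^ (k - 1)) ((N ^^ Suc m) (h b x)) = (N ^^ (m + k)) (h b x)"
        proof -
          have "m + k = (k - 1) + Suc m" using k by simp
          then show ?thesis by (simp only: funpow_add o_apply)
        qed
        moreover have "h b x \<in> Wt (i - int k) (i - int k + int (m + k))"
          using hom_Wt[OF h_hom h_T low[OF bB] x] by (simp add: m(1))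
        ultimately have hx: "h b x \<in> W (i - int k - 1)"
          using N_pow_injective[of "h b x" "i - int k" "m + k"] by simp
        have "h (b + 1) z \<in> W (i - int k - 1)"
        proof (rule less.IH[OF _ z(1) refl])
          show "nat (i + int J + 1 - (i + int (m + 2))) < s" using s m by simp
          show "\<bar>b + 1\<bar> + int (nat (i + int J + 1 - (i + int (m + 2)))) \<le> B - (int J + 1)"
            using less.prems(3) s m by linarith
        qed
        then have "h b (N z) \<in> W (i - int k - 1)" using N_in_W h_N[OF zc] by simp
        moreover have "y = N z \<oplus> x" unfolding x_def using yc zc N_closed by (simp add: add_minus_cancel)
        then have "h b y = h b (N z) \<oplus> h b x" using h_add N_closed zc xc by simp
        ultimately show ?thesis using hx W_add by simp
      next
        case False
        define m where "m = nat (i - j)"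
        have m: "j = i - int m" "m \<le> J" "0 < m" using False small by (auto simp: m_def)
        obtain z where z: "z \<in> Wt i (i + int m)" "y \<ominus> (N ^^ m) z \<in> W (i - 1)"
          using N_pow_surjective less.prems(1) unfolding m(1) by blast
        have zc: "z \<in> carrier V" using z Wt_W W_carrier by blast
        have "h (b + int m) z \<in> W (i - int k - 1)"
        proof (rule less.IH[OF _ z(1) refl])
          show "nat (i + int J + 1 - (i + int m)) < s" using s m by linarith
          show "\<bar>b + int m\<bar> + int (nat (i + int J + 1 - (i + int m))) \<le> B - (int J + 1)"
            using less.prems(3) s m by linarith
        qed
        then have "h b ((N ^^ m) z) \<in> W (i - int k - 1)" using h_N_pow[OF zc] N_pow_in_W by simp
        moreover have "h b (y \<ominus> (N ^^ m) z) \<in> W (i - int k - 1)" using low' z(2) bB by blast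
        moreover have "h b y = h b ((N ^^ m) z) \<oplus> h b (y \<ominus> (N ^^ m) z)"
          using h_add[of "(N ^^ m) z" "y \<ominus> (N ^^ m) z" b] yc N_pow_closed[OF zc]
          by (simp add: add_minus_cancel)
        ultimately show ?thesis using W_add by simp
      qed
    qed
  qed
  have bB: "\<bar>b\<bar> \<le> B" using b by linarith
  let ?U = "{x \<in> carrier V. h b x \<in> W (i - int k - 1)}"
  have "subspace EE ?U V"
  proof -
    have "submodule EE ?U V"
      by (rule module_hom_submodule_vimage[OF module_axioms module_axioms h_hom is_module[OF W_subspace]])
    then show ?thesis using vectorspace_axioms by (simp add: subspace_def)
  qed
  moreover have "W (i - 1) \<subseteq> ?U" using low' bB W_carrier by blast
  moreover have "Wt i j \<subseteq> ?U" for j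
  proof
    fix y assume y: "y \<in> Wt i j"
    show "y \<in> ?U"
    proof (cases "int J < \<bar>j - i\<bar>")
      case True
      then show ?thesis using J[OF True] y low' bB W_carrier by blast
    next
      case False
      then have "\<bar>b\<bar> + int (nat (i + int J + 1 - j)) \<le> B - (int J + 1)" using b by linarith
      then show ?thesis using weight[OF y refl] Wt_W[OF y] W_carrier by blast
    qed
  qed
  ultimately have "W i \<subseteq> ?U" by (rule Wt_generate)
  then show ?thesis by (auto simp: algebra_simps)
qed

text \<open>Iterating the step pushes the image of \<open>V\<close> down the whole filtration. The bound \<open>B\<close> depends on \<open>V\<close>
  only, so a polynomial can be chosen for it afterwards.\<close>

lemma lowering_imp_zero:
  obtains B :: int where "\<And>h. \<lbrakk>\<And>b. h b \<in> module_hom EE V V;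
      \<And>b x. x \<in> carrier V \<Longrightarrow> T (h b x) = h b (T x);
      \<And>b x. x \<in> carrier V \<Longrightarrow> h b (N x) = N (h (b + 1) x);
      \<And>b i. \<bar>b\<bar> \<le> B \<Longrightarrow> h b ` W i \<subseteq> W (i - 1)\<rbrakk> \<Longrightarrow> \<forall>x\<in>carrier V. h 0 x = \<zero>"
proof -
  obtain J :: nat where J: "\<And>i j. int J < \<bar>j - i\<bar> \<Longrightarrow> Wt i j \<subseteq> W (i - 1)"
    by (rule weights_bounded) blast
  obtain m where m: "W m = carrier V" by (rule W_top)
  obtain n where n: "W n = {\<zero>}" by (rule W_bottom)
  define l where "l = nat (m - n)"
  define D where "D = 3 * int J + 3"
  show thesis
  proof (rule that[of "int l * D"], rule ballI)
    fix h :: "int \<Rightarrow> 'v \<Rightarrow> 'v" and x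
    assume h: "\<And>b. h b \<in> module_hom EE V V"
      "\<And>b x. x \<in> carrier V \<Longrightarrow> T (h b x) = h b (T x)"
      "\<And>b x. x \<in> carrier V \<Longrightarrow> h b (N x) = N (h (b + 1) x)"
      and low: "\<And>b i. \<bar>b\<bar> \<le> int l * D \<Longrightarrow> h b ` W i \<subseteq> W (i - 1)" and x: "x \<in> carrier V"
    have "h b ` W i \<subseteq> W (i - int (Suc k))" if "k \<le> l" "\<bar>b\<bar> \<le> int (l - k) * D" for k b i
      using that
    proof (induction k arbitrary: b i)
      case 0 then show ?case using low by simp
    next
      case (Suc k)
      have eq: "int (l - Suc k) * D = int (l - k) * D - D"
        using Suc.prems(1) by (simp add: of_nat_diff algebra_simps)
      show ?case
      proof (rule lowering_step[where h = h and k = "Suc k" and J = J and B = "int (l - k) * D"])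
        show "h b ` W i \<subseteq> W (i - int (Suc k))" if "\<bar>b\<bar> \<le> int (l - k) * D" for b i
          using Suc.IH that Suc.prems(1) by simp
        show "\<bar>b\<bar> \<le> int (l - k) * D - (3 * int J + 3)" using Suc.prems(2) eq by (simp add: D_def)
      qed (use J h in simp_all)
    qed
    from this[of l 0 m] have "h 0 x \<in> W (m - int (Suc l))" using x m by auto
    moreover have "m - int (Suc l) \<le> n" by (simp add: l_def)
    ultimately have "h 0 x \<in> W n" using W_le by blast
    then show "h 0 x = \<zero>" using n by simp
  qed
qed

end


section \<open>The associated graded representation\<close>

lemma poly_eval_wd_direct_sum:
  "poly_eval (wd_direct_sum Y) (\<lambda>f i. S i (f i)) k f = (\<lambda>i. poly_eval (Y i) (S i) k (f i))"
  by (induction k arbitrary: f) (simp_all add: wd_direct_sum_def)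

context mixed_rep
begin

abbreviation Gr where "Gr \<equiv> associated_graded V W"
abbreviation T_Gr where "T_Gr \<equiv> weil_action Gr frob"

lemma Gr_sel:
  "carrier Gr = {f. (\<forall>i. f i \<in> carrier (gr i)) \<and> finite {i. f i \<noteq> \<zero>\<^bsub>gr i\<^esub>}}"
  "\<zero>\<^bsub>Gr\<^esub> = (\<lambda>i. \<zero>\<^bsub>gr i\<^esub>)" "f \<oplus>\<^bsub>Gr\<^esub> g = (\<lambda>i. f i \<oplus>\<^bsub>gr i\<^esub> g i)"
  "r \<odot>\<^bsub>Gr\<^esub> f = (\<lambda>i. r \<odot>\<^bsub>gr i\<^esub> f i)" "weil_action Gr w = (\<lambda>f i. weil_action (gr i) w (f i))"
  by (simp_all add: associated_graded_def wd_direct_sum_def)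

lemmas gr_abelian_monoid = abelian_group.axioms(1)[OF module.axioms(2)[OF module_gr]]

lemmas gr_simps [simp] =
  abelian_monoid.zero_closed[OF gr_abelian_monoid] abelian_monoid.l_zero[OF gr_abelian_monoid]
  abelian_monoid.r_zero[OF gr_abelian_monoid] abelian_monoid.a_closed[OF gr_abelian_monoid]
  Module.module.smult_r_null[OF module_gr, simplified]

lemma Gr_add_closed:
  assumes "f \<in> carrier Gr" "g \<in> carrier Gr" shows "f \<oplus>\<^bsub>Gr\<^esub> g \<in> carrier Gr"
proof -
  have "{i. f i \<oplus>\<^bsub>gr i\<^esub> g i \<noteq> \<zero>\<^bsub>gr i\<^esub>} \<subseteq> {i. f i \<noteq> \<zero>\<^bsub>gr i\<^esub>} \<union> {i. g i \<noteq> \<zero>\<^bsub>gr i\<^esub>}" by auto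
  moreover have "finite ({i. f i \<noteq> \<zero>\<^bsub>gr i\<^esub>} \<union> {i. g i \<noteq> \<zero>\<^bsub>gr i\<^esub>})" using assms by (simp add: Gr_sel)
  ultimately have "finite {i. f i \<oplus>\<^bsub>gr i\<^esub> g i \<noteq> \<zero>\<^bsub>gr i\<^esub>}" by (rule finite_subset)
  then show ?thesis using assms by (simp add: Gr_sel)
qed

lemma Gr_map_closed:
  assumes f: "f \<in> carrier Gr" and g: "\<And>i. g i \<in> module_hom EE (gr i) (gr i)"
  shows "(\<lambda>i. g i (f i)) \<in> carrier Gr"
proof -
  have "g i \<zero>\<^bsub>gr i\<^esub> = \<zero>\<^bsub>gr i\<^esub>" for i
    using mod_hom.f0_is_0[of EE "gr i" "gr i" "g i"] g module_gr
    by (simp add: mod_hom_def mod_hom_axioms_def)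
  then have "{i. g i (f i) \<noteq> \<zero>\<^bsub>gr i\<^esub>} \<subseteq> {i. f i \<noteq> \<zero>\<^bsub>gr i\<^esub>}" by auto
  moreover have "finite {i. f i \<noteq> \<zero>\<^bsub>gr i\<^esub>}" using f by (simp add: Gr_sel)
  ultimately have "finite {i. g i (f i) \<noteq> \<zero>\<^bsub>gr i\<^esub>}" by (rule finite_subset)
  moreover have "g i (f i) \<in> carrier (gr i)" for i
    using module_hom_closed[OF g[of i]] f by (auto simp: Gr_sel)
  ultimately show ?thesis by (simp add: Gr_sel)
qed

lemma smult_gr_hom: "r \<in> E \<Longrightarrow> (\<lambda>x. r \<odot>\<^bsub>gr i\<^esub> x) \<in> module_hom EE (gr i) (gr i)"
proof -
  assume r: "r \<in> E"
  interpret gr: module EE "gr i" by (rule module_gr)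
  have "r \<odot>\<^bsub>gr i\<^esub> (s \<odot>\<^bsub>gr i\<^esub> x) = s \<odot>\<^bsub>gr i\<^esub> (r \<odot>\<^bsub>gr i\<^esub> x)" if "s \<in> E" "x \<in> carrier (gr i)" for s x
    using r that gr.smult_assoc1[of r s x] gr.smult_assoc1[of s r x] R.m_comm[of r s] by simp
  then show ?thesis
    using r by (auto simp: module_hom_def gr.smult_r_distr)
qed

lemma module_Gr: "module EE Gr"
proof (rule module_criteria)
  have gr: "module EE (gr i)" for i by (rule module_gr)
  show "cring EE" by (rule R.is_cring)
  show "\<zero>\<^bsub>Gr\<^esub> \<in> carrier Gr"
    using abelian_monoid.zero_closed[OF gr_abelian_monoid] by (simp add: Gr_sel)
  show "\<forall>v w. v \<in> carrier Gr \<and> w \<in> carrier Gr \<longrightarrow> v \<oplus>\<^bsub>Gr\<^esub> w \<in> carrier Gr"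
    using Gr_add_closed by blast
  show smult: "\<forall>r v. r \<in> carrier EE \<and> v \<in> carrier Gr \<longrightarrow> r \<odot>\<^bsub>Gr\<^esub> v \<in> carrier Gr"
    using Gr_map_closed[OF _ smult_gr_hom] by (simp add: Gr_sel(4))
  show "\<forall>v\<in>carrier Gr. \<exists>w\<in>carrier Gr. v \<oplus>\<^bsub>Gr\<^esub> w = \<zero>\<^bsub>Gr\<^esub>"
  proof
    fix v assume v: "v \<in> carrier Gr"
    define r where "r = \<ominus>\<^bsub>EE\<^esub> \<one>\<^bsub>EE\<^esub>"
    have r: "r \<in> carrier EE" unfolding r_def by (intro R.a_inv_closed R.one_closed)
    have "v i \<oplus>\<^bsub>gr i\<^esub> r \<odot>\<^bsub>gr i\<^esub> v i = \<zero>\<^bsub>gr i\<^esub>" for i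
    proof -
      interpret gr: module EE "gr i" by (rule module_gr)
      have vi: "v i \<in> carrier (gr i)" using v by (simp add: Gr_sel)
      have "r \<odot>\<^bsub>gr i\<^esub> v i = \<ominus>\<^bsub>gr i\<^esub> v i"
        unfolding r_def using gr.smult_l_minus[OF R.one_closed vi] gr.smult_one[OF vi] by simp
      then show ?thesis using vi by (simp add: gr.M.r_neg)
    qed
    then have "v \<oplus>\<^bsub>Gr\<^esub> (r \<odot>\<^bsub>Gr\<^esub> v) = \<zero>\<^bsub>Gr\<^esub>" by (simp add: Gr_sel)
    then show "\<exists>w\<in>carrier Gr. v \<oplus>\<^bsub>Gr\<^esub> w = \<zero>\<^bsub>Gr\<^esub>" using smult r v by blast
  qed
  show "\<forall>v w. v \<in> carrier Gr \<and> w \<in> carrier Gr \<longrightarrow> v \<oplus>\<^bsub>Gr\<^esub> w = w \<oplus>\<^bsub>Gr\<^esub> v"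
    using abelian_monoid.a_comm[OF gr_abelian_monoid] by (auto simp: Gr_sel)
  show "\<forall>v w x. v \<in> carrier Gr \<and> w \<in> carrier Gr \<and> x \<in> carrier Gr \<longrightarrow>
      v \<oplus>\<^bsub>Gr\<^esub> w \<oplus>\<^bsub>Gr\<^esub> x = v \<oplus>\<^bsub>Gr\<^esub> (w \<oplus>\<^bsub>Gr\<^esub> x)"
    using abelian_monoid.a_assoc[OF gr_abelian_monoid] by (auto simp: Gr_sel)
  show "\<forall>v\<in>carrier Gr. v \<oplus>\<^bsub>Gr\<^esub> \<zero>\<^bsub>Gr\<^esub> = v"
    using abelian_monoid.r_zero[OF gr_abelian_monoid] by (auto simp: Gr_sel)
  show "\<forall>a b v. a \<in> carrier EE \<and> b \<in> carrier EE \<and> v \<in> carrier Gr \<longrightarrow>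
      (a \<otimes>\<^bsub>EE\<^esub> b) \<odot>\<^bsub>Gr\<^esub> v = a \<odot>\<^bsub>Gr\<^esub> (b \<odot>\<^bsub>Gr\<^esub> v)"
    using Module.module.smult_assoc1[OF gr] by (auto simp: Gr_sel)
  show "\<forall>v\<in>carrier Gr. \<one>\<^bsub>EE\<^esub> \<odot>\<^bsub>Gr\<^esub> v = v"
    using Module.module.smult_one[OF gr] by (auto simp: Gr_sel)
  show "\<forall>a b v. a \<in> carrier EE \<and> b \<in> carrier EE \<and> v \<in> carrier Gr \<longrightarrow>
      (a \<oplus>\<^bsub>EE\<^esub> b) \<odot>\<^bsub>Gr\<^esub> v = a \<odot>\<^bsub>Gr\<^esub> v \<oplus>\<^bsub>Gr\<^esub> b \<odot>\<^bsub>Gr\<^esub> v"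
    using Module.module.smult_l_distr[OF gr] by (auto simp: Gr_sel)
  show "\<forall>a v w. a \<in> carrier EE \<and> v \<in> carrier Gr \<and> w \<in> carrier Gr \<longrightarrow>
      a \<odot>\<^bsub>Gr\<^esub> (v \<oplus>\<^bsub>Gr\<^esub> w) = a \<odot>\<^bsub>Gr\<^esub> v \<oplus>\<^bsub>Gr\<^esub> a \<odot>\<^bsub>Gr\<^esub> w"
    using Module.module.smult_r_distr[OF gr] by (auto simp: Gr_sel)
qed

definition incl :: "int \<Rightarrow> 'v set \<Rightarrow> int \<Rightarrow> 'v set" where
  "incl i y = (\<lambda>j. if j = i then y else \<zero>\<^bsub>gr j\<^esub>)"

lemma incl_hom: "incl i \<in> module_hom EE (gr i) Gr"
proof -
  have "finite {j. incl i y j \<noteq> \<zero>\<^bsub>gr j\<^esub>}" for y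
    by (rule finite_subset[of _ "{i}"]) (auto simp: incl_def)
  then show ?thesis
    by (auto simp: module_hom_def Gr_sel incl_def fun_eq_iff)
qed

text \<open>The graded pieces with \<open>W i = W (i - 1)\<close> are zero and the others, finitely many, are spanned by
  finite sets.\<close>

lemma Gr_spanned:
  "\<exists>B. finite B \<and> B \<subseteq> carrier Gr \<and> LinearCombinations.module.span EE Gr B = carrier Gr"
proof -
  interpret Gr: module EE Gr by (rule module_Gr)
  have "\<forall>i. \<exists>A. finite A \<and> A \<subseteq> carrier (gr i) \<and> LinearCombinations.module.span EE (gr i) A = carrier (gr i)"
    by (rule allI, rule gr_spanned) blast
  then obtain A where A: "\<And>i. finite (A i)" "\<And>i. A i \<subseteq> carrier (gr i)"
    "\<And>i. LinearCombinations.module.span EE (gr i) (A i) = carrier (gr i)" by metis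
  define B where "B = (\<Union>i\<in>{i. W i \<noteq> W (i - 1)}. incl i ` A i)"
  have finB: "finite B" unfolding B_def using finitely_many_jumps A(1) by blast
  have Bc: "B \<subseteq> carrier Gr" unfolding B_def using A(2) module_hom_closed[OF incl_hom] by blast
  have span: "submodule EE (Gr.span B) Gr" by (rule Gr.span_is_submodule[OF Bc])
  have piece: "incl i y \<in> Gr.span B" if y: "y \<in> carrier (gr i)" for i y
  proof (cases "W i = W (i - 1)")
    case True
    then have "y = \<zero>\<^bsub>gr i\<^esub>" using y cl_eq_zero_iff by (auto simp: carrier_gr)
    then have "incl i y = \<zero>\<^bsub>Gr\<^esub>" by (auto simp: incl_def Gr_sel fun_eq_iff)
    then show ?thesis using span by (simp add: submodule_def)
  next
    case False
    show ?thesis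
      by (rule module_hom_span[OF module_gr module_Gr incl_hom A(2)])
        (use False y A(3) Bc in \<open>auto simp: B_def\<close>)
  qed
  have "f \<in> Gr.span B" if "finite S" "f \<in> carrier Gr" "{i. f i \<noteq> \<zero>\<^bsub>gr i\<^esub>} \<subseteq> S" for S f
    using that
  proof (induction S arbitrary: f rule: finite_induct)
    case empty
    then have "f = \<zero>\<^bsub>Gr\<^esub>" by (auto simp: Gr_sel)
    then show ?case using span by (simp add: submodule_def)
  next
    case (insert a S)
    define f' where "f' = f(a := \<zero>\<^bsub>gr a\<^esub>)"
    have fa: "f i \<in> carrier (gr i)" for i using insert.prems by (simp add: Gr_sel)
    have supp: "{i. f' i \<noteq> \<zero>\<^bsub>gr i\<^esub>} \<subseteq> S" using insert.prems by (auto simp: f'_def)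
    have "f' \<in> carrier Gr"
      using fa finite_subset[OF supp insert.hyps(1)] by (auto simp: Gr_sel f'_def)
    then have "f' \<in> Gr.span B" using insert.IH supp by blast
    moreover have "f = incl a (f a) \<oplus>\<^bsub>Gr\<^esub> f'"
      using fa by (auto simp: Gr_sel incl_def f'_def fun_eq_iff)
    ultimately show ?case using piece[OF fa[of a]] span by (metis submodule.m_closed)
  qed
  then have "carrier Gr \<subseteq> Gr.span B" by (auto simp: Gr_sel)
  then have "Gr.span B = carrier Gr" using Gr.span_is_subset2[OF Bc] by (simp add: subset_antisym)
  then show ?thesis using finB Bc by blast
qed

lemma Gr_endomorphism: "vector_endomorphism EE Gr T_Gr"
proof -
  have "T_Gr \<in> module_hom EE Gr Gr"
    unfolding module_hom_def
  proof (intro CollectI conjI allI impI funcsetI)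
    fix f assume "f \<in> carrier Gr"
    then show "T_Gr f \<in> carrier Gr"
      using Gr_map_closed[OF _ weil_action_gr_hom] by (simp add: Gr_sel(5))
  next
    fix f g assume "f \<in> carrier Gr \<and> g \<in> carrier Gr"
    then show "T_Gr (f \<oplus>\<^bsub>Gr\<^esub> g) = T_Gr f \<oplus>\<^bsub>Gr\<^esub> T_Gr g"
      using module_hom_add[OF weil_action_gr_hom] by (simp add: Gr_sel)
  next
    fix r f assume "r \<in> carrier EE \<and> f \<in> carrier Gr"
    then show "T_Gr (r \<odot>\<^bsub>Gr\<^esub> f) = r \<odot>\<^bsub>Gr\<^esub> T_Gr f"
      using module_hom_smult[OF weil_action_gr_hom] by (simp add: Gr_sel)
  qed
  then show ?thesis
    using module_Gr field.field_axioms
    by (simp add: vector_endomorphism_def vector_endomorphism_axioms_def vectorspace_def)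
qed

lemma Gr_fin_dim: "vectorspace.fin_dim EE Gr"
proof -
  interpret Gr: vector_endomorphism EE Gr "T_Gr" by (rule Gr_endomorphism)
  show ?thesis using Gr_spanned by (auto simp: Gr.fin_dim_def)
qed

lemma poly_eval_gr:
  assumes S: "\<And>x. x \<in> W i \<Longrightarrow> S (cl i x) = cl i (T' x)" and T': "T' \<in> module_hom EE V V" "T' ` W i \<subseteq> W i"
    and k: "k \<in> polys_over EE" and x: "x \<in> W i"
  shows "poly_eval (gr i) S k (cl i x) = cl i (poly_eval V T' k x)"
proof -
  have "T' \<in> module_hom EE (V\<lparr>carrier := W i\<rparr>) (V\<lparr>carrier := W i\<rparr>)"
    using T' W_carrier by (auto simp: module_hom_def)
  then have v: "vector_endomorphism EE (V\<lparr>carrier := W i\<rparr>) T'"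
    using subspace_is_vs[OF W_subspace] by (simp add: vector_endomorphism_def vector_endomorphism_axioms_def)
  have "poly_eval (V\<lparr>carrier := W i\<rparr>) T' k = poly_eval V T' k" by (rule poly_eval_cong_ops) simp_all
  then show ?thesis
    using poly_eval_natural[OF v cl_hom, of S k x] S k x by simp
qed

text \<open>An identity between polynomials in \<open>T\<close> that holds on \<open>V\<close> holds on all graded pieces.\<close>

lemma regular_imp_Gr_regular:
  assumes "regular_endomorphism EE V T"
  shows "regular_endomorphism EE Gr T_Gr"
  unfolding regular_endomorphism_def
proof
  fix k assume k: "k \<in> polys_over EE"
  then obtain l where l: "l \<in> polys_over EE"
    "\<And>x. x \<in> carrier V \<Longrightarrow> poly_eval V T (Times k (Times k l)) x = poly_eval V T k x"
    using assms unfolding regular_endomorphism_def by blast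
  have kkl: "Times k (Times k l) \<in> polys_over EE" using k l(1) by simp
  have gr_eval: "poly_eval (gr i) (T_gr i) e (cl i x) = cl i (poly_eval V T e x)"
    if "e \<in> polys_over EE" "x \<in> W i" for e i x
    by (rule poly_eval_gr[OF _ endo T_W that]) (rule weil_action_gr_cl)
  have "poly_eval Gr T_Gr (Times k (Times k l)) f = poly_eval Gr T_Gr k f"
    if f: "f \<in> carrier Gr" for f
  proof -
    have pointwise: "poly_eval (gr i) (T_gr i) (Times k (Times k l)) (f i) =
        poly_eval (gr i) (T_gr i) k (f i)" for i
    proof -
      obtain x where x: "x \<in> W i" "f i = cl i x" using f by (auto simp: Gr_sel carrier_gr)
      show ?thesis
        unfolding x(2) gr_eval[OF kkl x(1)] gr_eval[OF k x(1)] using l(2)[OF W_carrier[OF x(1)]] by simp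
    qed
    show ?thesis
      unfolding Gr_sel(5) unfolding associated_graded_def
        poly_eval_wd_direct_sum[where S = T_gr]
      by (rule ext) (rule pointwise)
  qed
  then show "\<exists>l\<in>polys_over EE. \<forall>f\<in>carrier Gr.
      poly_eval Gr T_Gr (Times k (Times k l)) f = poly_eval Gr T_Gr k f"
    using l(1) by blast
qed

definition c_power :: "int \<Rightarrow> 'e" where
  "c_power b = (if 0 \<le> b then c [^]\<^bsub>EE\<^esub> nat b else (inv\<^bsub>EE\<^esub> c) [^]\<^bsub>EE\<^esub> nat (- b))"

lemma c_power_props:
  shows c_power_E: "c_power b \<in> E" and c_power_0: "c_power 0 = \<one>\<^bsub>F\<^esub>"
    and c_power_Suc: "c_power (b + 1) = c_power b \<otimes>\<^bsub>F\<^esub> c" and c_power_nonzero: "c_power b \<noteq> \<zero>\<^bsub>F\<^esub>"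
proof -
  interpret F: field F by (rule field_F)
  have cu: "c \<in> Units EE" using c field.field_Units by simp
  have i: "inv\<^bsub>EE\<^esub> c \<in> carrier EE" "inv\<^bsub>EE\<^esub> c \<otimes>\<^bsub>EE\<^esub> c = \<one>\<^bsub>EE\<^esub>"
    using cu R.Units_inv_closed R.Units_l_inv by blast+
  have cE: "c \<in> carrier EE" using c by simp
  have E: "c_power b \<in> E" for b
    using R.nat_pow_closed[OF i(1), of "nat (- b)"] R.nat_pow_closed[OF cE, of "nat b"]
    by (simp add: c_power_def del: pow_nat)
  then show "c_power b \<in> E" .
  show "c_power 0 = \<one>\<^bsub>F\<^esub>" by (simp add: c_power_def)
  have Suc: "c_power (b + 1) = c_power b \<otimes>\<^bsub>EE\<^esub> c" for b
  proof (cases "0 \<le> b")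
    case True
    then have "nat (b + 1) = Suc (nat b)" by simp
    then show ?thesis using True R.nat_pow_Suc[of c "nat b"] by (simp add: c_power_def)
  next
    case False
    define n where "n = nat (- b) - 1"
    have n: "nat (- b) = Suc n" "nat (- (b + 1)) = n" using False by (simp_all add: n_def)
    have "c_power b \<otimes>\<^bsub>EE\<^esub> c = ((inv\<^bsub>EE\<^esub> c) [^]\<^bsub>EE\<^esub> n \<otimes>\<^bsub>EE\<^esub> inv\<^bsub>EE\<^esub> c) \<otimes>\<^bsub>EE\<^esub> c"
      using False by (simp add: c_power_def n)
    also have "\<dots> = (inv\<^bsub>EE\<^esub> c) [^]\<^bsub>EE\<^esub> n"
      using R.m_assoc[OF R.nat_pow_closed[OF i(1), of n] i(1) cE] i R.r_one[OF R.nat_pow_closed[OF i(1), of n]]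
      by simp
    also have "\<dots> = c_power (b + 1)"
    proof (cases "b + 1 = 0")
      case True
      then have "n = 0" using n by simp
      then show ?thesis using True by (simp add: c_power_def)
    next
      case False
      then show ?thesis using \<open>\<not> 0 \<le> b\<close> n by (simp add: c_power_def)
    qed
    finally show ?thesis ..
  qed
  then show "c_power (b + 1) = c_power b \<otimes>\<^bsub>F\<^esub> c" by simp
  have nz: "x [^]\<^bsub>EE\<^esub> n \<noteq> \<zero>\<^bsub>EE\<^esub>" if "x \<in> carrier EE" "x \<noteq> \<zero>\<^bsub>EE\<^esub>" for x and n :: nat
    using that
  proof (induction n)
    case (Suc n)
    then show ?case
      using field.integral[of "x [^]\<^bsub>EE\<^esub> n" x] R.nat_pow_closed[of x n] R.nat_pow_Suc[of x n] by auto
  qed (use field.one_not_zero in simp)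
  have "inv\<^bsub>EE\<^esub> c \<noteq> \<zero>\<^bsub>EE\<^esub>"
  proof
    assume "inv\<^bsub>EE\<^esub> c = \<zero>\<^bsub>EE\<^esub>"
    then have "\<zero>\<^bsub>EE\<^esub> = \<one>\<^bsub>EE\<^esub>" using i(2) R.l_null[OF cE] by simp
    then show False using field.one_not_zero by simp
  qed
  then show "c_power b \<noteq> \<zero>\<^bsub>F\<^esub>"
    using nz[OF i(1)] nz[OF cE] c by (simp add: c_power_def del: pow_nat)
qed

text \<open>The polynomial \<open>h = k - k\<^sup>2 l\<close> is chosen to vanish at \<open>c\<^sup>b T\<close> on the associated graded space for all \<open>b\<close>
  in the range that \<open>lowering_imp_zero\<close> asks for; then it vanishes at \<open>T\<close> on \<open>V\<close>.\<close>

lemma Gr_regular_imp_regular: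
  assumes reg: "regular_endomorphism EE Gr T_Gr"
  shows "regular_endomorphism EE V T"
  unfolding regular_endomorphism_def
proof
  interpret Gr: vector_endomorphism EE Gr "T_Gr" by (rule Gr_endomorphism)
  fix k assume k: "k \<in> polys_over EE"
  obtain B :: int where B: "\<And>h. \<lbrakk>\<And>b. h b \<in> module_hom EE V V;
      \<And>b x. x \<in> carrier V \<Longrightarrow> T (h b x) = h b (T x);
      \<And>b x. x \<in> carrier V \<Longrightarrow> h b (N x) = N (h (b + 1) x);
      \<And>b i. \<bar>b\<bar> \<le> B \<Longrightarrow> h b ` W i \<subseteq> W (i - 1)\<rbrakk> \<Longrightarrow> \<forall>x\<in>carrier V. h 0 x = \<zero>"
    by (rule lowering_imp_zero) blast
  let ?P = "c_power ` {- B..B}"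
  have "?P \<subseteq> carrier EE - {\<zero>\<^bsub>EE\<^esub>}" using c_power_E c_power_nonzero by auto
  then obtain l where l: "l \<in> polys_over EE"
    "\<And>r f. r \<in> ?P \<Longrightarrow> f \<in> carrier Gr \<Longrightarrow>
      poly_eval Gr (\<lambda>f. r \<odot>\<^bsub>Gr\<^esub> T_Gr f) (Times k (Times k l)) f =
      poly_eval Gr (\<lambda>f. r \<odot>\<^bsub>Gr\<^esub> T_Gr f) k f"
    using Gr.regular_scaled_simultaneously[OF reg k, of ?P] by blast
  define S where "S b = (\<lambda>x. c_power b \<odot> T x)" for b
  have S_endo: "vector_endomorphism EE V (S b)" for b
    unfolding S_def using scaled_endomorphism[of "c_power b"] c_power_E by simp
  have S_hom: "S b \<in> module_hom EE V V" for b using vector_endomorphism.endo[OF S_endo] .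
  have S_W: "S b ` W i \<subseteq> W i" for b i using W_smult c_power_E T_in_W by (auto simp: S_def)
  define e where "e = minus_expr k (Times k (Times k l))"
  have kkl: "Times k (Times k l) \<in> polys_over EE" using k l(1) by simp
  have e: "e \<in> polys_over EE" using k l(1) R.a_inv_closed[OF R.one_closed] by (simp add: e_def)
  have ev_e: "poly_eval V (S b) e x = poly_eval V (S b) k x \<ominus> poly_eval V (S b) (Times k (Times k l)) x"
    if "x \<in> carrier V" for b x
    unfolding e_def using vector_endomorphism.ev_minus_expr[OF S_endo _ _ that] k kkl by blast
  define h where "h b = poly_eval V (S b) e" for b
  have "\<forall>x\<in>carrier V. h 0 x = \<zero>"
  proof (rule B)
    show "h b \<in> module_hom EE V V" for b
      unfolding h_def using vector_endomorphism.ev_hom[OF S_endo] e by blast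
    show "T (h b x) = h b (T x)" if x: "x \<in> carrier V" for b x
    proof -
      have "poly_eval V (S b) e (T x) = T (poly_eval V (S b) e x)"
        by (rule poly_eval_natural[OF S_endo endo])
          (use x e c_power_E T_closed module_hom_smult[OF endo] in \<open>auto simp: S_def\<close>)
      then show ?thesis by (simp add: h_def)
    qed
    show "h b (N x) = N (h (b + 1) x)" if x: "x \<in> carrier V" for b x
      unfolding h_def
    proof (rule poly_eval_natural[OF S_endo N_hom _ _ x])
      show "set_poly_expr e \<subseteq> carrier EE" using e by simp
      fix x assume x: "x \<in> carrier V"
      have "S b (N x) = (c_power b \<otimes>\<^bsub>EE\<^esub> c) \<odot> N (T x)"
        using smult_assoc1[of "c_power b" c "N (T x)"] c_power_E c x N_closed T_closed T_N
        by (simp add: S_def)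
      also have "\<dots> = N (S (b + 1) x)"
        using c_power_Suc[of b] N_smult[OF c_power_E T_closed[OF x], of "b + 1"] by (simp add: S_def)
      finally show "S b (N x) = N (S (b + 1) x)" .
    qed
    show "h b ` W i \<subseteq> W (i - 1)" if b: "\<bar>b\<bar> \<le> B" for b i
    proof
      fix y assume "y \<in> h b ` W i"
      then obtain x where x: "x \<in> W i" "y = h b x" by blast
      have xc: "x \<in> carrier V" using x W_carrier by blast
      have scaled: "poly_eval (gr i) (\<lambda>y. c_power b \<odot>\<^bsub>gr i\<^esub> T_gr i y) d (cl i x) =
          cl i (poly_eval V (S b) d x)" if "d \<in> polys_over EE" for d
        by (rule poly_eval_gr[OF _ S_hom S_W that x(1)])
          (simp add: weil_action_gr_cl S_def cl_smult c_power_E T_in_W)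
      have "c_power b \<in> ?P" using b by (intro imageI) auto
      moreover have "incl i (cl i x) \<in> carrier Gr"
        using module_hom_closed[OF incl_hom] cl_in_gr[OF x(1)] by blast
      ultimately have "poly_eval Gr (\<lambda>f. c_power b \<odot>\<^bsub>Gr\<^esub> T_Gr f) (Times k (Times k l)) (incl i (cl i x)) =
          poly_eval Gr (\<lambda>f. c_power b \<odot>\<^bsub>Gr\<^esub> T_Gr f) k (incl i (cl i x))"
        by (rule l(2))
      then have "poly_eval (gr i) (\<lambda>y. c_power b \<odot>\<^bsub>gr i\<^esub> T_gr i y) (Times k (Times k l)) (cl i x) =
          poly_eval (gr i) (\<lambda>y. c_power b \<odot>\<^bsub>gr i\<^esub> T_gr i y) k (cl i x)"
        unfolding Gr_sel(4,5) unfolding associated_graded_def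
          poly_eval_wd_direct_sum[where S = "\<lambda>i y. c_power b \<odot>\<^bsub>gr i\<^esub> T_gr i y"]
        by (drule_tac fun_cong[of _ _ i]) (simp add: incl_def)
      then have "cl i (poly_eval V (S b) k x) = cl i (poly_eval V (S b) (Times k (Times k l)) x)"
        unfolding scaled[OF kkl] scaled[OF k] by simp
      moreover have "poly_eval V (S b) d x \<in> W i" if "d \<in> polys_over EE" for d
        using vector_endomorphism.ev_stable[OF S_endo W_subspace S_W] that x by blast
      ultimately have "h b x \<in> W (i - 1)"
        unfolding h_def ev_e[OF xc] using cl_eq_iff k kkl by blast
      then show "y \<in> W (i - 1)" using x by simp
    qed
  qed
  moreover have "S 0 x = T x" if "x \<in> carrier V" for x
    using smult_one[OF T_closed[OF that]] by (simp add: S_def c_power_0)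
  then have S0: "poly_eval V (S 0) d x = poly_eval V T d x" if "d \<in> polys_over EE" "x \<in> carrier V" for d x
    using poly_eval_natural[OF vector_endomorphism_axioms, of id V "S 0" d x] that
    by (auto simp: module_hom_def)
  ultimately have "poly_eval V T (Times k (Times k l)) x = poly_eval V T k x" if x: "x \<in> carrier V" for x
  proof -
    have "poly_eval V T k x \<ominus> poly_eval V T (Times k (Times k l)) x = \<zero>"
      using \<open>\<forall>x\<in>carrier V. h 0 x = \<zero>\<close> x S0[OF k x] S0[OF kkl x] ev_e[OF x, of 0] by (simp add: h_def)
    then show ?thesis
      using add_minus_cancel[of "poly_eval V T k x" "poly_eval V T (Times k (Times k l)) x"] k kkl x ev_closed
      by simp
  qed
  then show "\<exists>l\<in>polys_over EE. \<forall>x\<in>carrier V. poly_eval V T (Times k (Times k l)) x = poly_eval V T k x"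
    using l(1) by blast
qed

theorem frobenius_semisimple_iff_Gr:
  "frobenius_semisimple EE frob V \<longleftrightarrow> frobenius_semisimple EE frob Gr"
proof -
  have "frobenius_semisimple EE frob V \<longleftrightarrow> regular_endomorphism EE V T"
    unfolding frobenius_semisimple_def by (rule semisimple_iff_regular[OF fd])
  also have "\<dots> \<longleftrightarrow> regular_endomorphism EE Gr T_Gr"
    using regular_imp_Gr_regular Gr_regular_imp_regular by blast
  also have "\<dots> \<longleftrightarrow> frobenius_semisimple EE frob Gr"
    unfolding frobenius_semisimple_def
    by (rule vector_endomorphism.semisimple_iff_regular[OF Gr_endomorphism Gr_fin_dim, symmetric])
  finally show ?thesis .
qed

end


section \<open>Mixed Weil--Deligne representations\<close>

text \<open>The scalar of \<open>mixed_rep\<close> is \<open>p\<close> to the power \<open>v(\<phi>) = - f\<close>. It is defined because the coefficient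
  field has characteristic 0, and it is the inverse of the cardinality \<open>p\<^sup>f\<close> of the residue field.\<close>

theorem corollary2p15:
  fixes p :: nat
    and Kbar :: "'k ring" and absval :: "'k \<Rightarrow> real" and Qp K :: "'k set"
    and frob :: "'k \<Rightarrow> 'k"
    and Ebar :: "'e ring" and E :: "'e set"
    and V :: "('e, 'v, 'k \<Rightarrow> 'k) wd_rep" and W :: "int \<Rightarrow> 'v set"
  assumes "p_adic_field p Kbar absval Qp K"
    and "geometric_frobenius p Kbar absval Qp K frob"
    and "algebraic_closure Ebar E"
    and "\<forall>n::nat. 0 < n \<longrightarrow> [n] \<cdot>\<^bsub>Ebar\<^esub> \<one>\<^bsub>Ebar\<^esub> \<noteq> \<zero>\<^bsub>Ebar\<^esub>"
    and "mixed_weil_deligne_rep p Kbar absval K frob Ebar E V W"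
  shows "frobenius_semisimple (Ebar\<lparr>carrier := E\<rparr>) frob V \<longleftrightarrow>
         frobenius_semisimple (Ebar\<lparr>carrier := E\<rparr>) frob (associated_graded V W)"
proof -
  let ?E = "Ebar\<lparr>carrier := E\<rparr>"
  interpret padic: p_adic p Kbar absval Qp K by (rule p_adic.intro) fact
  have field: "field Ebar" and sub: "subfield E Ebar"
    using assms(3) by (simp_all add: algebraic_closure_def)
  interpret F: field Ebar by (rule field)
  interpret E: field ?E by (rule F.subfield_iff(2)[OF sub])
  obtain f where f: "has_residue_degree Kbar absval Qp K f"
    "has_weil_degree p Kbar absval frob (- int f)" and frob: "frob \<in> carrier (weil_group p Kbar absval K)"
    using assms(2) by (auto simp: geometric_frobenius_def)
  have card: "residue_card Kbar absval K = p ^ f" by (rule padic.residue_card_eq[OF f(1)])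
  have p0: "0 < p" using padic.prime_p prime_gt_0_nat by blast
  define c where "c = ([p] \<cdot>\<^bsub>?E\<^esub> \<one>\<^bsub>?E\<^esub>) [^]\<^bsub>?E\<^esub> (- int f)"
  have pow: "([p] \<cdot>\<^bsub>?E\<^esub> \<one>\<^bsub>?E\<^esub>) [^]\<^bsub>?E\<^esub> n = [(p ^ n)] \<cdot>\<^bsub>Ebar\<^esub> \<one>\<^bsub>Ebar\<^esub>" for n :: nat
  proof -
    have "[p] \<cdot>\<^bsub>?E\<^esub> \<one>\<^bsub>?E\<^esub> = [p] \<cdot>\<^bsub>Ebar\<^esub> \<one>\<^bsub>Ebar\<^esub>" by (simp add: add_pow_def nat_pow_def)
    moreover have "x [^]\<^bsub>?E\<^esub> n = x [^]\<^bsub>Ebar\<^esub> n" for x by (simp add: nat_pow_def)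
    moreover have "([p] \<cdot>\<^bsub>Ebar\<^esub> \<one>\<^bsub>Ebar\<^esub>) [^]\<^bsub>Ebar\<^esub> n = [(p ^ n)] \<cdot>\<^bsub>Ebar\<^esub> \<one>\<^bsub>Ebar\<^esub>"
      by (induction n) (simp_all add: F.add_pow_rdistr F.add.nat_pow_pow mult.commute)
    ultimately show ?thesis by simp
  qed
  have q: "[(p ^ f)] \<cdot>\<^bsub>Ebar\<^esub> \<one>\<^bsub>Ebar\<^esub> \<in> E" "[(p ^ f)] \<cdot>\<^bsub>Ebar\<^esub> \<one>\<^bsub>Ebar\<^esub> \<noteq> \<zero>\<^bsub>Ebar\<^esub>"
  proof -
    have "([p] \<cdot>\<^bsub>?E\<^esub> \<one>\<^bsub>?E\<^esub>) [^]\<^bsub>?E\<^esub> f \<in> carrier ?E" by (intro E.nat_pow_closed E.add.nat_pow_closed E.one_closed)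
    then show "[(p ^ f)] \<cdot>\<^bsub>Ebar\<^esub> \<one>\<^bsub>Ebar\<^esub> \<in> E" unfolding pow by simp
    show "[(p ^ f)] \<cdot>\<^bsub>Ebar\<^esub> \<one>\<^bsub>Ebar\<^esub> \<noteq> \<zero>\<^bsub>Ebar\<^esub>" using assms(4) p0 by simp
  qed
  have c: "c \<in> E" "c \<otimes>\<^bsub>Ebar\<^esub> ([(p ^ f)] \<cdot>\<^bsub>Ebar\<^esub> \<one>\<^bsub>Ebar\<^esub>) = \<one>\<^bsub>Ebar\<^esub>"
  proof -
    let ?q = "[(p ^ f)] \<cdot>\<^bsub>Ebar\<^esub> \<one>\<^bsub>Ebar\<^esub>"
    have "?q \<in> Units ?E" using q E.field_Units by simp
    then have i: "inv\<^bsub>?E\<^esub> ?q \<in> carrier ?E" "inv\<^bsub>?E\<^esub> ?q \<otimes>\<^bsub>?E\<^esub> ?q = \<one>\<^bsub>?E\<^esub>"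
      using E.Units_inv_closed E.Units_l_inv by blast+
    have "c \<in> carrier ?E \<and> c \<otimes>\<^bsub>?E\<^esub> ?q = \<one>\<^bsub>?E\<^esub>"
    proof (cases "f = 0")
      case True
      then show ?thesis using E.one_closed E.l_one[OF E.one_closed] by (simp add: c_def)
    next
      case False
      then have "c = inv\<^bsub>?E\<^esub> (([p] \<cdot>\<^bsub>?E\<^esub> \<one>\<^bsub>?E\<^esub>) [^]\<^bsub>?E\<^esub> f)"
        by (simp add: c_def int_pow_def2)
      then have "c = inv\<^bsub>?E\<^esub> ?q" unfolding pow .
      then show ?thesis using i by simp
    qed
    then show "c \<in> E" "c \<otimes>\<^bsub>Ebar\<^esub> ?q = \<one>\<^bsub>Ebar\<^esub>" by simp_all
  qed
  have E_sub: "E \<subseteq> carrier Ebar" using subfieldE(3)[OF sub] .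
  have c0: "c \<noteq> \<zero>\<^bsub>Ebar\<^esub>" using c(2) q(1) E_sub by auto
  have wd: "weil_deligne_rep p Kbar absval K ?E V"
    and W: "\<And>i. weil_deligne_subrep p Kbar absval K ?E V (W i)"
    and fil: "mono W" "(\<Union>i. W i) = carrier V" "(\<Inter>i. W i) = {\<zero>\<^bsub>V\<^esub>}"
    and pure: "\<And>i. pure_of_weight (residue_card Kbar absval K) Ebar E frob i (graded_piece V W i)"
    using assms(5) by (auto simp: mixed_weil_deligne_rep_def)
  have "mixed_rep Ebar E V frob W (p ^ f) c"
  proof (intro mixed_rep.intro mixed_rep_axioms.intro)
    show "vector_endomorphism ?E V (weil_action V frob)"
      using wd frob by (simp add: weil_deligne_rep_def vector_endomorphism_def vector_endomorphism_axioms_def)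
    show "vectorspace.fin_dim ?E V" "monodromy V \<in> module_hom ?E V V"
      using wd by (simp_all add: weil_deligne_rep_def)
    show "weil_action V frob (monodromy V x) = c \<odot>\<^bsub>V\<^esub> monodromy V (weil_action V frob x)"
      if "x \<in> carrier V" for x
      using wd frob f(2) that unfolding weil_deligne_rep_def c_def by blast
    show "subspace ?E (W i) V" "weil_action V frob ` W i \<subseteq> W i" "monodromy V ` W i \<subseteq> W i" for i
      using W[of i] frob by (auto simp: weil_deligne_subrep_def)
    show "pure_of_weight (p ^ f) Ebar E frob i (graded_piece V W i)" for i
      using pure[of i] card by simp
    show "weil_number (p ^ f) Ebar (i - 2) (c \<otimes>\<^bsub>Ebar\<^esub> \<alpha>)" if "weil_number (p ^ f) Ebar i \<alpha>" for i \<alpha>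
      by (rule weil_number_shift[OF field _ c(2) _ that]) (use c(1) E_sub p0 in auto)
  qed (use field sub c c0 fil in auto)
  then show ?thesis by (rule mixed_rep.frobenius_semisimple_iff_Gr)
qed

end
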